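(* Let $N\ge 2$ and $x\in\mathbb R$, and let $H$ be the integrable spin-one XXZ Hamiltonian on $N$ sites with the diagonal twist. Then the non-zero parts of the spectra of $H$ restricted to the two subspaces $\{F=1\}$ and $\{F=-1\}$ of $V$ coincide, including degeneracies; i.e. for every $E\neq 0$, the eigenspaces of $H|_{\{F=1\}}$ and of $H|_{\{F=-1\}}$ for the eigenvalue $E$ have the same dimension.
   Context: $V=(\mathbb C^3)^{\otimes N}$, with single-site basis $|{\Uparrow}\rangle=(1,0,0)^t$, $|0\rangle=(0,1,0)^t$, $|{\Downarrow}\rangle=(0,0,1)^t$. Spin-one matrices: $s^1=\frac1{\sqrt2}\begin{pmatrix}0&1&0\\1&0&1\\0&1&0\end{pmatrix}$, $s^2=\frac1{\sqrt2}\begin{pmatrix}0&-\mathrm i&0\\ \mathrm i&0&-\mathrm i\\0&\mathrm i&0\end{pmatrix}$, $s^3=\mathrm{diag}(1,0,-1)$; $s^a_j$ is $s^a$ acting on site $j$. The Hamiltonian is $$H=\sum_{j=1}^N\Big(\sum_{a=1}^3J_a\big(s_j^as_{j+1}^a+2(s_j^a)^2\big)-\sum_{a,b=1}^3A_{ab}\,s_j^as_j^bs_{j+1}^as_{j+1}^b\Big),$$ with $J_1=J_2=1$, $J_3=\frac12(x^2-2)$, $A_{ab}=A_{ba}$, $A_{aa}=J_a$, $A_{12}=1$, $A_{13}=A_{23}=x-1$. Diagonal twist: $s^1_{N+1}=-s^1_1$, $s^2_{N+1}=-s^2_1$, $s^3_{N+1}=s^3_1$. The spin-reversal operator is $F=\begin{pmatrix}0&0&1\\0&1&0\\1&0&0\end{pmatrix}^{\otimes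 N}$; it commutes with $H$. *)

theory Defs
  imports "HOL-Analysis.Analysis" "HOL-Library.Function_Algebras"
begin

section \<open>The Hilbert space of the chain\<close>

text \<open>
  A basis state of the chain with \<open>N\<close> sites is a list of length \<open>N\<close> over the three-element
  index type \<open>3\<close>; the indices \<open>1\<close>, \<open>2\<close>, \<open>3\<close> of \<open>complex ^ 3\<close> stand for the single-site
  basis vectors \<open>(1,0,0)\<close> (up), \<open>(0,1,0)\<close> (zero), \<open>(0,0,1)\<close> (down). A vector is given by its
  coordinates with respect to these product states. Site \<open>j\<close> (counted from \<open>1\<close>) is list
  position \<open>j - 1\<close>.
\<close>

type_synonym config = "3 list"
type_synonym state = "config \<Rightarrow> complex"

definition configs :: "nat \<Rightarrow> config set" where
  "configs N = {\<sigma>. length \<sigma> = N}"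

text \<open>The type \<^typ>\<open>state\<close> contains the spaces for all \<open>N\<close>; \<open>chain_space N\<close> is the \<open>N\<close>-fold tensor power.\<close>

definition chain_space :: "nat \<Rightarrow> state set" where
  "chain_space N = {\<psi>. \<forall>\<sigma>. \<sigma> \<notin> configs N \<longrightarrow> \<psi> \<sigma> = 0}"

definition cscale :: "complex \<Rightarrow> state \<Rightarrow> state"  (infixr \<open>*\<^sub>V\<close> 75) where
  "c *\<^sub>V \<psi> = (\<lambda>\<sigma>. c * \<psi> \<sigma>)"

interpretation state: vector_space cscale
  by unfold_locales (auto simp: cscale_def fun_eq_iff algebra_simps)

section \<open>Tensor product operators\<close>

text \<open>\<open>tensor_op N M\<close> is the operator \<open>M 1 \<otimes> \<dots> \<otimes> M N\<close> on \<open>chain_space N\<close>.\<close>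

definition tensor_op :: "nat \<Rightarrow> (nat \<Rightarrow> complex ^ 3 ^ 3) \<Rightarrow> state \<Rightarrow> state" where
  "tensor_op N M \<psi> = (\<lambda>\<sigma>. if \<sigma> \<in> configs N
     then \<Sum>\<tau>\<in>configs N. (\<Prod>j\<in>{1..N}. M j $ (\<sigma> ! (j - 1)) $ (\<tau> ! (j - 1))) * \<psi> \<tau>
     else 0)"

definition site_op :: "nat \<Rightarrow> complex ^ 3 ^ 3 \<Rightarrow> nat \<Rightarrow> state \<Rightarrow> state" where
  "site_op N B j = tensor_op N (\<lambda>i. if i = j then B else mat 1)"

section \<open>The Hamiltonian and the spin reversal\<close>

text \<open>Note that \<open>3 = 0\<close> in the type \<open>3\<close>, whose elements are \<open>1\<close>, \<open>2\<close>, \<open>3\<close>.\<close>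

definition spin :: "3 \<Rightarrow> complex ^ 3 ^ 3" where
  "spin a =
    (if a = 1 then (1 / sqrt 2) *\<^sub>R
       vector [vector [0, 1, 0],
               vector [1, 0, 1],
               vector [0, 1, 0]]
     else if a = 2 then (1 / sqrt 2) *\<^sub>R
       vector [vector [0, - \<i>, 0],
               vector [\<i>, 0, - \<i>],
               vector [0, \<i>, 0]]
     else
       vector [vector [1, 0, 0],
               vector [0, 0, 0],
               vector [0, 0, -1]])"

text \<open>The operators \<open>s\<^sup>a\<^sub>j\<close> for \<open>j = 1, \<dots>, N + 1\<close>, with the diagonal twist at \<open>j = N + 1\<close>.\<close>

definition spin_op :: "nat \<Rightarrow> 3 \<Rightarrow> nat \<Rightarrow> state \<Rightarrow> state" where
  "spin_op N a j \<psi> =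
    (if j = N + 1 then (if a = 3 then 1 else - 1) *\<^sub>V site_op N (spin a) 1 \<psi>
     else site_op N (spin a) j \<psi>)"

text \<open>The coefficients \<open>J\<^sub>a\<close> and \<open>A\<^sub>a\<^sub>b\<close>.\<close>

definition coupling :: "real \<Rightarrow> 3 \<Rightarrow> real" where
  "coupling x a = (if a = 3 then (x\<^sup>2 - 2) / 2 else 1)"

definition quartic_coupling :: "real \<Rightarrow> 3 \<Rightarrow> 3 \<Rightarrow> real" where
  "quartic_coupling x a b = (if a = b then coupling x a else if a = 3 \<or> b = 3 then x - 1 else 1)"

definition hamiltonian :: "nat \<Rightarrow> real \<Rightarrow> state \<Rightarrow> state" where
  "hamiltonian N x \<psi> =
    (\<Sum>j\<in>{1..N}.
      (\<Sum>a\<in>UNIV. complex_of_real (coupling x a) *\<^sub>V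
         (spin_op N a j (spin_op N a (j + 1) \<psi>) + 2 *\<^sub>V spin_op N a j (spin_op N a j \<psi>)))
      - (\<Sum>a\<in>UNIV. \<Sum>b\<in>UNIV. complex_of_real (quartic_coupling x a b) *\<^sub>V
         spin_op N a j (spin_op N b j (spin_op N a (j + 1) (spin_op N b (j + 1) \<psi>)))))"

definition spin_reversal :: "nat \<Rightarrow> state \<Rightarrow> state" where
  "spin_reversal N = tensor_op N (\<lambda>j.
     vector [vector [0, 0, 1],
             vector [0, 1, 0],
             vector [1, 0, 0]])"

definition sector :: "nat \<Rightarrow> complex \<Rightarrow> state set" where
  "sector N \<epsilon> = {\<psi> \<in> chain_space N. spin_reversal N \<psi> = \<epsilon> *\<^sub>V \<psi>}"

text \<open>The eigenspace for \<open>E\<close> of the Hamiltonian restricted to the sector \<open>{F = \<epsilon>}\<close>.\<close>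

definition sector_eigenspace :: "nat \<Rightarrow> real \<Rightarrow> complex \<Rightarrow> complex \<Rightarrow> state set" where
  "sector_eigenspace N x \<epsilon> E = {\<psi> \<in> sector N \<epsilon>. hamiltonian N x \<psi> = E *\<^sub>V \<psi>}"

end

theory Submission
  imports Defs
begin

text \<open>
  Let \<open>F\<close> be the spin reversal and \<open>S\<close> the twisted translation. The transfer matrices with a spin-half auxiliary
  line and the diagonal twist commute with \<open>H\<close> and \<open>S\<close>, and they anticommute with \<open>F\<close>, because \<open>F\<close> exchanges
  the two auxiliary states while the twist changes sign. If \<open>A\<close> and \<open>B\<close> are two of them that commute with each other,
  moving \<open>A\<close> once around the trace shows \<open>Tr (F H^k A B S) = 0\<close>. By fusion there is a one-parameter family of
  such pairs with \<open>A B = T s - \<delta> s ^ N\<close>, where \<open>T s\<close> is the nineteen-vertex transfer matrix and \<open>\<delta> s\<close> is a scalar.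
  At \<open>s = 0\<close> the operator \<open>T s\<close> is proportional to the inverse of \<open>S\<close> and its logarithmic derivative is \<open>H\<close> up
  to a factor and an additive constant, so the value and the derivative of the trace at \<open>s = 0\<close> give \<open>Tr (F H^(k+1)) = 0\<close>. As \<open>H\<close> is
  self-adjoint, the projection \<open>P\<close> onto its eigenspace for \<open>E \<noteq> 0\<close> is a polynomial in \<open>H\<close> without
  constant term. Hence \<open>Tr (F P) = 0\<close>, and this trace is the difference of the two dimensions.
\<close>

section \<open>Operators on the chain and their trace\<close>

text \<open>\<open>A\<close> and \<open>B\<close> commute because fusing them in either order yields
  the same kernel: \<open>B\<close> is \<open>A\<close> with the spectral parameter lowered by one
  step, the distance at which the product of two spin-half lines becomes reducible. Both commute
  with \<open>H\<close> by a local condition on two neighbouring sites. The factor \<open>S\<close>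
  turns \<open>T 0\<close> into a multiple of the identity, so that the derivative produces
  \<open>H\<close> itself. It costs a second unknown: besides Tr (F H^k) there is Tr (F H^k S),
  which comes with the scalar term. Value and derivative at \<open>s = 0\<close> give two equations
  for these two numbers and Tr (F H^(k+1)), from which one would expect the last to be some multiple
  of Tr (F H^k). The multiple is zero because the logarithmic derivative of \<delta> at 0, which is
  (1 + x^2) / x, equals the additive constant per site in that of \<open>T\<close>. This coincidence
  is the reason why the exceptional eigenvalue is 0.\<close>

lemma finite_configs [simp]: "finite (configs N)"
  using finite_lists_length_eq[of "UNIV :: 3 set" N] by (simp add: configs_def)

lemma sum_configs_Suc:
  "(\<Sum>\<sigma>\<in>configs (Suc n). f \<sigma>) = (\<Sum>a\<in>UNIV. \<Sum>\<sigma>\<in>configs n. f (a # \<sigma>))"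
proof -
  have "configs (Suc n) = (\<lambda>(a, \<sigma>). a # \<sigma>) ` (UNIV \<times> configs n)"
    by (auto simp: configs_def length_Suc_conv image_iff)
  moreover have "inj_on (\<lambda>(a, \<sigma>). a # \<sigma>) (UNIV \<times> configs n)"
    by (auto simp: inj_on_def)
  ultimately show ?thesis
    by (simp add: sum.reindex sum.cartesian_product case_prod_unfold)
qed

definition ket :: "config \<Rightarrow> state" where
  "ket \<sigma> = (\<lambda>\<tau>. if \<tau> = \<sigma> then 1 else 0)"

definition kop :: "nat \<Rightarrow> (config \<Rightarrow> config \<Rightarrow> complex) \<Rightarrow> state \<Rightarrow> state" where
  "kop N m \<psi> = (\<lambda>\<sigma>. if \<sigma> \<in> configs N then \<Sum>\<tau>\<in>configs N. m \<sigma> \<tau> * \<psi> \<tau> else 0)"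

text \<open>Having a kernel bundles linearity, values in \<open>chain_space N\<close> and
  independence of the coordinates outside \<open>configs N\<close>, which matter because
  \<open>state\<close> contains the chains of all lengths.\<close>

definition is_op :: "nat \<Rightarrow> (state \<Rightarrow> state) \<Rightarrow> bool" where
  "is_op N A \<longleftrightarrow> (\<exists>m. A = kop N m)"

definition trace_op :: "nat \<Rightarrow> (state \<Rightarrow> state) \<Rightarrow> complex" where
  "trace_op N A = (\<Sum>\<sigma>\<in>configs N. A (ket \<sigma>) \<sigma>)"

text \<open>The identity function keeps coordinates outside \<open>configs N\<close> and so is not
  an \<open>is_op\<close>. This is why powers and polynomials of an operator are composed with
  \<open>id_op N\<close> below: their degree-zero term is the bare identity.\<close>

definition id_op :: "nat \<Rightarrow> state \<Rightarrow> state" where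
  "id_op N \<psi> = (\<lambda>\<sigma>. if \<sigma> \<in> configs N then \<psi> \<sigma> else 0)"

lemma is_op_kop [simp]: "is_op N (kop N m)"
  by (auto simp: is_op_def)

lemma kop_cong:
  "(\<And>\<sigma> \<tau>. \<sigma> \<in> configs N \<Longrightarrow> \<tau> \<in> configs N \<Longrightarrow> m \<sigma> \<tau> = m' \<sigma> \<tau>) \<Longrightarrow> kop N m = kop N m'"
  by (auto simp: kop_def fun_eq_iff intro!: sum.cong)

lemma kop_ket:
  assumes "\<tau> \<in> configs N"
  shows "kop N m (ket \<tau>) \<sigma> = (if \<sigma> \<in> configs N then m \<sigma> \<tau> else 0)"
  using assms by (simp add: kop_def ket_def if_distrib[of "\<lambda>z. _ * z"] cong: if_cong)

lemma is_op_expand: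
  assumes "is_op N A"
  shows "A \<psi> \<sigma> = (\<Sum>\<tau>\<in>configs N. A (ket \<tau>) \<sigma> * \<psi> \<tau>)"
proof -
  obtain m where m: "A = kop N m" using assms by (auto simp: is_op_def)
  show ?thesis unfolding m by (simp add: kop_ket) (simp add: kop_def)
qed

lemma is_op_outside: "is_op N A \<Longrightarrow> \<sigma> \<notin> configs N \<Longrightarrow> A \<psi> \<sigma> = 0"
  by (auto simp: is_op_def kop_def)

lemma is_op_in_chain_space: "is_op N A \<Longrightarrow> A \<psi> \<in> chain_space N"
  by (auto simp: chain_space_def is_op_outside)

lemma is_opI:
  assumes "finite I"
    and "\<And>\<psi> \<sigma>. A \<psi> \<sigma> = (if \<sigma> \<in> configs N then \<Sum>i\<in>I. c i \<sigma> * \<psi> (g i \<sigma>) else 0)"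
    and "\<And>i \<sigma>. i \<in> I \<Longrightarrow> \<sigma> \<in> configs N \<Longrightarrow> g i \<sigma> \<in> configs N"
  shows "is_op N A"
proof -
  have "A \<psi> \<sigma> = kop N (\<lambda>\<sigma> \<tau>. \<Sum>i\<in>I. if \<tau> = g i \<sigma> then c i \<sigma> else 0) \<psi> \<sigma>" for \<psi> \<sigma>
  proof (cases "\<sigma> \<in> configs N")
    case True
    have "(\<Sum>\<tau>\<in>configs N. (\<Sum>i\<in>I. if \<tau> = g i \<sigma> then c i \<sigma> else 0) * \<psi> \<tau>)
      = (\<Sum>i\<in>I. \<Sum>\<tau>\<in>configs N. if \<tau> = g i \<sigma> then c i \<sigma> * \<psi> \<tau> else 0)"
      by (subst sum.swap) (auto simp: sum_distrib_right intro!: sum.cong)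
    also have "\<dots> = (\<Sum>i\<in>I. c i \<sigma> * \<psi> (g i \<sigma>))"
      using assms(3) True by (intro sum.cong) auto
    finally show ?thesis
      using True by (simp add: assms(2) kop_def)
  qed (simp add: assms(2) kop_def)
  then have "A = kop N (\<lambda>\<sigma> \<tau>. \<Sum>i\<in>I. if \<tau> = g i \<sigma> then c i \<sigma> else 0)"
    by (intro ext)
  then show ?thesis by simp
qed

lemma is_op_add:
  assumes "is_op N A" shows "A (\<psi> + \<phi>) = A \<psi> + A \<phi>"
  using assms by (auto simp: is_op_def kop_def fun_eq_iff algebra_simps sum.distrib)

lemma is_op_scale:
  assumes "is_op N A" shows "A (c *\<^sub>V \<psi>) = c *\<^sub>V A \<psi>"
  using assms by (auto simp: is_op_def kop_def cscale_def fun_eq_iff sum_distrib_left mult_ac)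

lemma is_op_zero:
  assumes "is_op N A" shows "A 0 = 0"
  using assms by (auto simp: is_op_def kop_def fun_eq_iff)

lemma is_op_diff:
  assumes "is_op N A" shows "A (\<psi> - \<phi>) = A \<psi> - A \<phi>"
  using assms by (auto simp: is_op_def kop_def fun_eq_iff algebra_simps sum_subtractf)

lemma is_op_sum:
  assumes "is_op N A" shows "A (\<Sum>i\<in>I. f i) = (\<Sum>i\<in>I. A (f i))"
  using assms by (induction I rule: infinite_finite_induct) (auto simp: is_op_zero is_op_add)

lemma is_op_comp:
  assumes "is_op N A" "is_op N B"
  shows "is_op N (A \<circ> B)"
proof -
  obtain m m' where m: "A = kop N m" "B = kop N m'" using assms by (auto simp: is_op_def)
  have "kop N m (kop N m' \<psi>) = kop N (\<lambda>\<sigma> \<tau>. \<Sum>\<rho>\<in>configs N. m \<sigma> \<rho> * m' \<rho> \<tau>) \<psi>" for \<psi>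
    by (auto simp: kop_def fun_eq_iff sum_distrib_left sum_distrib_right mult_ac intro: sum.swap)
  then show ?thesis by (auto simp: m is_op_def fun_eq_iff)
qed

lemma kop_comp:
  "kop N m \<circ> kop N m' = kop N (\<lambda>\<sigma> \<tau>. \<Sum>\<rho>\<in>configs N. m \<sigma> \<rho> * m' \<rho> \<tau>)"
  by (auto simp: kop_def fun_eq_iff sum_distrib_left sum_distrib_right mult_ac intro: sum.swap)

lemma is_op_id: "is_op N (id_op N)"
  by (rule is_opI[of "{()}" _ _ "\<lambda>_ _. 1" "\<lambda>_ \<sigma>. \<sigma>"]) (auto simp: id_op_def)

lemma comp_id_op:
  assumes "is_op N A" shows "A \<circ> id_op N = A" "id_op N \<circ> A = A"
  using assms by (auto simp: is_op_def kop_def id_op_def fun_eq_iff)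

lemma is_op_funpow:
  assumes "is_op N A" shows "is_op N ((A ^^ k) \<circ> id_op N)"
proof (induction k)
  case (Suc k)
  then show ?case using is_op_comp[OF assms Suc] by (simp add: o_def)
qed (simp add: is_op_id)

lemma is_op_plus:
  assumes "is_op N A" "is_op N B" shows "is_op N (\<lambda>\<psi>. A \<psi> + B \<psi>)"
proof -
  obtain m m' where m: "A = kop N m" "B = kop N m'" using assms by (auto simp: is_op_def)
  have "(\<lambda>\<psi>. A \<psi> + B \<psi>) = kop N (\<lambda>\<sigma> \<tau>. m \<sigma> \<tau> + m' \<sigma> \<tau>)"
    by (auto simp: m kop_def fun_eq_iff algebra_simps sum.distrib)
  then show ?thesis by simp
qed

lemma is_op_smult:
  assumes "is_op N A" shows "is_op N (\<lambda>\<psi>. c *\<^sub>V A \<psi>)"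
proof -
  obtain m where m: "A = kop N m" using assms by (auto simp: is_op_def)
  have "(\<lambda>\<psi>. c *\<^sub>V A \<psi>) = kop N (\<lambda>\<sigma> \<tau>. c * m \<sigma> \<tau>)"
    by (auto simp: m kop_def cscale_def fun_eq_iff algebra_simps sum_distrib_left)
  then show ?thesis by simp
qed

lemma is_op_zero_fun: "is_op N (\<lambda>\<psi>. 0)"
proof -
  have "(\<lambda>\<psi>. 0) = kop N (\<lambda>\<sigma> \<tau>. 0)" by (auto simp: kop_def fun_eq_iff)
  then show ?thesis by simp
qed

lemma is_op_setsum:
  assumes "\<And>i. i \<in> I \<Longrightarrow> is_op N (A i)" shows "is_op N (\<lambda>\<psi>. \<Sum>i\<in>I. A i \<psi>)"
  using assms
  by (induction I rule: infinite_finite_induct) (auto simp: is_op_zero_fun intro: is_op_plus)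

lemma trace_op_comm:
  assumes "is_op N A" "is_op N B"
  shows "trace_op N (A \<circ> B) = trace_op N (B \<circ> A)"
proof -
  have "trace_op N (A \<circ> B) = (\<Sum>\<sigma>\<in>configs N. \<Sum>\<tau>\<in>configs N. A (ket \<tau>) \<sigma> * B (ket \<sigma>) \<tau>)"
    unfolding trace_op_def o_def by (subst is_op_expand[OF assms(1)]) simp
  also have "\<dots> = (\<Sum>\<tau>\<in>configs N. \<Sum>\<sigma>\<in>configs N. B (ket \<sigma>) \<tau> * A (ket \<tau>) \<sigma>)"
    by (subst sum.swap) (simp add: mult.commute)
  also have "\<dots> = trace_op N (B \<circ> A)"
    unfolding trace_op_def o_def by (subst (2) is_op_expand[OF assms(2)]) simp
  finally show ?thesis .
qed

lemma trace_op_plus: "trace_op N (\<lambda>\<psi>. A \<psi> + B \<psi>) = trace_op N A + trace_op N B"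
  by (simp add: trace_op_def sum.distrib)

lemma trace_op_smult: "trace_op N (\<lambda>\<psi>. c *\<^sub>V A \<psi>) = c * trace_op N A"
  by (simp add: trace_op_def cscale_def sum_distrib_left)

lemma trace_op_setsum: "trace_op N (\<lambda>\<psi>. \<Sum>i\<in>I. A i \<psi>) = (\<Sum>i\<in>I. trace_op N (A i))"
proof -
  have "(\<Sum>i\<in>I. A i \<psi>) \<sigma> = (\<Sum>i\<in>I. A i \<psi> \<sigma>)" for \<psi> \<sigma>
    by (induction I rule: infinite_finite_induct) auto
  then show ?thesis
    by (simp add: trace_op_def) (rule sum.swap)
qed

lemma trace_op_comp_kop:
  assumes "is_op N A"
  shows "trace_op N (A \<circ> kop N m) = (\<Sum>\<sigma>\<in>configs N. \<Sum>\<tau>\<in>configs N. A (ket \<tau>) \<sigma> * m \<tau> \<sigma>)"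
  unfolding trace_op_def o_def by (subst is_op_expand[OF assms]) (simp add: kop_ket)

section \<open>The twisted translation and the spin flip\<close>

text \<open>The diagonal of exp (i pi s^3), the rotation by pi about the third axis. Conjugation by
  it negates \<open>s^1\<close> and \<open>s^2\<close>, which is the boundary condition of the
  chain.\<close>

definition twist :: "3 \<Rightarrow> complex" where
  "twist a = (if a = 2 then 1 else - 1)"

lemma twist_square [simp]: "twist a * twist a = 1" "twist a * (twist a * z) = z"
  by (simp_all add: twist_def)

text \<open>Conjugation by it moves an operator one site to the right, twisting the site that
  crosses the boundary. Its \<open>N\<close>-th power is therefore the product of all
  \<open>twist\<close> factors rather than the identity.\<close>

definition shift :: "nat \<Rightarrow> state \<Rightarrow> state" where
  "shift N \<psi> = (\<lambda>\<sigma>. if \<sigma> \<in> configs N then twist (hd \<sigma>) * \<psi> (rotate1 \<sigma>) else 0)"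

definition unshift :: "nat \<Rightarrow> state \<Rightarrow> state" where
  "unshift N \<psi> = (\<lambda>\<sigma>. if \<sigma> \<in> configs N then twist (last \<sigma>) * \<psi> (last \<sigma> # butlast \<sigma>) else 0)"

lemma rotate1_configs [simp]: "rotate1 \<sigma> \<in> configs N \<longleftrightarrow> \<sigma> \<in> configs N"
  by (simp add: configs_def)

lemma last_butlast_configs: "N > 0 \<Longrightarrow> \<sigma> \<in> configs N \<Longrightarrow> last \<sigma> # butlast \<sigma> \<in> configs N"
  by (auto simp: configs_def)

lemma configs_nonempty: "N > 0 \<Longrightarrow> \<sigma> \<in> configs N \<Longrightarrow> \<sigma> \<noteq> []"
  by (auto simp: configs_def)

lemma rotate1_last_butlast: "\<sigma> \<noteq> [] \<Longrightarrow> rotate1 (last \<sigma> # butlast \<sigma>) = \<sigma>"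
  by simp

lemma last_rotate1: "\<sigma> \<noteq> [] \<Longrightarrow> last (rotate1 \<sigma>) = hd \<sigma>"
  by (cases \<sigma>) auto

lemma last_butlast_rotate1: "\<sigma> \<noteq> [] \<Longrightarrow> hd \<sigma> # butlast (rotate1 \<sigma>) = \<sigma>"
  by (cases \<sigma>) auto

lemma is_op_shift: "is_op N (shift N)"
  by (rule is_opI[of "{()}" _ _ "\<lambda>_ \<sigma>. twist (hd \<sigma>)" "\<lambda>_ \<sigma>. rotate1 \<sigma>"]) (auto simp: shift_def)

lemma is_op_unshift:
  assumes "N > 0" shows "is_op N (unshift N)"
  by (rule is_opI[of "{()}" _ _ "\<lambda>_ \<sigma>. twist (last \<sigma>)" "\<lambda>_ \<sigma>. last \<sigma> # butlast \<sigma>"])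
    (auto simp: unshift_def last_butlast_configs assms)

lemma shift_unshift:
  assumes "N > 0" shows "shift N \<circ> unshift N = id_op N"
  using assms by (auto simp: shift_def unshift_def id_op_def fun_eq_iff last_rotate1
      last_butlast_rotate1 configs_nonempty)

lemma unshift_shift:
  assumes "N > 0" shows "unshift N \<circ> shift N = id_op N"
  using assms by (auto simp: shift_def unshift_def id_op_def fun_eq_iff
      rotate1_last_butlast configs_nonempty last_butlast_configs simp del: rotate1.simps)

lemma sum_rotate1: "(\<Sum>\<sigma>\<in>configs N. f (rotate1 \<sigma>)) = (\<Sum>\<sigma>\<in>configs N. f \<sigma>)"
proof -
  have "rotate1 ` configs N = configs N"
    by (rule endo_inj_surj) (auto intro: inj_on_subset[OF inj_rotate1])
  then show ?thesis
    using sum.reindex[of rotate1 "configs N" f] inj_on_subset[OF inj_rotate1 subset_UNIV, of "configs N"] by simp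
qed

lemma shift_conj_kop:
  assumes "N > 0"
  shows "shift N \<circ> kop N m \<circ> unshift N
    = kop N (\<lambda>\<sigma> \<tau>. twist (hd \<sigma>) * twist (hd \<tau>) * m (rotate1 \<sigma>) (rotate1 \<tau>))"
proof (intro ext)
  fix \<psi> \<sigma>
  show "(shift N \<circ> kop N m \<circ> unshift N) \<psi> \<sigma> =
    kop N (\<lambda>\<sigma> \<tau>. twist (hd \<sigma>) * twist (hd \<tau>) * m (rotate1 \<sigma>) (rotate1 \<tau>)) \<psi> \<sigma>"
  proof (cases "\<sigma> \<in> configs N")
    case True
    then have "(shift N \<circ> kop N m \<circ> unshift N) \<psi> \<sigma>
      = twist (hd \<sigma>) * (\<Sum>\<tau>\<in>configs N. m (rotate1 \<sigma>) \<tau> * unshift N \<psi> \<tau>)"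
      by (simp add: shift_def kop_def)
    also have "(\<Sum>\<tau>\<in>configs N. m (rotate1 \<sigma>) \<tau> * unshift N \<psi> \<tau>)
      = (\<Sum>\<tau>\<in>configs N. m (rotate1 \<sigma>) (rotate1 \<tau>) * unshift N \<psi> (rotate1 \<tau>))"
      by (rule sum_rotate1[symmetric])
    also have "\<dots> = (\<Sum>\<tau>\<in>configs N. m (rotate1 \<sigma>) (rotate1 \<tau>) * (twist (hd \<tau>) * \<psi> \<tau>))"
      using assms by (intro sum.cong)
        (auto simp: unshift_def last_rotate1 last_butlast_rotate1 configs_nonempty)
    finally show ?thesis
      using True by (simp add: kop_def sum_distrib_left mult_ac)
  qed (simp add: shift_def kop_def)
qed

section \<open>The spin reversal as a permutation of configurations\<close>

definition flip :: "3 \<Rightarrow> 3" where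
  "flip a = (if a = 1 then 3 else if a = 3 then 1 else 2)"

lemma flip_flip [simp]: "flip (flip a) = a"
  using exhaust_3[of a] by (auto simp: flip_def)

lemma twist_flip [simp]: "twist (flip a) = twist a"
  using exhaust_3[of a] by (auto simp: flip_def twist_def)

lemma map_flip_flip [simp]: "map flip (map flip \<sigma>) = \<sigma>"
  by (induction \<sigma>) auto

lemma map_flip_configs [simp]: "map flip \<sigma> \<in> configs N \<longleftrightarrow> \<sigma> \<in> configs N"
  by (simp add: configs_def)

lemma spin_reversal_eq:
  "spin_reversal N \<psi> = (\<lambda>\<sigma>. if \<sigma> \<in> configs N then \<psi> (map flip \<sigma>) else 0)"
proof (rule ext)
  fix \<sigma>
  let ?M = "vector [vector [0, 0, 1], vector [0, 1, 0], vector [1, 0, 0]] :: complex ^ 3 ^ 3"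
  have M: "?M $ a $ b = (if b = flip a then 1 else 0)" for a b
    using exhaust_3[of a] exhaust_3[of b] by (elim disjE; hypsubst; simp add: flip_def)
  show "spin_reversal N \<psi> \<sigma> = (if \<sigma> \<in> configs N then \<psi> (map flip \<sigma>) else 0)"
  proof (cases "\<sigma> \<in> configs N")
    case True
    have "(\<Prod>j\<in>{1..N}. if \<tau> ! (j - 1) = flip (\<sigma> ! (j - 1)) then 1 else 0 :: complex)
      = (if \<tau> = map flip \<sigma> then 1 else 0)" if "\<tau> \<in> configs N" for \<tau>
    proof -
      have eq: "\<tau> = map flip \<sigma> \<longleftrightarrow> (\<forall>j\<in>{1..N}. \<tau> ! (j - 1) = flip (\<sigma> ! (j - 1)))"
      proof
        assume *: "\<forall>j\<in>{1..N}. \<tau> ! (j - 1) = flip (\<sigma> ! (j - 1))"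
        have "\<tau> ! j = flip (\<sigma> ! j)" if "j < N" for j
          using *[rule_format, of "Suc j"] that by simp
        then show "\<tau> = map flip \<sigma>"
          using True that by (auto simp: configs_def list_eq_iff_nth_eq)
      qed (use True in \<open>auto simp: configs_def\<close>)
      show ?thesis
        unfolding eq by (auto intro!: prod.neutral prod_zero)
    qed
    then show ?thesis
      using True by (simp add: spin_reversal_def tensor_op_def M if_distrib[of "\<lambda>z. z * _"] cong: if_cong)
  qed (simp add: spin_reversal_def tensor_op_def)
qed

lemma is_op_spin_reversal: "is_op N (spin_reversal N)"
  by (rule is_opI[of "{()}" _ _ "\<lambda>_ \<sigma>. 1" "\<lambda>_ \<sigma>. map flip \<sigma>"]) (auto simp: spin_reversal_eq)

lemma spin_reversal_involution: "spin_reversal N \<circ> spin_reversal N = id_op N"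
  by (auto simp: spin_reversal_eq id_op_def fun_eq_iff simp del: map_map)

lemma shift_spin_reversal: "shift N \<circ> spin_reversal N = spin_reversal N \<circ> shift N"
proof (cases "N = 0")
  case False
  then show ?thesis
    by (auto simp: spin_reversal_eq shift_def fun_eq_iff rotate1_map hd_map configs_nonempty)
qed (auto simp: spin_reversal_eq shift_def fun_eq_iff configs_def)

section \<open>Matrix product operators\<close>

text \<open>\<open>T i j a b\<close> is the weight of a vertex with auxiliary indices \<open>i\<close>, \<open>j\<close> and with matrix element \<open>a\<close>, \<open>b\<close> on the site.\<close>

type_synonym 'n weight = "'n \<Rightarrow> 'n \<Rightarrow> 3 \<Rightarrow> 3 \<Rightarrow> complex"

text \<open>A list of weights allows one deviating vertex at any site. Such defects arise twice: as
  boundary terms of local commutators and as terms of the Leibniz rule.\<close>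

primrec monodromy :: "('n::finite) weight list \<Rightarrow> 'n \<Rightarrow> 'n \<Rightarrow> config \<Rightarrow> config \<Rightarrow> complex" where
  "monodromy [] i j \<sigma> \<tau> = (if i = j then 1 else 0)"
| "monodromy (T # Ts) i j \<sigma> \<tau> =
    (\<Sum>k\<in>UNIV. T i k (hd \<sigma>) (hd \<tau>) * monodromy Ts k j (tl \<sigma>) (tl \<tau>))"

definition trans_kernel :: "('n::finite \<Rightarrow> complex) \<Rightarrow> 'n weight list \<Rightarrow> config \<Rightarrow> config \<Rightarrow> complex" where
  "trans_kernel K Ts \<sigma> \<tau> = (\<Sum>i\<in>UNIV. K i * monodromy Ts i i \<sigma> \<tau>)"

definition transfer :: "('n::finite \<Rightarrow> complex) \<Rightarrow> 'n weight list \<Rightarrow> state \<Rightarrow> state" where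
  "transfer K Ts = kop (length Ts) (trans_kernel K Ts)"

lemma monodromy_snoc:
  assumes "length \<sigma> = length Ts" "length \<tau> = length Ts"
  shows "monodromy (Ts @ [T]) i j (\<sigma> @ [a]) (\<tau> @ [b]) = (\<Sum>k\<in>UNIV. monodromy Ts i k \<sigma> \<tau> * T k j a b)"
  using assms
proof (induction Ts arbitrary: i \<sigma> \<tau>)
  case Nil
  then show ?case
    by (simp add: if_distrib[of "\<lambda>z. z * _"] if_distrib[of "\<lambda>z. _ * z"] cong: if_cong)
next
  case (Cons U Ts)
  obtain c \<sigma>' d \<tau>' where eq: "\<sigma> = c # \<sigma>'" "\<tau> = d # \<tau>'"
    using Cons.prems by (metis length_Suc_conv length_Cons)
  then show ?case
    using Cons by (simp add: sum_distrib_left sum_distrib_right mult.assoc) (rule sum.swap)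
qed

text \<open>Equivalently, the vertex commutes with the simultaneous rotation \<open>K\<close> of the
  auxiliary space and \<open>twist\<close> of the site, since \<open>twist\<close> squares to
  one.\<close>

definition twist_covariant :: "('n \<Rightarrow> complex) \<Rightarrow> 'n weight \<Rightarrow> bool" where
  "twist_covariant K T \<longleftrightarrow> (\<forall>i j a b. K i * T i j a b = twist a * twist b * T i j a b * K j)"

text \<open>Cyclicity of the auxiliary trace: to reach the other end the first vertex has to pass
  \<open>K\<close>, and covariance converts this into a twist of its site.\<close>

lemma trans_kernel_rotate:
  assumes "twist_covariant K T" "length \<sigma> = length Ts" "length \<tau> = length Ts"
  shows "trans_kernel K (T # Ts) (a # \<sigma>) (b # \<tau>)
    = twist a * twist b * trans_kernel K (Ts @ [T]) (\<sigma> @ [a]) (\<tau> @ [b])"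
proof -
  have "trans_kernel K (T # Ts) (a # \<sigma>) (b # \<tau>)
    = (\<Sum>i\<in>UNIV. \<Sum>k\<in>UNIV. K i * T i k a b * monodromy Ts k i \<sigma> \<tau>)"
    by (simp add: trans_kernel_def sum_distrib_left mult.assoc)
  also have "\<dots> = (\<Sum>i\<in>UNIV. \<Sum>k\<in>UNIV. twist a * twist b * (K k * (monodromy Ts k i \<sigma> \<tau> * T i k a b)))"
    using assms(1) by (intro sum.cong) (auto simp: twist_covariant_def)
  also have "\<dots> = (\<Sum>k\<in>UNIV. \<Sum>i\<in>UNIV. twist a * twist b * (K k * (monodromy Ts k i \<sigma> \<tau> * T i k a b)))"
    by (rule sum.swap)
  also have "\<dots> = twist a * twist b * trans_kernel K (Ts @ [T]) (\<sigma> @ [a]) (\<tau> @ [b])"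
    using assms(2,3) by (simp add: trans_kernel_def monodromy_snoc sum_distrib_left)
  finally show ?thesis .
qed

lemma transfer_rotate:
  assumes "twist_covariant K T" "N = Suc (length Ts)"
  shows "transfer K (T # Ts) = shift N \<circ> transfer K (Ts @ [T]) \<circ> unshift N"
proof -
  have N: "N > 0" "length (T # Ts) = N" "length (Ts @ [T]) = N" using assms(2) by auto
  show ?thesis
    unfolding transfer_def N shift_conj_kop[OF N(1)]
    using assms by (intro kop_cong) (auto simp: configs_def length_Suc_conv trans_kernel_rotate)
qed

lemma is_op_transfer: "length Ts = N \<Longrightarrow> is_op N (transfer K Ts)"
  by (auto simp: transfer_def)

lemma shift_transfer:
  assumes "twist_covariant K T" "N > 0"
  shows "shift N \<circ> transfer K (replicate N T) = transfer K (replicate N T) \<circ> shift N"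
proof -
  obtain n where n: "N = Suc n" using assms(2) by (cases N) auto
  have "transfer K (replicate N T) = shift N \<circ> transfer K (replicate N T) \<circ> unshift N"
    using transfer_rotate[OF assms(1), of N "replicate n T"] n
    by (simp add: replicate_append_same)
  then have "transfer K (replicate N T) \<circ> shift N
    = shift N \<circ> transfer K (replicate N T) \<circ> unshift N \<circ> shift N"
    by (rule arg_cong[of _ _ "\<lambda>X. X \<circ> shift N"])
  then show ?thesis
    by (simp add: unshift_shift[OF assms(2)] comp_id_op is_op_comp is_op_shift is_op_transfer comp_assoc)
qed

text \<open>The local relation lets \<open>Q\<close> slide through the chain one site at a time.
  \<open>Q\<close> may be rectangular, so it can project onto or embed a smaller auxiliary
  space.\<close>

lemma monodromy_intertwine:
  fixes Q :: "'m::finite \<Rightarrow> 'n::finite \<Rightarrow> complex"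
  assumes "\<And>i j a b. (\<Sum>k\<in>UNIV. Q i k * M k j a b) = (\<Sum>k\<in>UNIV. T i k a b * Q k j)"
  shows "(\<Sum>k\<in>UNIV. Q i k * monodromy (replicate n M) k j \<sigma> \<tau>)
    = (\<Sum>k\<in>UNIV. monodromy (replicate n T) i k \<sigma> \<tau> * Q k j)"
proof (induction n arbitrary: i \<sigma> \<tau>)
  case 0
  then show ?case
    by (simp add: if_distrib[of "\<lambda>z. z * _"] if_distrib[of "\<lambda>z. _ * z"] cong: if_cong)
next
  case (Suc n)
  let ?a = "hd \<sigma>" and ?b = "hd \<tau>" and ?\<sigma> = "tl \<sigma>" and ?\<tau> = "tl \<tau>"
  have "(\<Sum>k\<in>UNIV. Q i k * monodromy (replicate (Suc n) M) k j \<sigma> \<tau>)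
    = (\<Sum>l\<in>UNIV. (\<Sum>k\<in>UNIV. Q i k * M k l ?a ?b) * monodromy (replicate n M) l j ?\<sigma> ?\<tau>)"
    by (simp add: sum_distrib_left sum_distrib_right mult.assoc) (rule sum.swap)
  also have "\<dots> = (\<Sum>k\<in>UNIV. T i k ?a ?b * (\<Sum>l\<in>UNIV. Q k l * monodromy (replicate n M) l j ?\<sigma> ?\<tau>))"
    unfolding assms by (simp add: sum_distrib_left sum_distrib_right mult.assoc) (rule sum.swap)
  also have "\<dots> = (\<Sum>l\<in>UNIV. monodromy (replicate (Suc n) T) i l \<sigma> \<tau> * Q l j)"
    unfolding Suc by (simp add: sum_distrib_left sum_distrib_right mult.assoc) (rule sum.swap)
  finally show ?case .
qed

definition weight_comp :: "'m weight \<Rightarrow> 'n weight \<Rightarrow> ('m \<times> 'n) weight" where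
  "weight_comp L M = (\<lambda>(i, i') (j, j') a b. \<Sum>c\<in>UNIV. L i j a c * M i' j' c b)"

lemma sum_UNIV_prod: "(\<Sum>p\<in>UNIV. f p) = (\<Sum>i\<in>UNIV. \<Sum>j\<in>UNIV. f (i, j))"
  by (simp add: sum.cartesian_product UNIV_Times_UNIV)

lemma sum_rotate3:
  "(\<Sum>c\<in>A. \<Sum>\<rho>\<in>B. \<Sum>k\<in>C. f c \<rho> k) = (\<Sum>k\<in>C. \<Sum>c\<in>A. \<Sum>\<rho>\<in>B. f c \<rho> k)"
proof -
  have "(\<Sum>c\<in>A. \<Sum>\<rho>\<in>B. \<Sum>k\<in>C. f c \<rho> k) = (\<Sum>c\<in>A. \<Sum>k\<in>C. \<Sum>\<rho>\<in>B. f c \<rho> k)"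
    by (intro sum.cong refl sum.swap)
  also have "\<dots> = (\<Sum>k\<in>C. \<Sum>c\<in>A. \<Sum>\<rho>\<in>B. f c \<rho> k)"
    by (rule sum.swap)
  finally show ?thesis .
qed

lemma monodromy_comp:
  fixes L :: "('m::finite) weight" and M :: "('n::finite) weight"
  shows "(\<Sum>\<rho>\<in>configs n. monodromy (replicate n L) i j \<sigma> \<rho> * monodromy (replicate n M) i' j' \<rho> \<tau>)
    = monodromy (replicate n (weight_comp L M)) (i, i') (j, j') \<sigma> \<tau>"
proof (induction n arbitrary: i i' \<sigma> \<tau>)
  case 0
  then show ?case by (simp add: configs_def)
next
  case (Suc n)
  let ?a = "hd \<sigma>" and ?b = "hd \<tau>" and ?\<sigma> = "tl \<sigma>" and ?\<tau> = "tl \<tau>"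
  have "(\<Sum>\<rho>\<in>configs (Suc n). monodromy (replicate (Suc n) L) i j \<sigma> \<rho> * monodromy (replicate (Suc n) M) i' j' \<rho> \<tau>)
    = (\<Sum>c\<in>UNIV. \<Sum>\<rho>\<in>configs n. \<Sum>k\<in>UNIV. \<Sum>k'\<in>UNIV. (L i k ?a c * M i' k' c ?b) *
        (monodromy (replicate n L) k j ?\<sigma> \<rho> * monodromy (replicate n M) k' j' \<rho> ?\<tau>))"
    by (simp add: sum_configs_Suc sum_product mult_ac)
  also have "\<dots> = (\<Sum>k\<in>UNIV. \<Sum>k'\<in>UNIV. \<Sum>c\<in>UNIV. \<Sum>\<rho>\<in>configs n. (L i k ?a c * M i' k' c ?b) *
        (monodromy (replicate n L) k j ?\<sigma> \<rho> * monodromy (replicate n M) k' j' \<rho> ?\<tau>))"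
    by (subst sum_rotate3) (intro sum.cong refl sum_rotate3)
  also have "\<dots> = (\<Sum>k\<in>UNIV. \<Sum>k'\<in>UNIV. weight_comp L M (i, i') (k, k') ?a ?b *
      monodromy (replicate n (weight_comp L M)) (k, k') (j, j') ?\<sigma> ?\<tau>)"
    unfolding Suc[symmetric] by (simp add: weight_comp_def sum_product)
  finally show ?case
    by (simp add: sum_UNIV_prod)
qed

lemma transfer_comp:
  "transfer K (replicate N L) \<circ> transfer K' (replicate N M)
    = transfer (\<lambda>(i, i'). K i * K' i') (replicate N (weight_comp L M))"
proof -
  have "(\<Sum>\<rho>\<in>configs N. trans_kernel K (replicate N L) \<sigma> \<rho> * trans_kernel K' (replicate N M) \<rho> \<tau>)
    = trans_kernel (\<lambda>(i, i'). K i * K' i') (replicate N (weight_comp L M)) \<sigma> \<tau>" for \<sigma> \<tau>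
  proof -
    have "(\<Sum>\<rho>\<in>configs N. trans_kernel K (replicate N L) \<sigma> \<rho> * trans_kernel K' (replicate N M) \<rho> \<tau>)
      = (\<Sum>\<rho>\<in>configs N. \<Sum>i\<in>UNIV. \<Sum>i'\<in>UNIV. (K i * K' i') *
          (monodromy (replicate N L) i i \<sigma> \<rho> * monodromy (replicate N M) i' i' \<rho> \<tau>))"
      by (simp add: trans_kernel_def sum_product mult_ac)
    also have "\<dots> = (\<Sum>i\<in>UNIV. \<Sum>i'\<in>UNIV. \<Sum>\<rho>\<in>configs N. (K i * K' i') *
          (monodromy (replicate N L) i i \<sigma> \<rho> * monodromy (replicate N M) i' i' \<rho> \<tau>))"
      by (subst sum.swap, rule sum.cong[OF refl], rule sum.swap)
    finally show ?thesis
      by (simp add: trans_kernel_def sum_UNIV_prod monodromy_comp[symmetric] sum_distrib_left)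
  qed
  then show ?thesis
    by (simp add: transfer_def kop_comp)
qed

section \<open>Local weights\<close>

text \<open>The matrix elements of the two-site density of the Hamiltonian. The diagonal ones are not symmetric
  under exchange of the two sites because the quadratic term acts on the left site only.\<close>

definition bond_weight :: "complex \<Rightarrow> 3 \<Rightarrow> 3 \<Rightarrow> 3 \<Rightarrow> 3 \<Rightarrow> complex" where
  "bond_weight x a b c d =
    (if a = c \<and> b = d then
       (if a = 2 then (if b = 2 then 2 else 3)
        else if b = 2 then x\<^sup>2 - 1 else if a = b then x\<^sup>2 else 1)
     else if a = d \<and> b = c then (if a = 2 \<or> b = 2 then 1 else - 1)
     else if (a = 2 \<and> b = 2 \<and> c \<noteq> 2 \<and> d \<noteq> 2 \<and> c \<noteq> d) \<or> (c = 2 \<and> d = 2 \<and> a \<noteq> 2 \<and> b \<noteq> 2 \<and> a \<noteq> b) then x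
     else 0)"

text \<open>The vertex weights for a spin-one site and a spin-half auxiliary line, where \<open>True\<close> is auxiliary spin up.
  With \<open>x = q + 1/q\<close> and \<open>[u] = (q^u - q^(-u)) / (q - 1/q)\<close> the usual weights are the case
  \<open>al = [u]\<close>, \<open>be = [u + 1]\<close>, so that \<open>x * al - be = [u - 1]\<close>. Keeping \<open>al\<close> and \<open>be\<close> free avoids both
  \<open>q\<close> and the singular points \<open>x = 2\<close>, \<open>x = -2\<close>. Only the product of the two off-diagonal weights
  matters in a transfer matrix, hence the asymmetric choice \<open>g\<close> and \<open>1\<close>.\<close>

definition six_vertex :: "complex \<Rightarrow> complex \<Rightarrow> complex \<Rightarrow> complex \<Rightarrow> bool weight" where
  "six_vertex x g al be i j a b =
    (if i = j then
       (if a \<noteq> b then 0 else if a = 2 then al else if (a = 1) = i then be else x * al - be)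
     else if i then (if a = 2 \<and> b = 1 \<or> a = 3 \<and> b = 2 then g else 0)
     else (if a = 1 \<and> b = 2 \<or> a = 2 \<and> b = 3 then 1 else 0))"

text \<open>The boundary term of Sutherland's condition, found by solving the linear system in \<open>sutherland\<close> below.\<close>

definition six_vertex_defect :: "complex \<Rightarrow> complex \<Rightarrow> complex \<Rightarrow> complex \<Rightarrow> bool weight" where
  "six_vertex_defect x g al be i j a b =
    (if i = j then
       (if a \<noteq> b then 0 else if a = 2 then x\<^sup>2 * al - x * be else if (a = 1) = i then x * al else x^3 * al - x\<^sup>2 * be - x * al)
     else if i then (if a = 2 \<and> b = 1 then 2 * g else if a = 3 \<and> b = 2 then (x\<^sup>2 - 2) * g else 0)
     else (if a = 1 \<and> b = 2 then x\<^sup>2 - 2 else if a = 2 \<and> b = 3 then 2 else 0))"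

text \<open>The triplet block of the product of two six-vertex weights. At \<open>s = 0\<close> it is \<open>x\<close> times a permutation.\<close>

definition nineteen_vertex :: "complex \<Rightarrow> complex \<Rightarrow> 3 weight" where
  "nineteen_vertex x s i j a b =
    (let g = 1 + x * s + s\<^sup>2 in
     if i = b \<and> j = a then
       (if i = j then (if i = 2 then x * g - s else x + s)
        else if i = 1 \<and> j = 3 then x * g\<^sup>2 else if i = 1 \<or> j = 3 then x * g else x)
     else if i = j \<and> a = b then (if i = 2 \<or> a = 2 then - s else s * (1 + x * s))
     else if i = 3 \<and> a = 1 \<and> b = 2 \<and> j = 2 \<or> i = 2 \<and> a = 2 \<and> b = 3 \<and> j = 1 then - x * s
     else if i = 2 \<and> a = 2 \<and> b = 1 \<and> j = 3 \<or> i = 1 \<and> a = 3 \<and> b = 2 \<and> j = 2 then - x * s * g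
     else 0)"

lemma bond_weight_sym: "bond_weight x c d a b = bond_weight x a b c d"
  using exhaust_3[of a] exhaust_3[of b] exhaust_3[of c] exhaust_3[of d]
  by (elim disjE; hypsubst; simp add: bond_weight_def)

lemma bond_weight_apply:
  "(\<Sum>c\<in>UNIV. \<Sum>d\<in>UNIV. bond_weight x a b c d * f c d) =
     (if a = 2 \<and> b = 2 then 2 * f 2 2 + x * f 1 3 + x * f 3 1
      else if a = b then x\<^sup>2 * f a a
      else if a = 2 then 3 * f a b + f b a
      else if b = 2 then (x\<^sup>2 - 1) * f a b + f b a
      else f a b - f b a + x * f 2 2)"
  using exhaust_3[of a] exhaust_3[of b]
  by (elim disjE; hypsubst; simp add: sum_3 bond_weight_def)

text \<open>Sutherland's condition, verified as 324 polynomial identities. The value of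
  \<open>g\<close> fixes the product of the off-diagonal weights: for \<open>al = [u]\<close>,
  \<open>be = [u + 1]\<close> the form \<open>al\<^sup>2 + be\<^sup>2 - x * al * be\<close> is
  identically 1, and being homogeneous it allows the pair to be rescaled.\<close>

lemma sutherland:
  assumes "g = x * (al\<^sup>2 + be\<^sup>2 - x * al * be)"
  shows "(\<Sum>c\<in>UNIV. \<Sum>d\<in>UNIV. bond_weight x a a' c d * (\<Sum>k\<in>UNIV. six_vertex x g al be i k c b * six_vertex x g al be k j d b'))
   - (\<Sum>c\<in>UNIV. \<Sum>d\<in>UNIV. bond_weight x b b' c d * (\<Sum>k\<in>UNIV. six_vertex x g al be i k a c * six_vertex x g al be k j a' d))
   = (\<Sum>k\<in>UNIV. six_vertex_defect x g al be i k a b * six_vertex x g al be k j a' b') - (\<Sum>k\<in>UNIV. six_vertex x g al be i k a b * six_vertex_defect x g al be k j a' b')"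
  unfolding bond_weight_apply UNIV_bool
  using exhaust_3[of a] exhaust_3[of a'] exhaust_3[of b] exhaust_3[of b']
  by (elim disjE; hypsubst; cases i; cases j;
      simp add: six_vertex_def six_vertex_defect_def;
      simp add: assms algebra_simps power2_eq_square power3_eq_cube)

section \<open>Matrix elements of the spin operators and of the density of the Hamiltonian\<close>

definition inv_sqrt2 :: complex where
  "inv_sqrt2 = complex_of_real (1 / sqrt 2)"

text \<open>Once the entries of the spin matrices are tabulated, the constant stays opaque and is
  eliminated through its square; no arithmetic with square roots enters the case
  distinctions.\<close>

lemma inv_sqrt2_square: "inv_sqrt2 * inv_sqrt2 = 1 / 2"
  unfolding inv_sqrt2_def of_real_mult[symmetric] by simp

lemma inv_sqrt2_i: "\<i> * inv_sqrt2 * (\<i> * inv_sqrt2) = - (1 / 2)" "\<i> * inv_sqrt2 * inv_sqrt2 = \<i> / 2" "inv_sqrt2 * (\<i> * inv_sqrt2) = \<i> / 2"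
proof -
  have "\<i> * inv_sqrt2 * (\<i> * inv_sqrt2) = (\<i> * \<i>) * (inv_sqrt2 * inv_sqrt2)" "\<i> * inv_sqrt2 * inv_sqrt2 = \<i> * (inv_sqrt2 * inv_sqrt2)" "inv_sqrt2 * (\<i> * inv_sqrt2) = \<i> * (inv_sqrt2 * inv_sqrt2)"
    by (simp_all only: mult_ac)
  then show "\<i> * inv_sqrt2 * (\<i> * inv_sqrt2) = - (1 / 2)" "\<i> * inv_sqrt2 * inv_sqrt2 = \<i> / 2" "inv_sqrt2 * (\<i> * inv_sqrt2) = \<i> / 2"
    by (simp_all add: inv_sqrt2_square)
qed

lemma spin_entry:
  "spin 1 $ p $ c = (if p = c \<or> p \<noteq> 2 \<and> c \<noteq> 2 then 0 else inv_sqrt2)"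
  "spin 2 $ p $ c = (if p = c \<or> p \<noteq> 2 \<and> c \<noteq> 2 then 0 else if p = 1 \<or> c = 3 then - \<i> * inv_sqrt2 else \<i> * inv_sqrt2)"
  "spin 3 $ p $ c = (if p = c then if p = 1 then 1 else if p = 2 then 0 else - 1 else 0)"
  unfolding spin_def
  subgoal using exhaust_3[of p] exhaust_3[of c]
  by (elim disjE; hypsubst; simp add: inv_sqrt2_def scaleR_conv_of_real[where 'a=complex])
  subgoal using exhaust_3[of p] exhaust_3[of c]
  by (elim disjE; hypsubst; simp add: inv_sqrt2_def scaleR_conv_of_real[where 'a=complex])
  subgoal using exhaust_3[of p] exhaust_3[of c]
  by (elim disjE; hypsubst; simp add: inv_sqrt2_def scaleR_conv_of_real[where 'a=complex])
  done

definition spin2 :: "3 \<Rightarrow> 3 \<Rightarrow> 3 \<Rightarrow> 3 \<Rightarrow> complex" where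
  "spin2 a b p c = (\<Sum>k\<in>UNIV. spin a $ p $ k * spin b $ k $ c)"

lemma spin2_entry:
  "spin2 1 1 p c = (if p = 2 \<and> c = 2 then 1 else if p = 2 \<or> c = 2 then 0 else 1 / 2)"
  "spin2 2 2 p c = (if p = 2 \<and> c = 2 then 1 else if p = 2 \<or> c = 2 then 0 else if p = c then 1 / 2 else - 1 / 2)"
  "spin2 1 2 p c = (if p = 2 \<or> c = 2 then 0 else if c = 1 then \<i> / 2 else - \<i> / 2)"
  "spin2 2 1 p c = (if p = 2 \<or> c = 2 then 0 else if p = 1 then - \<i> / 2 else \<i> / 2)"
  "spin2 3 3 p c = (if p = c \<and> p \<noteq> 2 then 1 else 0)"
  "spin2 1 3 p c = (if p = 2 \<and> c = 1 then inv_sqrt2 else if p = 2 \<and> c = 3 then - inv_sqrt2 else 0)"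
  "spin2 2 3 p c = (if p = 2 \<and> c \<noteq> 2 then \<i> * inv_sqrt2 else 0)"
  "spin2 3 1 p c = (if c = 2 \<and> p = 1 then inv_sqrt2 else if c = 2 \<and> p = 3 then - inv_sqrt2 else 0)"
  "spin2 3 2 p c = (if c = 2 \<and> p \<noteq> 2 then - \<i> * inv_sqrt2 else 0)"
  subgoal using exhaust_3[of p] exhaust_3[of c] by (elim disjE; hypsubst; simp add: spin2_def spin_entry sum_3 inv_sqrt2_square inv_sqrt2_i)
  subgoal using exhaust_3[of p] exhaust_3[of c] by (elim disjE; hypsubst; simp add: spin2_def spin_entry sum_3 inv_sqrt2_square inv_sqrt2_i)
  subgoal using exhaust_3[of p] exhaust_3[of c] by (elim disjE; hypsubst; simp add: spin2_def spin_entry sum_3 inv_sqrt2_square inv_sqrt2_i)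
  subgoal using exhaust_3[of p] exhaust_3[of c] by (elim disjE; hypsubst; simp add: spin2_def spin_entry sum_3 inv_sqrt2_square inv_sqrt2_i)
  subgoal using exhaust_3[of p] exhaust_3[of c] by (elim disjE; hypsubst; simp add: spin2_def spin_entry sum_3 inv_sqrt2_square inv_sqrt2_i)
  subgoal using exhaust_3[of p] exhaust_3[of c] by (elim disjE; hypsubst; simp add: spin2_def spin_entry sum_3 inv_sqrt2_square inv_sqrt2_i)
  subgoal using exhaust_3[of p] exhaust_3[of c] by (elim disjE; hypsubst; simp add: spin2_def spin_entry sum_3 inv_sqrt2_square inv_sqrt2_i)
  subgoal using exhaust_3[of p] exhaust_3[of c] by (elim disjE; hypsubst; simp add: spin2_def spin_entry sum_3 inv_sqrt2_square inv_sqrt2_i)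
  subgoal using exhaust_3[of p] exhaust_3[of c] by (elim disjE; hypsubst; simp add: spin2_def spin_entry sum_3 inv_sqrt2_square inv_sqrt2_i)
  done

text \<open>Operators on different sites commute, so a quartic term is the tensor product of
  \<open>s^a s^b\<close> with itself. The factor \<open>if q = d\<close> expresses that the squares
  act on the left site alone.\<close>

lemma hamiltonian_density:
  "(\<Sum>a\<in>UNIV. complex_of_real (coupling x a) * (spin a $ p $ c * spin a $ q $ d + 2 * (spin2 a a p c * (if q = d then 1 else 0))))
   - (\<Sum>a\<in>UNIV. \<Sum>b\<in>UNIV. complex_of_real (quartic_coupling x a b) * (spin2 a b p c * spin2 a b q d)) = bond_weight (of_real x) p q c d"
  unfolding sum_3 spin2_entry
  using exhaust_3[of p] exhaust_3[of c] exhaust_3[of q] exhaust_3[of d]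
  by (elim disjE; hypsubst; simp add: coupling_def quartic_coupling_def spin_entry inv_sqrt2_square inv_sqrt2_i bond_weight_def; simp add: field_simps inv_sqrt2_square inv_sqrt2_i power2_eq_square)

section \<open>Local fusion identities\<close>

lemma sum_bool_pair: "(\<Sum>k\<in>UNIV. f k) = f (True,True) + f (True,False) + f (False,True) + (f (False,False) :: complex)"
  by (simp add: sum_UNIV_prod UNIV_bool)

text \<open>The triplet vectors are weighted by powers of \<open>x\<close> so that both orders of fusion give the same
  nineteen-vertex weights.\<close>

definition fuse :: "complex \<Rightarrow> 3 \<Rightarrow> bool \<times> bool \<Rightarrow> complex" where
  "fuse x i = (\<lambda>(j, k). if i = 1 \<and> j \<and> k \<or> i = 2 \<and> j \<noteq> k then 1 else if i = 3 \<and> \<not> j \<and> \<not> k then x else 0)"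

definition unfuse :: "complex \<Rightarrow> bool \<times> bool \<Rightarrow> 3 \<Rightarrow> complex" where
  "unfuse x = (\<lambda>(j, k) i. if i = 1 \<and> j \<and> k then x else if i = 2 \<and> j \<noteq> k then 1 else if i = 3 \<and> \<not> j \<and> \<not> k then 1 else 0)"

text \<open>In trigonometric notation \<open>A\<close> has the pair ([u], [u + 1]) and
  \<open>B\<close> the pair ([u - 1], [u]), both divided by [u], with s = - [u - 1] / [u]. Then 1 +
  x s + s^2 = 1 / [u]^2, which explains the common \<open>g\<close>. For the product of
  \<open>A\<close> and \<open>B\<close> the triplet is a quotient of the auxiliary space, reached by
  \<open>fuse\<close>; in the opposite order it is a subspace, embedded by
  \<open>unfuse\<close>.\<close>

lemma fusion_triplet:
  fixes x s
  defines "g \<equiv> x * (1 + x * s + s\<^sup>2)"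
  defines "A \<equiv> six_vertex x g 1 (x + s)" and "B \<equiv> six_vertex x g (- s) 1"
  shows "(\<Sum>k\<in>UNIV. fuse x i k * weight_comp A B k j a b) = (\<Sum>k\<in>UNIV. nineteen_vertex x s i k a b * fuse x k j)"
  and "(\<Sum>k\<in>UNIV. weight_comp B A j k a b * unfuse x k i) = (\<Sum>k\<in>UNIV. unfuse x j k * nineteen_vertex x s k i a b)"
proof -
  obtain j1 j2 where j: "j = (j1, j2)" by fastforce
  show "(\<Sum>k\<in>UNIV. fuse x i k * weight_comp A B k j a b) = (\<Sum>k\<in>UNIV. nineteen_vertex x s i k a b * fuse x k j)"
    unfolding j sum_bool_pair
  using exhaust_3[of a] exhaust_3[of b] exhaust_3[of i]
  by (elim disjE; hypsubst; cases j1; cases j2;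
      simp add: weight_comp_def A_def B_def sum_3 fuse_def six_vertex_def nineteen_vertex_def Let_def;
      simp add: g_def algebra_simps power2_eq_square)
  show "(\<Sum>k\<in>UNIV. weight_comp B A j k a b * unfuse x k i) = (\<Sum>k\<in>UNIV. unfuse x j k * nineteen_vertex x s k i a b)"
    unfolding j sum_bool_pair
  using exhaust_3[of a] exhaust_3[of b] exhaust_3[of i]
  by (elim disjE; hypsubst; cases j1; cases j2;
      simp add: weight_comp_def A_def B_def sum_3 unfuse_def six_vertex_def nineteen_vertex_def Let_def;
      simp add: g_def algebra_simps power2_eq_square)
qed

text \<open>The antisymmetric vector is an invariant column for one order and an invariant row for
  the other. Its factor is the quantum determinant: \<open>be\<close> of \<open>A\<close>, which is
  \<open>x + s\<close>, times \<open>x * al - be\<close> of \<open>B\<close>, which is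
  \<open>- (1 + x * s)\<close>.\<close>

lemma fusion_singlet:
  fixes x s
  defines "g \<equiv> x * (1 + x * s + s\<^sup>2)"
  defines "A \<equiv> six_vertex x g 1 (x + s)" and "B \<equiv> six_vertex x g (- s) 1"
  shows "(\<Sum>k\<in>UNIV. weight_comp A B j k a b * (if k = (True,False) then 1 else if k = (False,True) then - 1 else 0)) =
    (if j = (True,False) then 1 else if j = (False,True) then - 1 else 0) * (if a = b then - (x + s) * (1 + x * s) else 0)"
  and "(\<Sum>k\<in>UNIV. (if k = (True,False) then 1 else if k = (False,True) then - 1 else 0) * weight_comp B A k j a b) =
    (if a = b then - (x + s) * (1 + x * s) else 0) * (if j = (True,False) then 1 else if j = (False,True) then - 1 else 0)"
proof -
  obtain j1 j2 where j: "j = (j1, j2)" by fastforce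
  show "(\<Sum>k\<in>UNIV. weight_comp A B j k a b * (if k = (True,False) then 1 else if k = (False,True) then - 1 else 0)) =
    (if j = (True,False) then 1 else if j = (False,True) then - 1 else 0) * (if a = b then - (x + s) * (1 + x * s) else 0)"
    unfolding j sum_bool_pair
  using exhaust_3[of a] exhaust_3[of b]
  by (elim disjE; hypsubst; cases j1; cases j2;
      simp add: weight_comp_def A_def B_def sum_3 six_vertex_def;
      simp add: g_def algebra_simps power2_eq_square)
  show "(\<Sum>k\<in>UNIV. (if k = (True,False) then 1 else if k = (False,True) then - 1 else 0) * weight_comp B A k j a b) =
    (if a = b then - (x + s) * (1 + x * s) else 0) * (if j = (True,False) then 1 else if j = (False,True) then - 1 else 0)"
    unfolding j sum_bool_pair
  using exhaust_3[of a] exhaust_3[of b]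
  by (elim disjE; hypsubst; cases j1; cases j2;
      simp add: weight_comp_def A_def B_def sum_3 six_vertex_def;
      simp add: g_def algebra_simps power2_eq_square)
qed

section \<open>Two-site operators and their translates\<close>

definition pair_kernel :: "(3 \<Rightarrow> 3 \<Rightarrow> 3 \<Rightarrow> 3 \<Rightarrow> complex) \<Rightarrow> config \<Rightarrow> config \<Rightarrow> complex" where
  "pair_kernel w \<sigma> \<tau> = (if drop 2 \<sigma> = drop 2 \<tau> then w (\<sigma> ! 0) (\<sigma> ! 1) (\<tau> ! 0) (\<tau> ! 1) else 0)"

lemma pair_kernel_Cons [simp]:
  "pair_kernel w (a # b # \<rho>) (c # d # \<tau>) = (if \<rho> = \<tau> then w a b c d else 0)"
  by (simp add: pair_kernel_def)

definition pair_op :: "nat \<Rightarrow> (3 \<Rightarrow> 3 \<Rightarrow> 3 \<Rightarrow> 3 \<Rightarrow> complex) \<Rightarrow> state \<Rightarrow> state" where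
  "pair_op N w = kop N (pair_kernel w)"

fun translate :: "nat \<Rightarrow> nat \<Rightarrow> (state \<Rightarrow> state) \<Rightarrow> state \<Rightarrow> state" where
  "translate N 0 A = A"
| "translate N (Suc k) A = shift N \<circ> translate N k A \<circ> unshift N"

definition bond_sum :: "nat \<Rightarrow> (3 \<Rightarrow> 3 \<Rightarrow> 3 \<Rightarrow> 3 \<Rightarrow> complex) \<Rightarrow> state \<Rightarrow> state" where
  "bond_sum N w \<psi> = (\<Sum>k<N. translate N k (pair_op N w) \<psi>)"

lemma is_op_pair_op [simp]: "is_op N (pair_op N w)"
  by (simp add: pair_op_def)

lemma is_op_translate: "N > 0 \<Longrightarrow> is_op N A \<Longrightarrow> is_op N (translate N k A)"
  by (induction k) (auto intro!: is_op_comp is_op_shift is_op_unshift)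

lemma is_op_bond_sum: "N > 0 \<Longrightarrow> is_op N (bond_sum N w)"
  unfolding bond_sum_def by (intro is_op_setsum is_op_translate) auto

lemma configs_Suc_Suc:
  assumes "\<sigma> \<in> configs (Suc (Suc n))"
  obtains a b \<rho> where "\<sigma> = a # b # \<rho>" "\<rho> \<in> configs n"
  using assms by (auto simp: configs_def length_Suc_conv)

lemma pair_op_apply:
  assumes "a # b # \<rho> \<in> configs N"
  shows "pair_op N w \<psi> (a # b # \<rho>) = (\<Sum>c\<in>UNIV. \<Sum>d\<in>UNIV. w a b c d * \<psi> (c # d # \<rho>))"
proof -
  obtain n where n: "N = Suc (Suc n)" "\<rho> \<in> configs n" using assms by (auto simp: configs_def)
  have "(if \<rho> = \<tau> then w a b c d else 0) * \<psi> (c # d # \<tau>) = (if \<rho> = \<tau> then w a b c d * \<psi> (c # d # \<tau>) else 0)" for c d \<tau>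
    by simp
  then show ?thesis
    using assms n by (simp add: pair_op_def kop_def sum_configs_Suc)
qed

lemma pair_op_eqI:
  assumes "\<And>\<psi> a b \<rho>. a # b # \<rho> \<in> configs N \<Longrightarrow> A \<psi> (a # b # \<rho>) = (\<Sum>c\<in>UNIV. \<Sum>d\<in>UNIV. w a b c d * \<psi> (c # d # \<rho>))"
    "is_op N A" "N \<ge> 2"
  shows "A = pair_op N w"
proof (intro ext)
  fix \<psi> \<sigma>
  obtain n where n: "N = Suc (Suc n)" using assms(3) by (metis add_2_eq_Suc le_Suc_ex)
  show "A \<psi> \<sigma> = pair_op N w \<psi> \<sigma>"
  proof (cases "\<sigma> \<in> configs N")
    case True
    then obtain a b \<rho> where \<sigma>: "\<sigma> = a # b # \<rho>"
      using configs_Suc_Suc n by metis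
    show ?thesis
      using True unfolding \<sigma> by (simp only: assms(1) pair_op_apply)
  qed (simp add: is_op_outside[OF assms(2)] is_op_outside[OF is_op_pair_op])
qed

lemma sum_rotate5:
  "(\<Sum>c\<in>A. \<Sum>d\<in>B. \<Sum>k\<in>C. \<Sum>l\<in>D. \<Sum>m\<in>E. f c d k l m)
    = (\<Sum>k\<in>C. \<Sum>l\<in>D. \<Sum>m\<in>E. \<Sum>c\<in>A. \<Sum>d\<in>B. f c d k l m)"
  by (subst sum_rotate3, rule sum.cong[OF refl], subst sum_rotate3, rule sum.cong[OF refl], rule sum_rotate3)

lemma sum_distrib_rotate:
  fixes t :: "'m \<Rightarrow> complex"
  shows "(\<Sum>m\<in>E. t m * (\<Sum>k\<in>C. \<Sum>l\<in>D. w k l * g k l m))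
    = (\<Sum>k\<in>C. \<Sum>l\<in>D. \<Sum>m\<in>E. w k l * t m * g k l m)"
proof -
  have "(\<Sum>m\<in>E. t m * (\<Sum>k\<in>C. \<Sum>l\<in>D. w k l * g k l m))
    = (\<Sum>m\<in>E. \<Sum>k\<in>C. \<Sum>l\<in>D. w k l * t m * g k l m)"
    by (simp add: sum_distrib_left mult_ac)
  also have "\<dots> = (\<Sum>k\<in>C. \<Sum>l\<in>D. \<Sum>m\<in>E. w k l * t m * g k l m)"
    by (rule sum_rotate3[symmetric])
  finally show ?thesis .
qed

text \<open>If the local commutator is a difference of two terms (Sutherland's condition), then so is the commutator
  of a two-site operator with a transfer matrix, and the terms cancel in the sum over all bonds.\<close>

lemma pair_op_transfer:
  fixes L X :: "('n::finite) weight"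
  assumes N2: "N \<ge> 2" and loc0: "\<And>i j a a' b b'.
      (\<Sum>c\<in>UNIV. \<Sum>d\<in>UNIV. w a a' c d * (\<Sum>k\<in>UNIV. L i k c b * L k j d b'))
    - (\<Sum>c\<in>UNIV. \<Sum>d\<in>UNIV. w c d b b' * (\<Sum>k\<in>UNIV. L i k a c * L k j a' d))
    = (\<Sum>k\<in>UNIV. X i k a b * L k j a' b') - (\<Sum>k\<in>UNIV. L i k a b * X k j a' b')"
  shows "pair_op N w (transfer K (replicate N L) \<psi>) - transfer K (replicate N L) (pair_op N w \<psi>)
     = transfer K (X # replicate (N - 1) L) \<psi> - transfer K (L # X # replicate (N - 2) L) \<psi>"
proof -
  obtain n where n: "N = Suc (Suc n)" using N2 by (metis add_2_eq_Suc le_Suc_ex)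
  let ?Ls = "replicate n L"
  have two: "monodromy (U # V # ?Ls) i j (a # a' # \<sigma>) (b # b' # \<tau>)
    = (\<Sum>l\<in>UNIV. (\<Sum>k\<in>UNIV. U i k a b * V k l a' b') * monodromy ?Ls l j \<sigma> \<tau>)"
    for U V i j a a' b b' \<sigma> \<tau>
  proof -
    have "monodromy (U # V # ?Ls) i j (a # a' # \<sigma>) (b # b' # \<tau>)
      = (\<Sum>k\<in>UNIV. \<Sum>l\<in>UNIV. U i k a b * V k l a' b' * monodromy ?Ls l j \<sigma> \<tau>)"
      by (simp add: sum_distrib_left mult.assoc)
    then show ?thesis
      by (subst (asm) sum.swap) (simp only: sum_distrib_right)
  qed
  have tk: "trans_kernel K (U # V # ?Ls) (a # a' # \<sigma>) (b # b' # \<tau>)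
    = (\<Sum>i\<in>UNIV. \<Sum>l\<in>UNIV. (\<Sum>k\<in>UNIV. U i k a b * V k l a' b') * (K i * monodromy ?Ls l i \<sigma> \<tau>))"
    for U V a a' b b' \<sigma> \<tau>
    unfolding trans_kernel_def two sum_distrib_left by (intro sum.cong refl mult.left_commute)
  have loc: "(\<Sum>c\<in>UNIV. \<Sum>d\<in>UNIV. w a a' c d * trans_kernel K (L # L # ?Ls) (c # d # \<sigma>) (b # b' # \<tau>))
    - (\<Sum>c\<in>UNIV. \<Sum>d\<in>UNIV. w c d b b' * trans_kernel K (L # L # ?Ls) (a # a' # \<sigma>) (c # d # \<tau>))
    = trans_kernel K (X # L # ?Ls) (a # a' # \<sigma>) (b # b' # \<tau>)
    - trans_kernel K (L # X # ?Ls) (a # a' # \<sigma>) (b # b' # \<tau>)" for a a' b b' \<sigma> \<tau>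
  proof -
    let ?R = "\<lambda>i l. K i * monodromy ?Ls l i \<sigma> \<tau>"
    have e1: "(\<Sum>c\<in>UNIV. \<Sum>d\<in>UNIV. w a a' c d * trans_kernel K (L # L # ?Ls) (c # d # \<sigma>) (b # b' # \<tau>))
      = (\<Sum>i\<in>UNIV. \<Sum>l\<in>UNIV. (\<Sum>c\<in>UNIV. \<Sum>d\<in>UNIV. w a a' c d * (\<Sum>k\<in>UNIV. L i k c b * L k l d b')) * ?R i l)"
      unfolding tk sum_distrib_left[of "w _ _ _ _"]
      by (subst sum_rotate3, rule sum.cong[OF refl], subst sum_rotate3)
        (simp only: sum_distrib_right sum_distrib_left mult.assoc)
    have e2: "(\<Sum>c\<in>UNIV. \<Sum>d\<in>UNIV. w c d b b' * trans_kernel K (L # L # ?Ls) (a # a' # \<sigma>) (c # d # \<tau>))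
      = (\<Sum>i\<in>UNIV. \<Sum>l\<in>UNIV. (\<Sum>c\<in>UNIV. \<Sum>d\<in>UNIV. w c d b b' * (\<Sum>k\<in>UNIV. L i k a c * L k l a' d)) * ?R i l)"
      unfolding tk sum_distrib_left[of "w _ _ _ _"]
      by (subst sum_rotate3, rule sum.cong[OF refl], subst sum_rotate3)
        (simp only: sum_distrib_right sum_distrib_left mult.assoc)
    show ?thesis
      unfolding e1 e2 unfolding tk sum_subtractf[symmetric] left_diff_distrib[symmetric]
        loc0[unfolded sum_subtractf[symmetric]] ..
  qed
  have rep: "replicate N L = L # L # ?Ls" "replicate (N - 1) L = L # ?Ls" "replicate (N - 2) L = ?Ls"
    by (simp_all add: n)
  have "(pair_op N w (transfer K (replicate N L) \<psi>) - transfer K (replicate N L) (pair_op N w \<psi>)) \<sigma>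
     = (transfer K (X # replicate (N - 1) L) \<psi> - transfer K (L # X # replicate (N - 2) L) \<psi>) \<sigma>" for \<sigma>
  proof (cases "\<sigma> \<in> configs N")
    case True
    then obtain a a' \<rho> where \<sigma>: "\<sigma> = a # a' # \<rho>" "\<rho> \<in> configs n"
      using configs_Suc_Suc n by metis
    let ?t = "\<lambda>U V. \<lambda>a a' \<rho> b b' \<tau>. trans_kernel K (U # V # ?Ls) (a # a' # \<rho>) (b # b' # \<tau>)"
    have ev: "transfer K (U # V # ?Ls) \<phi> (a # a' # \<rho>) =
       (\<Sum>b\<in>UNIV. \<Sum>b'\<in>UNIV. \<Sum>\<tau>\<in>configs n. ?t U V a a' \<rho> b b' \<tau> * \<phi> (b # b' # \<tau>))"
      if "\<rho> \<in> configs n" for U V \<phi> a a' \<rho>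
      using that by (simp add: transfer_def kop_def sum_configs_Suc) (simp add: configs_def)
    have mem: "a # b # \<tau> \<in> configs N" if "\<tau> \<in> configs n" for a b \<tau>
      using that n by (simp add: configs_def)
    have 1: "pair_op N w (transfer K (L # L # ?Ls) \<psi>) \<sigma>
      = (\<Sum>b\<in>UNIV. \<Sum>b'\<in>UNIV. \<Sum>\<tau>\<in>configs n. (\<Sum>c\<in>UNIV. \<Sum>d\<in>UNIV. w a a' c d * ?t L L c d \<rho> b b' \<tau>) * \<psi> (b # b' # \<tau>))"
    proof -
      have "pair_op N w (transfer K (L # L # ?Ls) \<psi>) \<sigma>
        = (\<Sum>c\<in>UNIV. \<Sum>d\<in>UNIV. \<Sum>b\<in>UNIV. \<Sum>b'\<in>UNIV. \<Sum>\<tau>\<in>configs n. w a a' c d * ?t L L c d \<rho> b b' \<tau> * \<psi> (b # b' # \<tau>))"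
        unfolding \<sigma>(1) by (simp only: pair_op_apply[OF mem[OF \<sigma>(2)]] ev[OF \<sigma>(2)] sum_distrib_left mult.assoc)
      also have "\<dots> = (\<Sum>b\<in>UNIV. \<Sum>b'\<in>UNIV. \<Sum>\<tau>\<in>configs n. \<Sum>c\<in>UNIV. \<Sum>d\<in>UNIV. w a a' c d * ?t L L c d \<rho> b b' \<tau> * \<psi> (b # b' # \<tau>))"
        by (rule sum_rotate5)
      finally show ?thesis by (simp only: sum_distrib_right)
    qed
    have 2: "transfer K (L # L # ?Ls) (pair_op N w \<psi>) \<sigma>
      = (\<Sum>b\<in>UNIV. \<Sum>b'\<in>UNIV. \<Sum>\<tau>\<in>configs n. (\<Sum>c\<in>UNIV. \<Sum>d\<in>UNIV. w c d b b' * ?t L L a a' \<rho> c d \<tau>) * \<psi> (b # b' # \<tau>))"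
    proof -
      have "transfer K (L # L # ?Ls) (pair_op N w \<psi>) \<sigma>
        = (\<Sum>c\<in>UNIV. \<Sum>d\<in>UNIV. \<Sum>\<tau>\<in>configs n. ?t L L a a' \<rho> c d \<tau> * (\<Sum>b\<in>UNIV. \<Sum>b'\<in>UNIV. w c d b b' * \<psi> (b # b' # \<tau>)))"
        unfolding \<sigma>(1) ev[OF \<sigma>(2)] by (intro sum.cong refl) (simp add: pair_op_apply mem)
      also have "\<dots> = (\<Sum>c\<in>UNIV. \<Sum>d\<in>UNIV. \<Sum>b\<in>UNIV. \<Sum>b'\<in>UNIV. \<Sum>\<tau>\<in>configs n. w c d b b' * ?t L L a a' \<rho> c d \<tau> * \<psi> (b # b' # \<tau>))"
        by (simp only: sum_distrib_rotate)
      also have "\<dots> = (\<Sum>b\<in>UNIV. \<Sum>b'\<in>UNIV. \<Sum>\<tau>\<in>configs n. \<Sum>c\<in>UNIV. \<Sum>d\<in>UNIV. w c d b b' * ?t L L a a' \<rho> c d \<tau> * \<psi> (b # b' # \<tau>))"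
        by (rule sum_rotate5)
      finally show ?thesis by (simp only: sum_distrib_right)
    qed
    show ?thesis
      unfolding rep minus_apply 1 2
      unfolding \<sigma>(1) ev[OF \<sigma>(2)] sum_subtractf[symmetric] left_diff_distrib[symmetric]
        loc[unfolded sum_subtractf[symmetric]] ..
  qed (simp add: is_op_outside[of N] is_op_transfer n)
  then show ?thesis by (intro ext)
qed

text \<open>Conjugation by the shift leaves \<open>t\<close> fixed, so the commutator relation for
  one bond is carried to all its translates.\<close>

lemma translate_comm:
  assumes "N > 0" "is_op N t" "shift N \<circ> t = t \<circ> shift N" "is_op N A" "is_op N D" "is_op N D'"
    and "\<And>\<psi>. A (t \<psi>) - t (A \<psi>) = D \<psi> - D' \<psi>"
  shows "translate N k A (t \<psi>) - t (translate N k A \<psi>) = translate N k D \<psi> - translate N k D' \<psi>"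
proof (induction k arbitrary: \<psi>)
  case (Suc k)
  note ops = is_op_shift[of N] is_op_unshift[OF assms(1)] assms(2)
    is_op_translate[OF assms(1,4), of k] is_op_translate[OF assms(1,5), of k] is_op_translate[OF assms(1,6), of k]
  have st: "shift N (t \<phi>) = t (shift N \<phi>)" for \<phi>
    using assms(3)[THEN fun_cong, of \<phi>] by simp
  have id: "id_op N (B \<phi>) = B \<phi>" "B (id_op N \<phi>) = B \<phi>" if "is_op N B" for B \<phi>
    using comp_id_op[OF that, THEN fun_cong, of \<phi>] by simp_all
  have su: "shift N (unshift N \<phi>) = id_op N \<phi>" "unshift N (shift N \<phi>) = id_op N \<phi>" for \<phi>
    using shift_unshift[OF assms(1), THEN fun_cong, of \<phi>] unshift_shift[OF assms(1), THEN fun_cong, of \<phi>]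
    by simp_all
  have ut: "unshift N (t \<phi>) = t (unshift N \<phi>)" for \<phi>
  proof -
    have "t \<phi> = shift N (t (unshift N \<phi>))"
      by (simp only: st su(1) id(2)[OF assms(2)])
    then show ?thesis
      by (simp only: su(2) id(1)[OF assms(2)])
  qed
  show ?case
    using arg_cong[OF Suc[of "unshift N \<psi>"], of "shift N"]
    unfolding is_op_diff[OF ops(1)] translate.simps comp_apply ut st .
qed (simp add: assms)

lemma translate_translate: "translate N k (shift N \<circ> A \<circ> unshift N) = translate N (Suc k) A"
  by (induction k) (simp_all add: comp_assoc)

lemma transfer_rotate1:
  assumes "Ts \<noteq> []" "\<And>T. T \<in> set Ts \<Longrightarrow> twist_covariant K T"
  shows "transfer K Ts = shift (length Ts) \<circ> transfer K (rotate1 Ts) \<circ> unshift (length Ts)"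
  using assms transfer_rotate[of K "hd Ts" "length Ts" "tl Ts"] by (cases Ts) auto

lemma translate_transfer_rotate:
  assumes "Ts \<noteq> []" "\<And>T. T \<in> set Ts \<Longrightarrow> twist_covariant K T"
  shows "translate (length Ts) k (transfer K (rotate k Ts)) = transfer K Ts"
proof (induction k)
  case (Suc k)
  have eq: "transfer K (rotate k Ts)
    = shift (length Ts) \<circ> transfer K (rotate (Suc k) Ts) \<circ> unshift (length Ts)"
    using transfer_rotate1[of "rotate k Ts" K] assms by simp
  show ?case
    using Suc by (simp only: translate_translate[symmetric] eq[symmetric])
qed simp

text \<open>The commutator with bond \<open>k\<close> is the difference of the transfer matrices
  with the defect at two neighbouring sites. The sum over the bonds telescopes, and the two ends
  agree because a defect carried around the ring comes back unchanged.\<close>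

lemma bond_sum_commute_transfer:
  fixes L X :: "('n::finite) weight"
  assumes "N \<ge> 2" "twist_covariant K L" "twist_covariant K X"
    and loc: "\<And>i j a a' b b'.
      (\<Sum>c\<in>UNIV. \<Sum>d\<in>UNIV. w a a' c d * (\<Sum>k\<in>UNIV. L i k c b * L k j d b'))
    - (\<Sum>c\<in>UNIV. \<Sum>d\<in>UNIV. w c d b b' * (\<Sum>k\<in>UNIV. L i k a c * L k j a' d))
    = (\<Sum>k\<in>UNIV. X i k a b * L k j a' b') - (\<Sum>k\<in>UNIV. L i k a b * X k j a' b')"
  shows "bond_sum N w \<circ> transfer K (replicate N L) = transfer K (replicate N L) \<circ> bond_sum N w"
proof -
  obtain n where n: "N = Suc (Suc n)" using assms(1) by (metis add_2_eq_Suc le_Suc_ex)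
  let ?t = "transfer K (replicate N L)"
  let ?D = "transfer K (X # replicate (N - 1) L)" and ?D' = "transfer K (L # X # replicate (N - 2) L)"
  have t: "is_op N ?t" "is_op N ?D" "is_op N ?D'" by (simp_all add: is_op_transfer n)
  have D': "?D' = shift N \<circ> ?D \<circ> unshift N"
    using transfer_rotate[OF assms(2), of N "X # replicate n L"] by (simp add: n replicate_append_same)
  \<comment> \<open>Covariance of the defect \<open>X\<close> itself enters here: the site carrying
    it also crosses the twisted boundary.\<close>
  have cyc: "translate N N ?D = ?D"
  proof -
    let ?Ts = "X # replicate (N - 1) L"
    have len: "length ?Ts = N" by (simp add: n)
    have rot: "rotate N ?Ts = ?Ts" by (rule rotate_id) (simp add: n)
    have cov: "twist_covariant K T" if "T \<in> set ?Ts" for T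
      using that assms(2,3) by auto
    show ?thesis
      by (rule translate_transfer_rotate[of ?Ts K N, unfolded len rot]) (simp, rule cov)
  qed
  have N0: "N > 0" by (simp add: n)
  have step: "translate N k (pair_op N w) (?t \<psi>) - ?t (translate N k (pair_op N w) \<psi>)
    = translate N k ?D \<psi> - translate N (Suc k) ?D \<psi>" for k \<psi>
    using translate_comm[of N ?t "pair_op N w" ?D ?D', OF N0 t(1) shift_transfer[OF assms(2) N0]
        is_op_pair_op t(2,3) pair_op_transfer[of N w L X, OF assms(1) loc]]
    unfolding D' translate_translate .
  have "bond_sum N w (?t \<psi>) - ?t (bond_sum N w \<psi>) = 0" for \<psi>
  proof -
    have "bond_sum N w (?t \<psi>) - ?t (bond_sum N w \<psi>)
      = (\<Sum>k<N. translate N k (pair_op N w) (?t \<psi>) - ?t (translate N k (pair_op N w) \<psi>))"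
      by (simp add: bond_sum_def is_op_sum[OF t(1)] sum_subtractf)
    also have "\<dots> = (\<Sum>k<N. translate N k ?D \<psi> - translate N (Suc k) ?D \<psi>)"
      by (simp only: step)
    also have "\<dots> = 0"
      using sum_lessThan_telescope'[of "\<lambda>k. translate N k ?D \<psi>" N]
      by (simp only: cyc translate.simps(1) diff_self)
    finally show ?thesis .
  qed
  then show ?thesis by (intro ext) (simp only: comp_apply right_minus_eq)
qed

text \<open>The shift maps each summand to the next one and the last back to the first.\<close>

lemma bond_sum_shift:
  assumes "N > 0" "translate N N (pair_op N w) = pair_op N w"
  shows "shift N \<circ> bond_sum N w = bond_sum N w \<circ> shift N"
proof -
  note ops = is_op_shift[of N] is_op_bond_sum[OF assms(1), of w]
  have "shift N (bond_sum N w (unshift N \<psi>)) = bond_sum N w \<psi>" for \<psi>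
  proof -
    let ?f = "\<lambda>k. translate N k (pair_op N w) \<psi>"
    have "shift N (bond_sum N w (unshift N \<psi>)) = (\<Sum>k<N. ?f (Suc k))"
      by (simp add: bond_sum_def is_op_sum[OF ops(1)])
    moreover have "(\<Sum>k<N. ?f k) + ?f N = ?f 0 + (\<Sum>k<N. ?f (Suc k))"
      using sum.lessThan_Suc_shift[of ?f N] sum.lessThan_Suc[of ?f N] by (simp only:)
    moreover have "?f N = ?f 0"
      unfolding assms(2) by simp
    ultimately show ?thesis
      unfolding bond_sum_def by (simp only: add.commute[of _ "?f 0"] add_left_cancel)
  qed
  then have "shift N \<circ> bond_sum N w \<circ> unshift N = bond_sum N w"
    by (intro ext) (simp only: comp_apply)
  then have "shift N \<circ> bond_sum N w \<circ> unshift N \<circ> shift N = bond_sum N w \<circ> shift N"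
    by (rule arg_cong[of _ _ "\<lambda>X. X \<circ> shift N"])
  then show ?thesis
    by (simp add: comp_assoc unshift_shift[OF assms(1)] comp_id_op[OF ops(2)])
qed

section \<open>The Hamiltonian as a sum of translates\<close>

text \<open>The twists introduced by \<open>shift\<close> and \<open>unshift\<close> cancel unless a
  site touched by the operator has been carried across the boundary. With sites counted from 0, this
  happens for the bond joining \<open>N - 1\<close> to 0, where the second index is twisted.\<close>

lemma translate_pair_op_apply:
  assumes "N \<ge> 2" "k < N" "\<sigma> \<in> configs N"
  shows "translate N k (pair_op N w) \<psi> \<sigma>
    = (\<Sum>c\<in>UNIV. \<Sum>d\<in>UNIV. (if Suc k = N then twist (\<sigma> ! 0) * twist d else 1)
        * w (\<sigma> ! k) (\<sigma> ! (Suc k mod N)) c d * \<psi> (\<sigma>[k := c, Suc k mod N := d]))"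
  using assms(2,3)
proof (induction k arbitrary: \<sigma> \<psi>)
  case 0
  obtain n where n: "N = Suc (Suc n)" using assms(1) by (metis add_2_eq_Suc le_Suc_ex)
  then obtain a b \<rho> where \<sigma>: "\<sigma> = a # b # \<rho>"
    using configs_Suc_Suc 0 by metis
  show ?case using 0 unfolding \<sigma> by (simp add: pair_op_apply n)
next
  case (Suc k)
  obtain a \<rho> where \<sigma>: "\<sigma> = a # \<rho>" and len: "N = Suc (length \<rho>)"
    using Suc.prems by (cases \<sigma>) (auto simp: configs_def)
  have mem: "\<rho> @ [a] \<in> configs N" and mem': "(\<rho> @ [a])[k := c, Suc k := d] \<in> configs N" for c d
    using len by (simp_all add: configs_def)
  have k: "k < length \<rho>" using Suc.prems len by simp
  have "translate N (Suc k) (pair_op N w) \<psi> \<sigma>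
    = twist a * translate N k (pair_op N w) (unshift N \<psi>) (\<rho> @ [a])"
    using Suc.prems by (simp add: shift_def \<sigma>)
  also have "\<dots> = twist a * (\<Sum>c\<in>UNIV. \<Sum>d\<in>UNIV. w (\<rho> ! k) ((\<rho> @ [a]) ! Suc k) c d
      * unshift N \<psi> ((\<rho> @ [a])[k := c, Suc k := d]))"
    using Suc.IH[OF _ mem, of "unshift N \<psi>"] Suc.prems len k by (simp add: nth_append)
  also have "\<dots> = (\<Sum>c\<in>UNIV. \<Sum>d\<in>UNIV. (if Suc (Suc k) = N then twist (\<sigma> ! 0) * twist d else 1)
        * w (\<sigma> ! Suc k) (\<sigma> ! (Suc (Suc k) mod N)) c d * \<psi> (\<sigma>[Suc k := c, Suc (Suc k) mod N := d]))"
  proof (cases "Suc (Suc k) = N")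
    case True
    then have lr: "length \<rho> = Suc k" "N = Suc (Suc k)" using len by simp_all
    then have "(\<rho> @ [a])[k := c, Suc k := d] = \<rho>[k := c] @ [d]" for c d
      by (simp add: list_update_append)
    then show ?thesis
      using lr mem' by (simp add: \<sigma> nth_append unshift_def sum_distrib_left mult_ac)
  next
    case False
    then have "Suc k < length \<rho>" using len k by simp
    then have "(\<rho> @ [a])[k := c, Suc k := d] = \<rho>[k := c, Suc k := d] @ [a]" for c d
      by (simp add: list_update_append)
    then show ?thesis
      using False len mem' \<open>Suc k < length \<rho>\<close>
      by (simp add: \<sigma> nth_append unshift_def sum_distrib_left mult_ac)
  qed
  finally show ?case .
qed

text \<open>After \<open>N\<close> steps every site has been twisted once. The twists cancel away
  from the bond, and on it they are absorbed because \<open>w\<close> commutes with the twist of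
  both sites.\<close>

lemma translate_pair_op_cyclic:
  assumes "N \<ge> 2" "\<And>a b c d. twist a * twist b * twist c * twist d * w a b c d = w a b c d"
  shows "translate N N (pair_op N w) = pair_op N w"
proof (rule pair_op_eqI)
  show "is_op N (translate N N (pair_op N w))"
    using assms(1) by (intro is_op_translate) auto
  fix \<psi> a b \<rho> assume mem: "a # b # \<rho> \<in> configs N"
  obtain n where n: "N = Suc (Suc n)" "length \<rho> = n"
    using mem by (auto simp: configs_def)
  have mem': "b # \<rho> @ [a] \<in> configs N" "d # \<rho> @ [c] \<in> configs N" for c d
    using n by (simp_all add: configs_def)
  have upd: "(b # \<rho> @ [a])[Suc n := c, 0 := d] = d # \<rho> @ [c]" "(b # \<rho> @ [a]) ! Suc n = a" for c d
    using n by (simp_all add: nth_append list_update_append)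
  have "translate N N (pair_op N w) \<psi> (a # b # \<rho>)
    = twist a * translate N (Suc n) (pair_op N w) (unshift N \<psi>) (b # \<rho> @ [a])"
    using mem n by (simp add: shift_def)
  also have "\<dots> = (\<Sum>c\<in>UNIV. \<Sum>d\<in>UNIV. twist a * (twist b * twist d * w a b c d * (twist c * \<psi> (c # d # \<rho>))))"
    unfolding sum_distrib_left
    using translate_pair_op_apply[OF assms(1), of "Suc n" "b # \<rho> @ [a]" w "unshift N \<psi>"] n mem' upd
    by (simp add: unshift_def sum_distrib_left)
  also have "\<dots> = (\<Sum>c\<in>UNIV. \<Sum>d\<in>UNIV. w a b c d * \<psi> (c # d # \<rho>))"
  proof (intro sum.cong refl)
    fix c d
    show "twist a * (twist b * twist d * w a b c d * (twist c * \<psi> (c # d # \<rho>))) = w a b c d * \<psi> (c # d # \<rho>)"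
      using arg_cong[OF assms(2)[of a b c d], of "\<lambda>z. z * \<psi> (c # d # \<rho>)"] by (simp only: mult_ac)
  qed
  finally show "translate N N (pair_op N w) \<psi> (a # b # \<rho>) = (\<Sum>c\<in>UNIV. \<Sum>d\<in>UNIV. w a b c d * \<psi> (c # d # \<rho>))" .
qed (rule assms(1))

lemma site_op_apply:
  assumes "\<sigma> \<in> configs N" "p < N"
  shows "site_op N B (Suc p) \<psi> \<sigma> = (\<Sum>b\<in>UNIV. B $ (\<sigma> ! p) $ b * \<psi> (\<sigma>[p := b]))"
proof -
  have len: "length \<sigma> = N" using assms(1) by (simp add: configs_def)
  have prod: "(\<Prod>j\<in>{1..N}. (if j = Suc p then B else mat 1) $ (\<sigma> ! (j - 1)) $ (\<tau> ! (j - 1)))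
    = (if \<tau> = \<sigma>[p := \<tau> ! p] then B $ (\<sigma> ! p) $ (\<tau> ! p) else 0)" if "\<tau> \<in> configs N" for \<tau>
  proof -
    have lt: "length \<tau> = N" using that by (simp add: configs_def)
    have "(\<Prod>j\<in>{1..N}. (if j = Suc p then B else mat 1) $ (\<sigma> ! (j - 1)) $ (\<tau> ! (j - 1)))
      = (\<Prod>j\<in>{..<N}. (if j = p then B else mat 1) $ (\<sigma> ! j) $ (\<tau> ! j))"
      by (rule prod.reindex_bij_witness[of _ Suc "\<lambda>j. j - 1"]) auto
    also have "\<dots> = B $ (\<sigma> ! p) $ (\<tau> ! p) * (\<Prod>j\<in>{..<N} - {p}. if \<sigma> ! j = \<tau> ! j then 1 else 0)"
      using assms(2) by (subst prod.remove[of _ p]) (auto simp: mat_def intro!: prod.cong)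
    also have "(\<Prod>j\<in>{..<N} - {p}. if \<sigma> ! j = \<tau> ! j then 1 else 0 :: complex)
      = (if \<tau> = \<sigma>[p := \<tau> ! p] then 1 else 0)"
    proof -
      have "\<tau> = \<sigma>[p := \<tau> ! p] \<longleftrightarrow> (\<forall>j\<in>{..<N} - {p}. \<sigma> ! j = \<tau> ! j)"
        using lt len assms(2) by (auto simp: list_eq_iff_nth_eq nth_list_update)
      then show ?thesis by (auto intro!: prod.neutral prod_zero)
    qed
    finally show ?thesis by simp
  qed
  have "site_op N B (Suc p) \<psi> \<sigma>
    = (\<Sum>\<tau>\<in>configs N. (if \<tau> = \<sigma>[p := \<tau> ! p] then B $ (\<sigma> ! p) $ (\<tau> ! p) else 0) * \<psi> \<tau>)"
    using assms(1) prod by (simp add: site_op_def tensor_op_def)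
  also have "\<dots> = (\<Sum>\<tau>\<in>(\<lambda>b. \<sigma>[p := b]) ` UNIV. (if \<tau> = \<sigma>[p := \<tau> ! p] then B $ (\<sigma> ! p) $ (\<tau> ! p) else 0) * \<psi> \<tau>)"
    using assms len by (intro sum.mono_neutral_right) (simp, auto simp: configs_def)
  also have "\<dots> = (\<Sum>b\<in>UNIV. B $ (\<sigma> ! p) $ b * \<psi> (\<sigma>[p := b]))"
    using assms len by (subst sum.reindex) (auto simp: inj_on_def dest: arg_cong[of _ _ "\<lambda>xs. xs ! p"])
  finally show ?thesis .
qed

lemma spin_op_apply:
  assumes "\<sigma> \<in> configs N" "p \<le> N" "N > 0"
  shows "spin_op N a (Suc p) \<psi> \<sigma> = (\<Sum>b\<in>UNIV.
    (if p = N \<and> a \<noteq> 3 then - 1 else 1) * spin a $ (\<sigma> ! (p mod N)) $ b * \<psi> (\<sigma>[p mod N := b]))"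
proof (cases "p = N")
  case True
  then show ?thesis
    using site_op_apply[OF assms(1,3), of "spin a" \<psi>]
    by (simp add: spin_op_def cscale_def sum_distrib_left mult.assoc)
next
  case False
  then show ?thesis
    using site_op_apply[OF assms(1), of p "spin a" \<psi>] assms(2)
    by (simp add: spin_op_def)
qed

lemma spin_op_outside: "\<sigma> \<notin> configs N \<Longrightarrow> spin_op N a j \<psi> \<sigma> = 0"
  by (simp add: spin_op_def site_op_def tensor_op_def cscale_def)

lemma sum_fun_apply: "(\<Sum>i\<in>I. f i) \<sigma> = (\<Sum>i\<in>I. (f i :: state) \<sigma>)"
  by (induction I rule: infinite_finite_induct) auto

text \<open>Matches the sign rule for \<open>s^a\<close> at site \<open>N + 1\<close> with
  conjugation by \<open>twist\<close>, the form in which the translates carry the boundary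
  condition.\<close>

lemma twist_spin:
  "(if a = 3 then 1 else - 1) * spin a $ q $ d = twist q * twist d * spin a $ q $ d"
  using exhaust_3[of a] exhaust_3[of q] exhaust_3[of d]
  by (elim disjE; hypsubst; simp add: spin_entry twist_def)

lemma twist_spin2:
  "(if a = 3 then 1 else - 1) * (if b = 3 then 1 else - 1) * spin2 a b q d = twist q * twist d * spin2 a b q d"
proof -
  have "(if a = 3 then 1 else - 1) * (if b = 3 then 1 else - 1) * spin2 a b q d
    = (\<Sum>k\<in>UNIV. ((if a = 3 then 1 else - 1) * spin a $ q $ k) * ((if b = 3 then 1 else - 1) * spin b $ k $ d))"
    unfolding spin2_def sum_distrib_left by (intro sum.cong refl) (simp only: mult_ac)
  also have "\<dots> = (\<Sum>k\<in>UNIV. twist q * twist d * (spin a $ q $ k * spin b $ k $ d))"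
    unfolding twist_spin by (intro sum.cong refl) (simp add: mult_ac)
  finally show ?thesis by (simp add: spin2_def sum_distrib_left)
qed

text \<open>Moves the sums over spin components inside the sums over configurations, so that the
  bracket becomes the two-site density. The factor \<open>t d\<close> carries the boundary
  sign.\<close>

lemma collect_density:
  fixes t :: "'d \<Rightarrow> complex"
  shows "(\<Sum>a\<in>A. J a * ((\<Sum>c\<in>C. \<Sum>d\<in>D. t d * P a c d * u c d) + 2 * (\<Sum>c\<in>C. \<Sum>d\<in>D. t d * S a c d * u c d)))
      - (\<Sum>a\<in>A. \<Sum>b\<in>B. Q a b * (\<Sum>c\<in>C. \<Sum>d\<in>D. t d * R a b c d * u c d))
    = (\<Sum>c\<in>C. \<Sum>d\<in>D. t d * ((\<Sum>a\<in>A. J a * (P a c d + 2 * S a c d)) - (\<Sum>a\<in>A. \<Sum>b\<in>B. Q a b * R a b c d)) * u c d)"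
proof -
  have "(\<Sum>a\<in>A. J a * ((\<Sum>c\<in>C. \<Sum>d\<in>D. t d * P a c d * u c d) + 2 * (\<Sum>c\<in>C. \<Sum>d\<in>D. t d * S a c d * u c d)))
    = (\<Sum>a\<in>A. \<Sum>c\<in>C. \<Sum>d\<in>D. t d * (J a * (P a c d + 2 * S a c d)) * u c d)"
    by (simp add: sum_distrib_left sum.distrib algebra_simps)
  also have "\<dots> = (\<Sum>c\<in>C. \<Sum>d\<in>D. \<Sum>a\<in>A. t d * (J a * (P a c d + 2 * S a c d)) * u c d)"
    by (rule sum_rotate3[symmetric])
  finally have 1: "(\<Sum>a\<in>A. J a * ((\<Sum>c\<in>C. \<Sum>d\<in>D. t d * P a c d * u c d) + 2 * (\<Sum>c\<in>C. \<Sum>d\<in>D. t d * S a c d * u c d)))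
    = (\<Sum>c\<in>C. \<Sum>d\<in>D. \<Sum>a\<in>A. t d * (J a * (P a c d + 2 * S a c d)) * u c d)" .
  have "(\<Sum>a\<in>A. \<Sum>b\<in>B. Q a b * (\<Sum>c\<in>C. \<Sum>d\<in>D. t d * R a b c d * u c d))
    = (\<Sum>a\<in>A. \<Sum>b\<in>B. \<Sum>c\<in>C. \<Sum>d\<in>D. t d * (Q a b * R a b c d) * u c d)"
    by (simp add: sum_distrib_left mult_ac)
  also have "\<dots> = (\<Sum>c\<in>C. \<Sum>d\<in>D. \<Sum>a\<in>A. \<Sum>b\<in>B. t d * (Q a b * R a b c d) * u c d)"
    by (subst sum_rotate3, rule sum.cong[OF refl], rule sum_rotate3)
  finally have 2: "(\<Sum>a\<in>A. \<Sum>b\<in>B. Q a b * (\<Sum>c\<in>C. \<Sum>d\<in>D. t d * R a b c d * u c d))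
    = (\<Sum>c\<in>C. \<Sum>d\<in>D. \<Sum>a\<in>A. \<Sum>b\<in>B. t d * (Q a b * R a b c d) * u c d)" .
  show ?thesis
    unfolding 1 2 by (simp only: sum_subtractf right_diff_distrib left_diff_distrib sum_distrib_left sum_distrib_right)
qed

lemma hamiltonian_eq_bond_sum:
  assumes "N \<ge> 2"
  shows "hamiltonian N x = bond_sum N (bond_weight (of_real x))"
proof (intro ext)
  fix \<psi> \<sigma>
  define loc where "loc j = (\<Sum>a\<in>UNIV. complex_of_real (coupling x a) *\<^sub>V
         (spin_op N a j (spin_op N a (j + 1) \<psi>) + 2 *\<^sub>V spin_op N a j (spin_op N a j \<psi>)))
      - (\<Sum>a\<in>UNIV. \<Sum>b\<in>UNIV. complex_of_real (quartic_coupling x a b) *\<^sub>V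
         spin_op N a j (spin_op N b j (spin_op N a (j + 1) (spin_op N b (j + 1) \<psi>))))" for j
  have "loc (Suc p) \<sigma> = translate N p (pair_op N (bond_weight (of_real x))) \<psi> \<sigma>" if p: "p < N" for p
  proof (cases "\<sigma> \<in> configs N")
    case True
    define q where "q = Suc p mod N"
    have len: "length \<sigma> = N" using True by (simp add: configs_def)
    have pq: "p \<noteq> q" "q < N" using assms p by (auto simp: q_def mod_Suc)
    have q0: "q = 0" if "Suc p = N" using that by (simp add: q_def)
    define t where "t d = (if Suc p = N then twist (\<sigma> ! 0) * twist d else 1)" for d
    define u where "u c d = \<psi> (\<sigma>[p := c, q := d])" for c d
    define e where "e a = (if Suc p = N \<and> a \<noteq> (3::3) then - 1 else (1::complex))" for a
    have mem: "\<tau>[i := c] \<in> configs N" if "\<tau> \<in> configs N" for \<tau> i c using that by (simp add: configs_def)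
    have sp: "spin_op N a (Suc p) \<phi> \<tau> = (\<Sum>c\<in>UNIV. spin a $ (\<tau> ! p) $ c * \<phi> (\<tau>[p := c]))"
      if "\<tau> \<in> configs N" for a \<phi> \<tau>
      using spin_op_apply[OF that, of p a \<phi>] p by simp
    have sq: "spin_op N a (Suc (Suc p)) \<phi> \<tau> = (\<Sum>d\<in>UNIV. e a * spin a $ (\<tau> ! q) $ d * \<phi> (\<tau>[q := d]))"
      if "\<tau> \<in> configs N" for a \<phi> \<tau>
      using spin_op_apply[OF that, of "Suc p" a \<phi>] p by (simp add: q_def e_def)
    have t1: "e a * spin a $ (\<sigma> ! q) $ d = t d * spin a $ (\<sigma> ! q) $ d" for a d
      using twist_spin[of a "\<sigma> ! q" d] by (auto simp: t_def e_def q0 split: if_splits)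
    have t2: "e a * e b * spin2 a b (\<sigma> ! q) d
      = t d * spin2 a b (\<sigma> ! q) d" for a b d
      using twist_spin2[of a b "\<sigma> ! q" d] by (auto simp: t_def e_def q0 split: if_splits)
    \<comment> \<open>The square terms leave the right site unchanged, so across the boundary its
      twist occurs twice and drops out.\<close>
    have t3: "t (\<sigma> ! q) = 1" by (simp add: t_def q0)
    have one: "spin_op N a (Suc p) (spin_op N a (Suc (Suc p)) \<psi>) \<sigma>
      = (\<Sum>c\<in>UNIV. \<Sum>d\<in>UNIV. t d * (spin a $ (\<sigma> ! p) $ c * spin a $ (\<sigma> ! q) $ d) * u c d)" for a
    proof -
      have "spin_op N a (Suc p) (spin_op N a (Suc (Suc p)) \<psi>) \<sigma>
        = (\<Sum>c\<in>UNIV. \<Sum>d\<in>UNIV. spin a $ (\<sigma> ! p) $ c * ((e a * spin a $ (\<sigma> ! q) $ d) * u c d))"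
        using pq by (simp add: sp sq True mem u_def sum_distrib_left)
      then show ?thesis
        unfolding t1 by (simp only: mult_ac)
    qed
    have two: "spin_op N a (Suc p) (spin_op N b (Suc p) \<phi>) \<tau> = (\<Sum>c\<in>UNIV. spin2 a b (\<tau> ! p) c * \<phi> (\<tau>[p := c]))"
      if "\<tau> \<in> configs N" for a b \<phi> \<tau>
    proof -
      have "spin_op N a (Suc p) (spin_op N b (Suc p) \<phi>) \<tau>
        = (\<Sum>k\<in>UNIV. \<Sum>c\<in>UNIV. spin a $ (\<tau> ! p) $ k * spin b $ k $ c * \<phi> (\<tau>[p := c]))"
        using that p by (simp add: sp mem sum_distrib_left configs_def mult.assoc)
      also have "\<dots> = (\<Sum>c\<in>UNIV. spin2 a b (\<tau> ! p) c * \<phi> (\<tau>[p := c]))"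
        unfolding spin2_def sum_distrib_right by (rule sum.swap)
      finally show ?thesis .
    qed
    have twoq: "spin_op N a (Suc (Suc p)) (spin_op N b (Suc (Suc p)) \<phi>) \<tau>
      = (\<Sum>d\<in>UNIV. e a * e b * spin2 a b (\<tau> ! q) d * \<phi> (\<tau>[q := d]))"
      if "\<tau> \<in> configs N" for a b \<phi> \<tau>
    proof -
      have "spin_op N a (Suc (Suc p)) (spin_op N b (Suc (Suc p)) \<phi>) \<tau>
        = (\<Sum>k\<in>UNIV. \<Sum>d\<in>UNIV. e a * e b
            * (spin a $ (\<tau> ! q) $ k * spin b $ k $ d) * \<phi> (\<tau>[q := d]))"
        using that pq by (simp add: sq mem sum_distrib_left configs_def mult_ac)
      also have "\<dots> = (\<Sum>d\<in>UNIV. e a * e b * spin2 a b (\<tau> ! q) d * \<phi> (\<tau>[q := d]))"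
        unfolding spin2_def sum_distrib_right sum_distrib_left by (rule sum.swap)
      finally show ?thesis .
    qed
    have square: "spin_op N a (Suc p) (spin_op N a (Suc p) \<psi>) \<sigma>
      = (\<Sum>c\<in>UNIV. \<Sum>d\<in>UNIV. t d * (spin2 a a (\<sigma> ! p) c * (if \<sigma> ! q = d then 1 else 0)) * u c d)" for a
    proof -
      have "(\<Sum>d\<in>UNIV. t d * (spin2 a a (\<sigma> ! p) c * (if \<sigma> ! q = d then 1 else 0)) * u c d)
        = (\<Sum>d\<in>UNIV. if \<sigma> ! q = d then t d * spin2 a a (\<sigma> ! p) c * u c d else 0)" for c
        by (intro sum.cong) auto
      moreover have "\<sigma>[p := c, q := \<sigma> ! q] = \<sigma>[p := c]" for c
        by (subst list_update_same_conv) (use pq len in auto)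
      ultimately show ?thesis
        by (simp add: two True t3 u_def)
    qed
    have quartic: "spin_op N a (Suc p) (spin_op N b (Suc p) (spin_op N a (Suc (Suc p)) (spin_op N b (Suc (Suc p)) \<psi>))) \<sigma>
      = (\<Sum>c\<in>UNIV. \<Sum>d\<in>UNIV. t d * (spin2 a b (\<sigma> ! p) c * spin2 a b (\<sigma> ! q) d) * u c d)" for a b
    proof -
      have "spin_op N a (Suc p) (spin_op N b (Suc p) (spin_op N a (Suc (Suc p)) (spin_op N b (Suc (Suc p)) \<psi>))) \<sigma>
        = (\<Sum>c\<in>UNIV. \<Sum>d\<in>UNIV. spin2 a b (\<sigma> ! p) c * ((e a * e b * spin2 a b (\<sigma> ! q) d) * u c d))"
        using pq by (simp add: two twoq True mem u_def sum_distrib_left)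
      then show ?thesis
        unfolding t2 by (simp only: mult_ac)
    qed
    have "loc (Suc p) \<sigma> = (\<Sum>a\<in>UNIV. complex_of_real (coupling x a) *
        ((\<Sum>c\<in>UNIV. \<Sum>d\<in>UNIV. t d * (spin a $ (\<sigma> ! p) $ c * spin a $ (\<sigma> ! q) $ d) * u c d)
        + 2 * (\<Sum>c\<in>UNIV. \<Sum>d\<in>UNIV. t d * (spin2 a a (\<sigma> ! p) c * (if \<sigma> ! q = d then 1 else 0)) * u c d)))
      - (\<Sum>a\<in>UNIV. \<Sum>b\<in>UNIV. complex_of_real (quartic_coupling x a b) *
        (\<Sum>c\<in>UNIV. \<Sum>d\<in>UNIV. t d * (spin2 a b (\<sigma> ! p) c * spin2 a b (\<sigma> ! q) d) * u c d))"
      by (simp add: loc_def sum_fun_apply cscale_def one square quartic)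
    also have "\<dots> = (\<Sum>c\<in>UNIV. \<Sum>d\<in>UNIV. t d * ((\<Sum>a\<in>UNIV. complex_of_real (coupling x a) * (spin a $ (\<sigma> ! p) $ c * spin a $ (\<sigma> ! q) $ d + 2 * (spin2 a a (\<sigma> ! p) c * (if \<sigma> ! q = d then 1 else 0))))
   - (\<Sum>a\<in>UNIV. \<Sum>b\<in>UNIV. complex_of_real (quartic_coupling x a b) * (spin2 a b (\<sigma> ! p) c * spin2 a b (\<sigma> ! q) d))) * u c d)"
      by (rule collect_density)
    also have "\<dots> = (\<Sum>c\<in>UNIV. \<Sum>d\<in>UNIV. t d * bond_weight (of_real x) (\<sigma> ! p) (\<sigma> ! q) c d * u c d)"
      unfolding hamiltonian_density ..
    also have "\<dots> = translate N p (pair_op N (bond_weight (of_real x))) \<psi> \<sigma>"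
      using translate_pair_op_apply[OF assms p True, of "bond_weight (of_real x)" \<psi>]
      by (simp add: t_def u_def q_def)
    finally show ?thesis .
  next
    case False
    have "is_op N (translate N p (pair_op N (bond_weight (of_real x))))"
      using assms by (intro is_op_translate) auto
    then show ?thesis
      using False by (simp add: loc_def sum_fun_apply cscale_def spin_op_outside is_op_outside)
  qed
  moreover have "hamiltonian N x \<psi> = (\<Sum>p<N. loc (Suc p))"
    unfolding hamiltonian_def loc_def
    by (rule sum.reindex_bij_witness[of _ Suc "\<lambda>j. j - 1"]) auto
  ultimately show "hamiltonian N x \<psi> \<sigma> = bond_sum N (bond_weight (of_real x)) \<psi> \<sigma>"
    by (simp add: bond_sum_def sum_fun_apply)
qed

section \<open>Fusion to the nineteen-vertex model\<close>

text \<open>Up to the factor \<open>\<i>\<close> this is the rotation by pi about the third axis for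
  spin one half.\<close>

definition aux_twist :: "bool \<Rightarrow> complex" where
  "aux_twist i = (if i then 1 else - 1)"

lemma twist_covariant_six_vertex:
  "twist_covariant aux_twist (six_vertex x g al be)" "twist_covariant aux_twist (six_vertex_defect x g al be)"
  unfolding twist_covariant_def by (auto simp: six_vertex_def six_vertex_defect_def aux_twist_def twist_def)

text \<open>\<open>v\<close> is a diagonal change of basis of the auxiliary space. It telescopes
  along the chain and leaves only its values at the two ends, which coincide in a trace.\<close>

lemma monodromy_flip:
  fixes L :: "bool weight"
  assumes "\<And>i j a b. L (\<not> i) (\<not> j) (flip a) (flip b) * v j = v i * L i j a b"
    and "length \<sigma> = n" "length \<tau> = n"
  shows "monodromy (replicate n L) (\<not> i) (\<not> j) (map flip \<sigma>) (map flip \<tau>) * v j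
    = v i * monodromy (replicate n L) i j \<sigma> \<tau>"
  using assms(2,3)
proof (induction n arbitrary: i \<sigma> \<tau>)
  case (Suc n)
  obtain a \<sigma>' b \<tau>' where eq: "\<sigma> = a # \<sigma>'" "\<tau> = b # \<tau>'" "length \<sigma>' = n" "length \<tau>' = n"
    using Suc.prems by (auto simp: length_Suc_conv)
  have "monodromy (replicate (Suc n) L) (\<not> i) (\<not> j) (map flip \<sigma>) (map flip \<tau>) * v j
    = (\<Sum>k\<in>UNIV. L (\<not> i) (\<not> k) (flip a) (flip b) * (monodromy (replicate n L) (\<not> k) (\<not> j) (map flip \<sigma>') (map flip \<tau>') * v j))"
    by (simp add: eq UNIV_bool algebra_simps)
  also have "\<dots> = (\<Sum>k\<in>UNIV. (L (\<not> i) (\<not> k) (flip a) (flip b) * v k) * monodromy (replicate n L) k j \<sigma>' \<tau>')"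
    using Suc.IH[OF eq(3,4)] by (simp add: mult.assoc)
  also have "\<dots> = v i * monodromy (replicate (Suc n) L) i j \<sigma> \<tau>"
    unfolding assms(1) by (simp add: eq sum_distrib_left mult.assoc)
  finally show ?case .
qed (auto)

text \<open>The spin flip exchanges the two auxiliary states, on which the twist has opposite signs. The assumption
  \<open>g \<noteq> 0\<close> is only needed to undo the asymmetric choice of the off-diagonal weights.\<close>

lemma transfer_six_vertex_flip:
  assumes "g \<noteq> 0"
  shows "spin_reversal N (transfer aux_twist (replicate N (six_vertex x g al be)) \<psi>)
    = - transfer aux_twist (replicate N (six_vertex x g al be)) (spin_reversal N \<psi>)"
proof -
  let ?L = "six_vertex x g al be" and ?v = "\<lambda>i. if i then 1 else g"
  let ?tk = "trans_kernel aux_twist (replicate N ?L)"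
  have loc: "?L (\<not> i) (\<not> j) (flip a) (flip b) * ?v j = ?v i * ?L i j a b" for i j a b
    using exhaust_3[of a] exhaust_3[of b]
    by (elim disjE; hypsubst; cases i; cases j; simp add: six_vertex_def flip_def)
  have diag: "monodromy (replicate N ?L) (\<not> i) (\<not> i) (map flip \<sigma>) (map flip \<tau>)
    = monodromy (replicate N ?L) i i \<sigma> \<tau>" if "\<sigma> \<in> configs N" "\<tau> \<in> configs N" for i \<sigma> \<tau>
    using monodromy_flip[of ?L ?v, OF loc, of \<sigma> N \<tau> i i] that assms
    by (auto simp: configs_def split: if_splits)
  have ker: "?tk (map flip \<sigma>) (map flip \<tau>) = - ?tk \<sigma> \<tau>" if "\<sigma> \<in> configs N" "\<tau> \<in> configs N" for \<sigma> \<tau>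
    using diag[OF that, of True] diag[OF that, of False]
    by (simp add: trans_kernel_def UNIV_bool aux_twist_def)
  have reidx: "(\<Sum>\<tau>\<in>configs N. f (map flip \<tau>)) = (\<Sum>\<tau>\<in>configs N. f \<tau>)" for f :: "config \<Rightarrow> complex"
    by (rule sum.reindex_bij_witness[of _ "map flip" "map flip"]) (auto simp: configs_def simp del: map_map)
  show ?thesis
  proof (rule ext)
    fix \<sigma>
    show "spin_reversal N (transfer aux_twist (replicate N ?L) \<psi>) \<sigma>
      = (- transfer aux_twist (replicate N ?L) (spin_reversal N \<psi>)) \<sigma>"
    proof (cases "\<sigma> \<in> configs N")
      case True
      have "(\<Sum>\<tau>\<in>configs N. ?tk (map flip \<sigma>) \<tau> * \<psi> \<tau>)
        = (\<Sum>\<tau>\<in>configs N. ?tk (map flip \<sigma>) (map flip \<tau>) * \<psi> (map flip \<tau>))"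
        by (rule reidx[symmetric])
      also have "\<dots> = (\<Sum>\<tau>\<in>configs N. - (?tk \<sigma> \<tau> * \<psi> (map flip \<tau>)))"
        using ker True by (intro sum.cong) auto
      finally show ?thesis
        using True by (simp add: spin_reversal_eq transfer_def kop_def sum_negf)
    qed (simp add: spin_reversal_eq transfer_def kop_def)
  qed
qed

text \<open>The action of \<open>aux_twist\<close> on both factors, restricted to the triplet. On
  the singlet the same product is -1, whence the minus sign in \<open>fused_kernel\<close>.\<close>

definition triplet_twist :: "3 \<Rightarrow> complex" where
  "triplet_twist i = (if i = 2 then - 1 else 1)"

definition fused_kernel :: "nat \<Rightarrow> complex \<Rightarrow> complex \<Rightarrow> config \<Rightarrow> config \<Rightarrow> complex" where
  "fused_kernel N x s \<sigma> \<tau> = trans_kernel triplet_twist (replicate N (nineteen_vertex x s)) \<sigma> \<tau>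
    - (- (x + s) * (1 + x * s)) ^ N * (if \<sigma> = \<tau> then 1 else 0)"

lemma monodromy_scalar:
  assumes "length \<sigma> = n" "length \<tau> = n"
  shows "monodromy (replicate n (\<lambda>(i::unit) (j::unit) a b. if a = b then c else 0)) i j \<sigma> \<tau>
    = (if \<sigma> = \<tau> then c ^ n else 0)"
  using assms
proof (induction n arbitrary: \<sigma> \<tau>)
  case (Suc n)
  then obtain a \<sigma>' b \<tau>' where "\<sigma> = a # \<sigma>'" "\<tau> = b # \<tau>'" "length \<sigma>' = n" "length \<tau>' = n"
    by (auto simp: length_Suc_conv)
  then show ?case using Suc.IH by (simp add: UNIV_unit)
qed auto

text \<open>The product of the two transfer matrices splits into the triplet part and the singlet part; the latter is
  scalar on every site.\<close>

lemma six_vertex_fusion: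
  fixes x s :: complex
  defines "g \<equiv> x * (1 + x * s + s\<^sup>2)"
  defines "A \<equiv> six_vertex x g 1 (x + s)" and "B \<equiv> six_vertex x g (- s) 1"
  assumes "x \<noteq> 0"
  shows "transfer aux_twist (replicate N A) \<circ> transfer aux_twist (replicate N B) = kop N (fused_kernel N x s)"
    and "transfer aux_twist (replicate N B) \<circ> transfer aux_twist (replicate N A) = kop N (fused_kernel N x s)"
proof -
  let ?\<delta> = "- (x + s) * (1 + x * s)"
  \<comment> \<open>The singlet is treated as a one-dimensional auxiliary space, so that
    \<open>monodromy_intertwine\<close> applies to it as well.\<close>
  let ?D = "\<lambda>(i::unit) (j::unit) (a::3) (b::3). if a = b then ?\<delta> else 0"
  let ?w = "\<lambda>k. if k = (True, False) then 1 else if k = (False, True) then - 1 else (0::complex)"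
  have ker: "trans_kernel (\<lambda>(i, i'). aux_twist i * aux_twist i') (replicate N (weight_comp A B)) \<sigma> \<tau> = fused_kernel N x s \<sigma> \<tau>"
    "trans_kernel (\<lambda>(i, i'). aux_twist i * aux_twist i') (replicate N (weight_comp B A)) \<sigma> \<tau> = fused_kernel N x s \<sigma> \<tau>"
    if "\<sigma> \<in> configs N" "\<tau> \<in> configs N" for \<sigma> \<tau>
  proof -
    define d where "d = monodromy (replicate N ?D) () () \<sigma> \<tau>"
    define T where "T = (\<lambda>i j. monodromy (replicate N (nineteen_vertex x s)) i j \<sigma> \<tau>)"
    have d: "d = ?\<delta> ^ N * (if \<sigma> = \<tau> then 1 else 0)"
      using that unfolding d_def by (subst monodromy_scalar) (auto simp: configs_def)
    have goal: "fused_kernel N x s \<sigma> \<tau> = T 1 1 - T 2 2 + T 3 3 - d"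
      by (simp add: fused_kernel_def d trans_kernel_def sum_3 triplet_twist_def T_def)
    show "trans_kernel (\<lambda>(i, i'). aux_twist i * aux_twist i') (replicate N (weight_comp A B)) \<sigma> \<tau> = fused_kernel N x s \<sigma> \<tau>"
    proof -
      define m where "m = (\<lambda>i j. monodromy (replicate N (weight_comp A B)) i j \<sigma> \<tau>)"
      have tri: "(\<Sum>k\<in>UNIV. fuse x i k * m k j) = (\<Sum>k\<in>UNIV. T i k * fuse x k j)" for i j
        unfolding m_def T_def A_def B_def g_def
        by (rule monodromy_intertwine) (rule fusion_triplet(1))
      have sing: "?w i * d = (\<Sum>k\<in>UNIV. m i k * ?w k)" for i
      proof -
        have "(\<Sum>k\<in>(UNIV::unit set). ?w i * monodromy (replicate N ?D) k () \<sigma> \<tau>) = (\<Sum>k\<in>UNIV. m i k * ?w k)"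
          unfolding m_def A_def B_def g_def
          by (rule monodromy_intertwine[of "\<lambda>i _. ?w i" ?D _ i N "()"])
            (use fusion_singlet(1)[of x s] in \<open>simp add: UNIV_unit\<close>)
        then show ?thesis by (simp add: d_def UNIV_unit)
      qed
      \<comment> \<open>The twisted trace sees only the four diagonal entries of \<open>m\<close>.
        The singlet relation shows that the two mixed ones add up to
        \<open>T 2 2 + d\<close>.\<close>
      have "m (True, True) (True, True) = T 1 1" "m (False, False) (False, False) = T 3 3"
        using tri[of 1 "(True, True)"] tri[of 3 "(False, False)"] \<open>x \<noteq> 0\<close>
        by (simp_all add: sum_bool_pair sum_3 fuse_def)
      moreover have "T 2 2 = m (True, False) (False, True) + m (False, True) (False, True)"
        using tri[of 2 "(False, True)"] by (simp add: sum_bool_pair sum_3 fuse_def)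
      moreover have "m (True, False) (True, False) = m (True, False) (False, True) + d"
        using sing[of "(True, False)"] by (simp add: sum_bool_pair UNIV_unit)
      ultimately show ?thesis
        unfolding goal by (simp add: trans_kernel_def sum_bool_pair aux_twist_def m_def)
    qed
    show "trans_kernel (\<lambda>(i, i'). aux_twist i * aux_twist i') (replicate N (weight_comp B A)) \<sigma> \<tau> = fused_kernel N x s \<sigma> \<tau>"
    proof -
      define m where "m = (\<lambda>i j. monodromy (replicate N (weight_comp B A)) i j \<sigma> \<tau>)"
      have tri: "(\<Sum>k\<in>UNIV. unfuse x i k * T k j) = (\<Sum>k\<in>UNIV. m i k * unfuse x k j)" for i j
        unfolding m_def T_def A_def B_def g_def
        by (rule monodromy_intertwine) (rule fusion_triplet(2)[symmetric])
      have sing: "(\<Sum>k\<in>UNIV. ?w k * m k j) = d * ?w j" for j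
      proof -
        have "(\<Sum>k\<in>UNIV. ?w k * m k j) = (\<Sum>k\<in>(UNIV::unit set). monodromy (replicate N ?D) () k \<sigma> \<tau> * ?w j)"
          unfolding m_def A_def B_def g_def
          by (rule monodromy_intertwine[of "\<lambda>_ k. ?w k" _ ?D "()"])
            (use fusion_singlet(2)[where x = x and s = s] in \<open>simp add: UNIV_unit\<close>)
        then show ?thesis by (simp add: d_def UNIV_unit)
      qed
      have "m (True, True) (True, True) = T 1 1" "m (False, False) (False, False) = T 3 3"
        using tri[of "(True, True)" 1] tri[of "(False, False)" 3] \<open>x \<noteq> 0\<close>
        by (simp_all add: sum_bool_pair sum_3 unfuse_def)
      moreover have "T 2 2 = m (False, True) (True, False) + m (False, True) (False, True)"
        using tri[of "(False, True)" 2] by (simp add: sum_bool_pair sum_3 unfuse_def)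
      moreover have "m (True, False) (True, False) = m (False, True) (True, False) + d"
        using sing[of "(True, False)"] by (simp add: sum_bool_pair algebra_simps)
      ultimately show ?thesis
        unfolding goal by (simp add: trans_kernel_def sum_bool_pair aux_twist_def m_def)
    qed
  qed
  show "transfer aux_twist (replicate N A) \<circ> transfer aux_twist (replicate N B) = kop N (fused_kernel N x s)"
    unfolding transfer_comp by (simp add: transfer_def) (rule kop_cong, rule ker)
  show "transfer aux_twist (replicate N B) \<circ> transfer aux_twist (replicate N A) = kop N (fused_kernel N x s)"
    unfolding transfer_comp by (simp add: transfer_def) (rule kop_cong, rule ker)
qed

section \<open>First-order expansion of the nineteen-vertex model at \<open>s = 0\<close>\<close>

definition nineteen_vertex_deriv :: "complex \<Rightarrow> 3 \<Rightarrow> 3 \<Rightarrow> 3 \<Rightarrow> 3 \<Rightarrow> complex" where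
  "nineteen_vertex_deriv x i j a b =
    (if i = b \<and> j = a then
       (if i = j then (if i = 2 then x\<^sup>2 - 1 else 1)
        else if i = 1 \<and> j = 3 then 2 * x\<^sup>2 else if i = 1 \<or> j = 3 then x\<^sup>2 else 0)
     else if i = j \<and> a = b then (if i = 2 \<or> a = 2 then - 1 else 1)
     else if i = 3 \<and> a = 1 \<and> b = 2 \<and> j = 2 \<or> i = 2 \<and> a = 2 \<and> b = 3 \<and> j = 1 then - x
     else if i = 2 \<and> a = 2 \<and> b = 1 \<and> j = 3 \<or> i = 1 \<and> a = 3 \<and> b = 2 \<and> j = 2 then - x
     else 0)"

lemma has_field_derivative_nineteen_vertex:
  "((\<lambda>s. nineteen_vertex x s i j a b) has_field_derivative nineteen_vertex_deriv x i j a b) (at 0)"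
  unfolding nineteen_vertex_def nineteen_vertex_deriv_def Let_def
  by (split if_split, (intro conjI impI)?)+ (auto intro!: derivative_eq_intros simp: power2_eq_square)

lemma nineteen_vertex_0: "nineteen_vertex x 0 i j a b = (if i = b \<and> j = a then x else 0)"
  by (simp add: nineteen_vertex_def)

text \<open>The last summand is a difference of one-site terms, which cancels under translation-invariant traces.\<close>

lemma nineteen_vertex_deriv_eq:
  "nineteen_vertex_deriv x i j a b = - bond_weight x i a b j
    + (if i = b \<and> a = j then 1 + x\<^sup>2 else 0)
    + (if i = b \<and> a = j then (if i = 1 then x\<^sup>2 - 2 else if i = 2 then 0 else - 2)
        - (if a = 1 then x\<^sup>2 - 2 else if a = 2 then 0 else - 2) else 0)"
  using exhaust_3[of i] exhaust_3[of j] exhaust_3[of a] exhaust_3[of b]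
  by (elim disjE; hypsubst; simp add: nineteen_vertex_deriv_def bond_weight_def)

lemma twist_covariant_nineteen_vertex:
  "twist_covariant triplet_twist (nineteen_vertex x s)" "twist_covariant triplet_twist (nineteen_vertex_deriv x)"
proof -
  have "triplet_twist i * nineteen_vertex x s i j a b = twist a * twist b * nineteen_vertex x s i j a b * triplet_twist j \<and>
    triplet_twist i * nineteen_vertex_deriv x i j a b = twist a * twist b * nineteen_vertex_deriv x i j a b * triplet_twist j" for i j a b
    using exhaust_3[of i] exhaust_3[of j] exhaust_3[of a] exhaust_3[of b]
    by (elim disjE; hypsubst; simp add: nineteen_vertex_deriv_def nineteen_vertex_def triplet_twist_def twist_def Let_def)
  then show "twist_covariant triplet_twist (nineteen_vertex x s)" "twist_covariant triplet_twist (nineteen_vertex_deriv x)"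
    by (simp_all add: twist_covariant_def)
qed

text \<open>Every vertex exchanges the auxiliary state with that of its site, so the whole row moves
  by one place.\<close>

lemma monodromy_nineteen_vertex_0:
  assumes "length \<sigma> = n" "length \<tau> = n"
  shows "monodromy (replicate n (nineteen_vertex x 0)) i j \<sigma> \<tau> = (if i # \<sigma> = \<tau> @ [j] then x ^ n else 0)"
  using assms
proof (induction n arbitrary: i \<sigma> \<tau>)
  case (Suc n)
  then obtain a \<sigma>' b \<tau>' where eq: "\<sigma> = a # \<sigma>'" "\<tau> = b # \<tau>'" "length \<sigma>' = n" "length \<tau>' = n"
    by (auto simp: length_Suc_conv)
  have "monodromy (replicate (Suc n) (nineteen_vertex x 0)) i j \<sigma> \<tau>
    = (\<Sum>k\<in>UNIV. if k = a then (if i = b then x else 0) * (if k # \<sigma>' = \<tau>' @ [j] then x ^ n else 0) else 0)"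
  proof -
    have "monodromy (replicate (Suc n) (nineteen_vertex x 0)) i j \<sigma> \<tau>
      = (\<Sum>k\<in>UNIV. nineteen_vertex x 0 i k a b * monodromy (replicate n (nineteen_vertex x 0)) k j \<sigma>' \<tau>')"
      by (simp add: eq)
    also have "\<dots> = (\<Sum>k\<in>UNIV. if k = a then (if i = b then x else 0) * (if k # \<sigma>' = \<tau>' @ [j] then x ^ n else 0) else 0)"
      unfolding Suc.IH[OF eq(3,4)] by (auto simp: nineteen_vertex_0 if_distrib[of "\<lambda>z. z * _"] cong: if_cong intro!: sum.cong)
    finally show ?thesis .
  qed
  then show ?case using eq by auto
qed auto

lemma has_field_derivative_monodromy:
  fixes T :: "complex \<Rightarrow> ('n::finite) weight"
  assumes "\<And>i j a b. ((\<lambda>s. T s i j a b) has_field_derivative T' i j a b) (at s0)"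
  shows "((\<lambda>s. monodromy (replicate n (T s)) i j \<sigma> \<tau>) has_field_derivative
    (\<Sum>l<n. monodromy ((replicate n (T s0))[l := T']) i j \<sigma> \<tau>)) (at s0)"
proof (induction n arbitrary: i \<sigma> \<tau>)
  case (Suc n)
  let ?m = "\<lambda>Ts k. monodromy Ts k j (tl \<sigma>) (tl \<tau>)" and ?a = "hd \<sigma>" and ?b = "hd \<tau>"
  have "((\<lambda>s. \<Sum>k\<in>UNIV. T s i k ?a ?b * ?m (replicate n (T s)) k) has_field_derivative
    (\<Sum>k\<in>UNIV. T' i k ?a ?b * ?m (replicate n (T s0)) k
      + (\<Sum>l<n. ?m ((replicate n (T s0))[l := T']) k) * T s0 i k ?a ?b)) (at s0)"
    by (intro DERIV_sum DERIV_mult assms Suc)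
  moreover have "(\<Sum>k\<in>UNIV. T' i k ?a ?b * ?m (replicate n (T s0)) k
      + (\<Sum>l<n. ?m ((replicate n (T s0))[l := T']) k) * T s0 i k ?a ?b)
    = (\<Sum>l<Suc n. monodromy ((replicate (Suc n) (T s0))[l := T']) i j \<sigma> \<tau>)"
  proof -
    have "(\<Sum>k\<in>UNIV. (\<Sum>l<n. ?m ((replicate n (T s0))[l := T']) k) * T s0 i k ?a ?b)
      = (\<Sum>l<n. \<Sum>k\<in>UNIV. T s0 i k ?a ?b * ?m ((replicate n (T s0))[l := T']) k)"
      unfolding sum_distrib_right by (subst sum.swap) (simp only: mult.commute)
    then show ?thesis
      unfolding sum.lessThan_Suc_shift sum.distrib by simp
  qed
  ultimately show ?case by simp
qed simp

section \<open>The trace of the spin reversal against powers of the Hamiltonian\<close>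

lemma transfer_replicate_update:
  assumes "j < N" "twist_covariant K T" "twist_covariant K X"
  shows "transfer K ((replicate N T)[j := X]) = translate N j (transfer K (X # replicate (N - 1) T))"
proof -
  let ?Ts = "(replicate N T)[j := X]"
  have split: "?Ts = replicate j T @ X # replicate (N - 1 - j) T"
    using assms(1) by (auto simp: list_eq_iff_nth_eq nth_append nth_Cons nth_list_update split: nat.split)
  have "rotate j ?Ts = X # replicate (N - 1 - j) T @ replicate j T"
    unfolding split using rotate_append[of "replicate j T" "X # replicate (N - 1 - j) T"] by simp
  also have "\<dots> = X # replicate (N - 1) T"
    using assms(1) by (simp add: replicate_add[symmetric])
  finally have rot: "rotate j ?Ts = X # replicate (N - 1) T" .
  have "set ?Ts \<subseteq> {T, X}" unfolding split by auto
  then have "twist_covariant K U" if "U \<in> set ?Ts" for U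
    using that assms(2,3) by blast
  then have "translate (length ?Ts) j (transfer K (rotate j ?Ts)) = transfer K ?Ts"
    using assms(1) by (intro translate_transfer_rotate) auto
  then show ?thesis by (simp add: rot)
qed

text \<open>The row is moved by one place and closed into a ring. The sign arises because
  \<open>triplet_twist\<close> is the negative of \<open>twist\<close>.\<close>

lemma transfer_nineteen_vertex_0:
  assumes "N > 0"
  shows "transfer triplet_twist (replicate N (nineteen_vertex x 0)) = (\<lambda>\<psi>. (- (x ^ N)) *\<^sub>V unshift N \<psi>)"
proof (intro ext)
  fix \<psi> \<sigma>
  show "transfer triplet_twist (replicate N (nineteen_vertex x 0)) \<psi> \<sigma> = ((- (x ^ N)) *\<^sub>V unshift N \<psi>) \<sigma>"
  proof (cases "\<sigma> \<in> configs N")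
    case True
    then obtain \<rho> c where \<sigma>: "\<sigma> = \<rho> @ [c]"
      using assms by (metis configs_nonempty rev_exhaust)
    have mem: "c # \<rho> \<in> configs N" using True by (simp add: \<sigma> configs_def)
    have ker: "trans_kernel triplet_twist (replicate N (nineteen_vertex x 0)) \<sigma> \<tau>
      = (if \<tau> = c # \<rho> then - (x ^ N) * twist c else 0)" if "\<tau> \<in> configs N" for \<tau>
    proof -
      have "trans_kernel triplet_twist (replicate N (nineteen_vertex x 0)) \<sigma> \<tau>
        = (\<Sum>i\<in>UNIV. triplet_twist i * (if i # \<sigma> = \<tau> @ [i] then x ^ N else 0))"
        using that True by (simp add: trans_kernel_def monodromy_nineteen_vertex_0 configs_def)
      also have "\<dots> = (\<Sum>i\<in>UNIV. if i = c then (if \<tau> = c # \<rho> then triplet_twist c * x ^ N else 0) else 0)"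
        by (intro sum.cong refl) (auto simp: \<sigma> append_Cons[symmetric] simp del: append_Cons)
      finally show ?thesis by (simp add: triplet_twist_def twist_def)
    qed
    have "transfer triplet_twist (replicate N (nineteen_vertex x 0)) \<psi> \<sigma>
      = (\<Sum>\<tau>\<in>configs N. if \<tau> = c # \<rho> then - (x ^ N) * twist c * \<psi> \<tau> else 0)"
      using True by (simp add: transfer_def kop_def ker if_distrib[of "\<lambda>z. z * _"] cong: if_cong)
    then show ?thesis
      using mem True by (simp add: cscale_def unshift_def \<sigma>)
  qed (simp add: transfer_def kop_def cscale_def unshift_def)
qed

text \<open>Permutations at all other sites feed the state of the last site into the defect as its
  auxiliary index. After undoing the translation, auxiliary line and site form two neighbouring
  sites, hence the reordering of the indices of \<open>T\<close>.\<close>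

lemma transfer_nineteen_vertex_deriv:
  assumes "N \<ge> 2"
  shows "transfer triplet_twist (T # replicate (N - 1) (nineteen_vertex x 0))
    = (\<lambda>\<psi>. (- (x ^ (N - 1))) *\<^sub>V unshift N (pair_op N (\<lambda>i a b j. T i j a b) \<psi>))"
proof (intro ext)
  fix \<psi> \<sigma>
  let ?Ts = "T # replicate (N - 1) (nineteen_vertex x 0)"
  let ?w = "\<lambda>i a b j. T i j a b"
  obtain n where n: "N = Suc (Suc n)" using assms by (metis add_2_eq_Suc le_Suc_ex)
  show "transfer triplet_twist ?Ts \<psi> \<sigma> = ((- (x ^ (N - 1))) *\<^sub>V unshift N (pair_op N ?w \<psi>)) \<sigma>"
  proof (cases "\<sigma> \<in> configs N")
    case True
    then obtain a \<tau> where \<tau>: "\<sigma> = a # \<tau>" "length \<tau> = Suc n"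
      using n by (auto simp: configs_def length_Suc_conv)
    then obtain \<rho> c where "\<tau> = \<rho> @ [c]"
      by (cases \<tau> rule: rev_cases) auto
    with \<tau> have \<sigma>: "\<sigma> = a # \<rho> @ [c]" and len: "length \<rho> = n" by simp_all
    have mem: "c # a # \<rho> \<in> configs N" using len n by (simp add: configs_def)
    have ker: "trans_kernel triplet_twist ?Ts \<sigma> (b # d # \<tau>)
      = (if \<tau> = \<rho> then - (x ^ (N - 1)) * twist c * T c d a b else 0)" if "length \<tau> = n" for b d \<tau>
    proof -
      have "trans_kernel triplet_twist ?Ts \<sigma> (b # d # \<tau>)
        = (\<Sum>i\<in>UNIV. triplet_twist i * (\<Sum>k\<in>UNIV. T i k a b * (if k # \<rho> @ [c] = (d # \<tau>) @ [i] then x ^ (N - 1) else 0)))"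
        using that len monodromy_nineteen_vertex_0[of "\<rho> @ [c]" "N - 1" "d # \<tau>" x]
        by (simp add: trans_kernel_def \<sigma> n del: replicate.simps)
      also have "\<dots> = (\<Sum>i\<in>UNIV. \<Sum>k\<in>UNIV. if k = d then (if i = c then (if \<tau> = \<rho> then triplet_twist c * T c d a b * x ^ (N - 1) else 0) else 0) else 0)"
        unfolding sum_distrib_left by (intro sum.cong refl) auto
      finally show ?thesis by (simp add: triplet_twist_def twist_def)
    qed
    have "transfer triplet_twist ?Ts \<psi> \<sigma>
      = (\<Sum>b\<in>UNIV. \<Sum>d\<in>UNIV. \<Sum>\<tau>\<in>configs n. if \<tau> = \<rho> then - (x ^ (N - 1)) * twist c * T c d a b * \<psi> (b # d # \<tau>) else 0)"
    proof -
      have "transfer triplet_twist ?Ts \<psi> \<sigma>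
        = (\<Sum>b\<in>UNIV. \<Sum>d\<in>UNIV. \<Sum>\<tau>\<in>configs n. trans_kernel triplet_twist ?Ts \<sigma> (b # d # \<tau>) * \<psi> (b # d # \<tau>))"
        using True by (simp add: transfer_def kop_def n sum_configs_Suc)
      then show ?thesis
        using ker by (simp add: configs_def if_distrib[of "\<lambda>z. z * _"] cong: if_cong)
    qed
    also have "\<dots> = (\<Sum>b\<in>UNIV. \<Sum>d\<in>UNIV. - (x ^ (N - 1)) * twist c * T c d a b * \<psi> (b # d # \<rho>))"
    proof -
      have "\<rho> \<in> configs n" using len by (simp add: configs_def)
      then show ?thesis by simp
    qed
    also have "\<dots> = ((- (x ^ (N - 1))) *\<^sub>V unshift N (pair_op N ?w \<psi>)) \<sigma>"
      using True mem by (simp add: cscale_def unshift_def \<sigma> pair_op_apply sum_distrib_left mult_ac sum_negf)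
    finally show ?thesis .
  qed (simp add: transfer_def kop_def cscale_def unshift_def n)
qed

text \<open>\<open>C\<close> stands for F H^k and enters through its invariance under the twisted
  translation.\<close>

context
  fixes N :: nat and C :: "state \<Rightarrow> state"
  assumes N0: "N > 0" and C: "is_op N C" and C_shift: "shift N \<circ> C = C \<circ> shift N"
begin

lemma trace_shift_conj:
  assumes "is_op N X"
  shows "trace_op N (C \<circ> (shift N \<circ> X \<circ> unshift N)) = trace_op N (C \<circ> X)"
proof -
  have "trace_op N (C \<circ> (shift N \<circ> X \<circ> unshift N)) = trace_op N (shift N \<circ> (C \<circ> X \<circ> unshift N))"
    using C_shift by (simp only: comp_assoc[symmetric])
  also have "\<dots> = trace_op N (C \<circ> X \<circ> unshift N \<circ> shift N)"
    by (intro trace_op_comm is_op_comp C assms is_op_shift is_op_unshift N0)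
  also have "\<dots> = trace_op N (C \<circ> X)"
    by (simp only: comp_assoc unshift_shift[OF N0] comp_id_op(1)[OF assms])
  finally show ?thesis .
qed

text \<open>It reduces Tr (C H), a sum over all bonds, to the contribution of a single bond.\<close>

lemma trace_translate:
  assumes "is_op N X"
  shows "trace_op N (C \<circ> translate N j X) = trace_op N (C \<circ> X)"
proof (induction j)
  case (Suc j)
  show ?case
    unfolding translate.simps trace_shift_conj[OF is_op_translate[OF N0 assms]] by (rule Suc)
qed simp

lemma translate_comp_shift:
  assumes "is_op N X"
  shows "translate N j X \<circ> shift N = translate N j (X \<circ> shift N)"
proof (induction j)
  case (Suc j)
  have "translate N (Suc j) X \<circ> shift N = shift N \<circ> (translate N j X \<circ> id_op N)"
    by (simp only: translate.simps comp_assoc unshift_shift[OF N0])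
  also have "\<dots> = shift N \<circ> (translate N j X \<circ> (shift N \<circ> unshift N))"
    by (simp only: shift_unshift[OF N0])
  also have "\<dots> = shift N \<circ> translate N j (X \<circ> shift N) \<circ> unshift N"
    by (simp only: comp_assoc[symmetric] Suc)
  finally show ?case by (simp only: translate.simps)
qed simp

lemma trace_unshift_conj:
  assumes "is_op N X"
  shows "trace_op N (C \<circ> (unshift N \<circ> X \<circ> shift N)) = trace_op N (C \<circ> X)"
proof -
  have "trace_op N (C \<circ> (unshift N \<circ> X \<circ> shift N))
    = trace_op N (C \<circ> (shift N \<circ> (unshift N \<circ> X \<circ> shift N) \<circ> unshift N))"
    by (rule trace_shift_conj[symmetric]) (intro is_op_comp is_op_shift is_op_unshift N0 assms)
  also have "shift N \<circ> (unshift N \<circ> X \<circ> shift N) \<circ> unshift N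
    = (shift N \<circ> unshift N) \<circ> X \<circ> (shift N \<circ> unshift N)"
    by (simp only: comp_assoc)
  finally show ?thesis
    by (simp only: shift_unshift[OF N0] comp_id_op[OF assms])
qed

lemma trace_comp_plus: "trace_op N (C \<circ> (\<lambda>\<psi>. A \<psi> + B \<psi>)) = trace_op N (C \<circ> A) + trace_op N (C \<circ> B)"
  by (simp add: o_def is_op_add[OF C] trace_op_plus)

lemma trace_comp_smult: "trace_op N (C \<circ> (\<lambda>\<psi>. c *\<^sub>V A \<psi>)) = c * trace_op N (C \<circ> A)"
  by (simp add: o_def is_op_scale[OF C] trace_op_smult)

lemma trace_comp_sum: "trace_op N (C \<circ> (\<lambda>\<psi>. \<Sum>i\<in>I. A i \<psi>)) = (\<Sum>i\<in>I. trace_op N (C \<circ> A i))"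
  by (simp add: o_def is_op_sum[OF C] trace_op_setsum)

lemma trace_nineteen_vertex_deriv:
  assumes "N \<ge> 2"
  shows "trace_op N (C \<circ> pair_op N (\<lambda>i a b j. nineteen_vertex_deriv x i j a b))
    = - trace_op N (C \<circ> pair_op N (bond_weight x)) + (1 + x\<^sup>2) * trace_op N (C \<circ> id_op N)"
proof -
  define y :: "3 \<Rightarrow> complex" where "y a = (if a = 1 then x\<^sup>2 - 2 else if a = 2 then 0 else - 2)" for a
  define Y where "Y = (\<lambda>\<psi> \<sigma>. if \<sigma> \<in> configs N then y (hd \<sigma>) * \<psi> \<sigma> else 0)"
  have Y: "is_op N Y"
    by (rule is_opI[of "{()}" _ _ "\<lambda>_ \<sigma>. y (hd \<sigma>)" "\<lambda>_ \<sigma>. \<sigma>"]) (auto simp: Y_def)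
  \<comment> \<open>\<open>Y\<close> acts on the first site and \<open>?Z\<close> is the same
    operator on the second; their traces against \<open>C\<close> agree.\<close>
  let ?Z = "shift N \<circ> Y \<circ> unshift N"
  let ?R = "\<lambda>\<psi>. (- 1) *\<^sub>V pair_op N (bond_weight x) \<psi> + ((1 + x\<^sup>2) *\<^sub>V id_op N \<psi> + (Y \<psi> + (- 1) *\<^sub>V ?Z \<psi>))"
  have "?R = pair_op N (\<lambda>i a b j. nineteen_vertex_deriv x i j a b)"
  proof (rule pair_op_eqI)
    show "is_op N ?R"
      by (intro is_op_plus is_op_smult is_op_pair_op is_op_id Y is_op_comp is_op_shift is_op_unshift N0)
    fix \<psi> a b \<rho> assume mem: "a # b # \<rho> \<in> configs N"
    then have mem': "b # \<rho> @ [a] \<in> configs N" by (simp add: configs_def)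
    have "(\<Sum>c\<in>UNIV. \<Sum>d\<in>UNIV. nineteen_vertex_deriv x a d b c * \<psi> (c # d # \<rho>))
      = (\<Sum>c\<in>UNIV. \<Sum>d\<in>UNIV. - (bond_weight x a b c d * \<psi> (c # d # \<rho>))
          + (if d = b then (if c = a then (1 + x\<^sup>2 + y a - y b) * \<psi> (a # b # \<rho>) else 0) else 0))"
      by (intro sum.cong refl) (auto simp: nineteen_vertex_deriv_eq y_def[symmetric] algebra_simps)
    also have "\<dots> = ?R \<psi> (a # b # \<rho>)"
      unfolding sum.distrib sum_negf using mem mem'
      by (simp add: pair_op_apply cscale_def id_op_def Y_def shift_def unshift_def) (simp add: algebra_simps)
    finally show "?R \<psi> (a # b # \<rho>) = (\<Sum>c\<in>UNIV. \<Sum>d\<in>UNIV. nineteen_vertex_deriv x a d b c * \<psi> (c # d # \<rho>))" ..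
  qed (rule assms)
  then have "trace_op N (C \<circ> pair_op N (\<lambda>i a b j. nineteen_vertex_deriv x i j a b)) = trace_op N (C \<circ> ?R)"
    by (simp only:)
  also have "\<dots> = - trace_op N (C \<circ> pair_op N (bond_weight x)) + (1 + x\<^sup>2) * trace_op N (C \<circ> id_op N)"
    unfolding trace_comp_plus trace_comp_smult trace_shift_conj[OF Y] by simp
  finally show ?thesis .
qed

lemma trace_bond_weight_zero:
  assumes "N \<ge> 2" "x \<noteq> 0"
    and fused: "\<forall>\<^sub>F s in nhds 0. trace_op N (C \<circ> kop N (fused_kernel N x s) \<circ> shift N) = 0"
  shows "trace_op N (C \<circ> pair_op N (bond_weight x)) = 0"
proof -
  let ?T = "nineteen_vertex x 0" and ?T' = "nineteen_vertex_deriv x"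
  let ?P = "pair_op N (\<lambda>i a b j. nineteen_vertex_deriv x i j a b)"
  let ?tr = "\<lambda>X. trace_op N (C \<circ> X)"
  let ?c = "of_nat N * (- x) ^ (N - 1) * (1 + x\<^sup>2)"
  let ?Ts = "\<lambda>l. (replicate N ?T)[l := ?T']"
  define D where "D \<sigma> \<tau> = (\<Sum>l<N. trans_kernel triplet_twist (?Ts l) \<sigma> \<tau>) + ?c * (if \<sigma> = \<tau> then 1 else 0)" for \<sigma> \<tau>
  note ops = C is_op_shift[of N] is_op_unshift[OF N0] is_op_id[of N] is_op_pair_op[of N]
  \<comment> \<open>With the kernel in last position the trace is a finite linear combination of its
    entries and can be differentiated entry by entry.\<close>
  have swap: "trace_op N (C \<circ> kop N m \<circ> shift N) = (\<Sum>\<sigma>\<in>configs N. \<Sum>\<tau>\<in>configs N. (shift N \<circ> C) (ket \<tau>) \<sigma> * m \<tau> \<sigma>)" for m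
  proof -
    have "trace_op N (C \<circ> kop N m \<circ> shift N) = trace_op N (shift N \<circ> (C \<circ> kop N m))"
      by (rule trace_op_comm) (intro is_op_comp ops is_op_kop)+
    also have "\<dots> = trace_op N ((shift N \<circ> C) \<circ> kop N m)"
      by (simp only: comp_assoc)
    also have "\<dots> = (\<Sum>\<sigma>\<in>configs N. \<Sum>\<tau>\<in>configs N. (shift N \<circ> C) (ket \<tau>) \<sigma> * m \<tau> \<sigma>)"
      by (rule trace_op_comp_kop) (intro is_op_comp ops)
    finally show ?thesis .
  qed
  have ker: "((\<lambda>s. fused_kernel N x s \<sigma> \<tau>) has_field_derivative D \<sigma> \<tau>) (at 0)" for \<sigma> \<tau>
  proof -
    have d1: "((\<lambda>s. trans_kernel triplet_twist (replicate N (nineteen_vertex x s)) \<sigma> \<tau>) has_field_derivative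
      (\<Sum>i\<in>UNIV. triplet_twist i * (\<Sum>l<N. monodromy (?Ts l) i i \<sigma> \<tau>))) (at 0)"
      unfolding trans_kernel_def
      by (intro DERIV_sum DERIV_cmult has_field_derivative_monodromy has_field_derivative_nineteen_vertex)
    have d2: "(\<Sum>i\<in>UNIV. triplet_twist i * (\<Sum>l<N. monodromy (?Ts l) i i \<sigma> \<tau>))
      = (\<Sum>l<N. trans_kernel triplet_twist (?Ts l) \<sigma> \<tau>)"
      unfolding trans_kernel_def sum_distrib_left by (rule sum.swap)
    have d3: "((\<lambda>s. (- (x + s) * (1 + x * s)) ^ N * (if \<sigma> = \<tau> then 1 else 0)) has_field_derivative
      - ?c * (if \<sigma> = \<tau> then 1 else 0)) (at 0)"
      by (auto intro!: derivative_eq_intros simp: algebra_simps power2_eq_square)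
    show ?thesis
      using DERIV_diff[OF d1[unfolded d2] d3] unfolding fused_kernel_def D_def by simp
  qed
  have "((\<lambda>s. trace_op N (C \<circ> kop N (fused_kernel N x s) \<circ> shift N)) has_field_derivative
     trace_op N (C \<circ> kop N D \<circ> shift N)) (at 0)"
    unfolding swap by (intro DERIV_sum DERIV_cmult ker)
  moreover have "((\<lambda>s. trace_op N (C \<circ> kop N (fused_kernel N x s) \<circ> shift N)) has_field_derivative 0) (at 0)"
    using fused by (subst DERIV_cong_ev[OF refl _ refl, of _ "\<lambda>_. 0"]) auto
  ultimately have deriv0: "trace_op N (C \<circ> kop N D \<circ> shift N) = 0"
    by (rule DERIV_unique)
  have id_shift: "id_op N \<circ> shift N = shift N" by (rule comp_id_op(2)[OF ops(2)])
  have "kop N D = (\<lambda>\<psi>. (\<Sum>l<N. transfer triplet_twist (?Ts l) \<psi>) + ?c *\<^sub>V id_op N \<psi>)"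
  proof (intro ext)
    fix \<psi> \<sigma>
    show "kop N D \<psi> \<sigma> = ((\<Sum>l<N. transfer triplet_twist (?Ts l) \<psi>) + ?c *\<^sub>V id_op N \<psi>) \<sigma>"
    proof (cases "\<sigma> \<in> configs N")
      case True
      have "(\<Sum>\<tau>\<in>configs N. ?c * (if \<sigma> = \<tau> then 1 else 0) * \<psi> \<tau>) = (\<Sum>\<tau>\<in>configs N. if \<sigma> = \<tau> then ?c * \<psi> \<tau> else 0)"
        by (intro sum.cong) auto
      also have "\<dots> = ?c * \<psi> \<sigma>" using True by simp
      finally have 1: "(\<Sum>\<tau>\<in>configs N. ?c * (if \<sigma> = \<tau> then 1 else 0) * \<psi> \<tau>) = ?c * \<psi> \<sigma>" .
      have 2: "(\<Sum>\<tau>\<in>configs N. (\<Sum>l<N. trans_kernel triplet_twist (?Ts l) \<sigma> \<tau>) * \<psi> \<tau>)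
        = (\<Sum>l<N. \<Sum>\<tau>\<in>configs N. trans_kernel triplet_twist (?Ts l) \<sigma> \<tau> * \<psi> \<tau>)"
        unfolding sum_distrib_right by (rule sum.swap)
      show ?thesis
        unfolding kop_def transfer_def D_def distrib_right sum.distrib 1 2
        using True by (simp add: sum_fun_apply cscale_def id_op_def)
    qed (simp add: sum_fun_apply kop_def transfer_def cscale_def id_op_def)
  qed
  then have D_shift: "kop N D \<circ> shift N = (\<lambda>\<psi>. (\<Sum>l<N. (transfer triplet_twist (?Ts l) \<circ> shift N) \<psi>) + ?c *\<^sub>V (id_op N \<circ> shift N) \<psi>)"
    by (simp add: fun_eq_iff)
  have summand: "?tr (transfer triplet_twist (?Ts l) \<circ> shift N) = - (x ^ (N - 1)) * ?tr ?P" if "l < N" for l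
  proof -
    let ?X = "transfer triplet_twist (?T' # replicate (N - 1) ?T)"
    have X: "is_op N ?X" using N0 by (intro is_op_transfer) simp
    have "?tr (transfer triplet_twist (?Ts l) \<circ> shift N) = ?tr (translate N l (?X \<circ> shift N))"
      by (simp only: transfer_replicate_update[OF that twist_covariant_nineteen_vertex] translate_comp_shift[OF X])
    also have "\<dots> = ?tr (?X \<circ> shift N)"
      by (intro trace_translate is_op_comp X ops)
    also have "?X \<circ> shift N = (\<lambda>\<psi>. (- (x ^ (N - 1))) *\<^sub>V (unshift N \<circ> ?P \<circ> shift N) \<psi>)"
      unfolding transfer_nineteen_vertex_deriv[OF assms(1)] by (simp add: o_def)
    also have "?tr \<dots> = - (x ^ (N - 1)) * ?tr ?P"
      unfolding trace_comp_smult by (simp only: trace_unshift_conj[OF is_op_pair_op])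
    finally show ?thesis .
  qed
  have "(\<Sum>l<N. ?tr (transfer triplet_twist (?Ts l) \<circ> shift N)) = (\<Sum>l<N. - (x ^ (N - 1)) * ?tr ?P)"
    by (intro sum.cong refl summand) simp
  then have summands: "(\<Sum>l<N. ?tr (transfer triplet_twist (?Ts l) \<circ> shift N)) = of_nat N * (- (x ^ (N - 1)) * ?tr ?P)"
    by simp
  have "trace_op N (C \<circ> kop N D \<circ> shift N) = of_nat N * (- (x ^ (N - 1)) * ?tr ?P) + ?c * ?tr (shift N)"
    unfolding comp_assoc D_shift trace_comp_plus trace_comp_sum trace_comp_smult id_shift
    by (simp only: summands)
  \<comment> \<open>The derivative at 0. The factor 1 + x^2 on the right stems from the quantum
    determinant.\<close>
  with deriv0 have "of_nat N * (x ^ (N - 1) * ?tr ?P) = of_nat N * ((- x) ^ (N - 1) * (1 + x\<^sup>2) * ?tr (shift N))"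
    by (simp add: algebra_simps)
  then have eq1: "x ^ (N - 1) * ?tr ?P = (- x) ^ (N - 1) * (1 + x\<^sup>2) * ?tr (shift N)"
    using N0 by (subst (asm) mult_cancel_left) simp
  have "kop N (fused_kernel N x 0) \<circ> shift N = (\<lambda>\<psi>. (- (x ^ N)) *\<^sub>V (unshift N \<circ> shift N) \<psi> + (- ((- x) ^ N)) *\<^sub>V (id_op N \<circ> shift N) \<psi>)"
  proof -
    have "kop N (fused_kernel N x 0) \<psi> \<sigma> = (transfer triplet_twist (replicate N ?T) \<psi> + (- ((- x) ^ N)) *\<^sub>V id_op N \<psi>) \<sigma>" for \<psi> \<sigma>
    proof (cases "\<sigma> \<in> configs N")
      case True
      have "(\<Sum>\<tau>\<in>configs N. (- x) ^ N * (if \<sigma> = \<tau> then 1 else 0) * \<psi> \<tau>) = (\<Sum>\<tau>\<in>configs N. if \<sigma> = \<tau> then (- x) ^ N * \<psi> \<tau> else 0)"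
        by (intro sum.cong) auto
      also have "\<dots> = (- x) ^ N * \<psi> \<sigma>" using True by simp
      finally have 1: "(\<Sum>\<tau>\<in>configs N. (- x) ^ N * (if \<sigma> = \<tau> then 1 else 0) * \<psi> \<tau>) = (- x) ^ N * \<psi> \<sigma>" .
      show ?thesis
        using True 1 by (simp add: kop_def fused_kernel_def transfer_def id_op_def cscale_def left_diff_distrib sum_subtractf)
    qed (simp add: kop_def transfer_def id_op_def cscale_def)
    then show ?thesis
      by (simp add: fun_eq_iff transfer_nineteen_vertex_0[OF N0])
  qed
  then have "trace_op N (C \<circ> kop N (fused_kernel N x 0) \<circ> shift N) = - (x ^ N) * ?tr (id_op N) - (- x) ^ N * ?tr (shift N)"
    unfolding comp_assoc by (simp only: trace_comp_plus trace_comp_smult unshift_shift[OF N0] id_shift) simp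
  moreover have "trace_op N (C \<circ> kop N (fused_kernel N x 0) \<circ> shift N) = 0"
    using fused by (rule eventually_nhds_x_imp_x)
  ultimately have "x * (x ^ (N - 1) * ?tr (id_op N)) = x * ((- x) ^ (N - 1) * ?tr (shift N))"
    using N0 by (cases N) (simp_all add: algebra_simps)
  then have eq2: "x ^ (N - 1) * ?tr (id_op N) = (- x) ^ (N - 1) * ?tr (shift N)"
    using assms(2) by simp
  \<comment> \<open>Eliminating the trace with the shift leaves exactly the additive constant of
    \<open>trace_nineteen_vertex_deriv\<close>, so the bond term must vanish.\<close>
  have "x ^ (N - 1) * ?tr ?P = x ^ (N - 1) * ((1 + x\<^sup>2) * ?tr (id_op N))"
    unfolding eq1 using eq2 by (simp add: mult_ac)
  then have "?tr ?P = (1 + x\<^sup>2) * ?tr (id_op N)"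
    using assms(2) by simp
  then show ?thesis
    using trace_nineteen_vertex_deriv[OF assms(1), of x] by simp
qed

end

text \<open>The parameter is complex, as in the local identities; it is specialised to real values
  for self-adjointness.\<close>

definition xxz :: "nat \<Rightarrow> complex \<Rightarrow> state \<Rightarrow> state" where
  "xxz N x = bond_sum N (bond_weight x)"

lemma xxz_shift:
  assumes "N \<ge> 2"
  shows "shift N \<circ> xxz N x = xxz N x \<circ> shift N"
proof -
  have "twist a * twist b * twist c * twist d * bond_weight x a b c d = bond_weight x a b c d" for a b c d
    using exhaust_3[of a] exhaust_3[of b] exhaust_3[of c] exhaust_3[of d]
    by (elim disjE; hypsubst; simp add: bond_weight_def twist_def)
  then show ?thesis
    unfolding xxz_def using assms by (intro bond_sum_shift translate_pair_op_cyclic) auto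
qed

lemma xxz_transfer:
  assumes "N \<ge> 2" "g = x * (al\<^sup>2 + be\<^sup>2 - x * al * be)"
  shows "xxz N x \<circ> transfer aux_twist (replicate N (six_vertex x g al be))
    = transfer aux_twist (replicate N (six_vertex x g al be)) \<circ> xxz N x"
proof -
  have sym: "(\<Sum>c\<in>UNIV. \<Sum>d\<in>UNIV. bond_weight x c d b b' * f c d)
    = (\<Sum>c\<in>UNIV. \<Sum>d\<in>UNIV. bond_weight x b b' c d * f c d)" for b b' f
    by (intro sum.cong refl arg_cong[of _ _ "\<lambda>z. z * _"] bond_weight_sym)
  show ?thesis
    unfolding xxz_def
    by (rule bond_sum_commute_transfer[OF assms(1) twist_covariant_six_vertex])
      (unfold sym, rule sutherland[OF assms(2)])
qed

lemma is_op_xxz: "N > 0 \<Longrightarrow> is_op N (xxz N x)"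
  by (simp add: xxz_def is_op_bond_sum)

lemma comp_funpow_commute: "f \<circ> g = g \<circ> f \<Longrightarrow> f \<circ> g ^^ k = g ^^ k \<circ> f"
  by (induction k) (auto simp: fun_eq_iff)

lemma trace_spin_reversal_xxz_power_nonzero:
  assumes N2: "N \<ge> 2" and "x \<noteq> 0"
  shows "trace_op N (spin_reversal N \<circ> (xxz N x ^^ Suc k \<circ> id_op N)) = 0"
proof -
  let ?H = "xxz N x" and ?F = "spin_reversal N"
  define C where "C = ?F \<circ> (?H ^^ k \<circ> id_op N)"
  have N0: "N > 0" using N2 by simp
  have H: "is_op N ?H" using N0 by (rule is_op_xxz)
  have C: "is_op N C"
    unfolding C_def by (intro is_op_comp is_op_spin_reversal is_op_funpow H)
  have C_shift: "shift N \<circ> C = C \<circ> shift N"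
  proof -
    have "shift N \<circ> C = ?F \<circ> ((shift N \<circ> ?H ^^ k) \<circ> id_op N)"
      unfolding C_def by (simp only: comp_assoc[symmetric] shift_spin_reversal)
    also have "shift N \<circ> ?H ^^ k = ?H ^^ k \<circ> shift N"
      by (rule comp_funpow_commute[OF xxz_shift[OF N2]])
    finally show ?thesis
      unfolding C_def by (simp only: comp_assoc comp_id_op[OF is_op_shift])
  qed
  have zero_if_neg: "z = 0" if "z = - z" for z :: complex
    using that by (auto simp: complex_eq_iff)
  have zero: "trace_op N (C \<circ> kop N (fused_kernel N x s) \<circ> shift N) = 0"
    if g: "x * (1 + x * s + s\<^sup>2) \<noteq> 0" for s
  proof -
    let ?g = "x * (1 + x * s + s\<^sup>2)"
    let ?A = "transfer aux_twist (replicate N (six_vertex x ?g 1 (x + s)))"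
    let ?B = "transfer aux_twist (replicate N (six_vertex x ?g (- s) 1))"
    have A: "is_op N ?A" and B: "is_op N ?B" by (simp_all add: is_op_transfer)
    have HA: "?H \<circ> ?A = ?A \<circ> ?H"
      by (rule xxz_transfer[OF N2]) (simp add: algebra_simps power2_eq_square)
    have CA: "C (?A \<psi>) = - ?A (C \<psi>)" for \<psi>
    proof -
      have "(?H ^^ k) (?A \<phi>) = ?A ((?H ^^ k) \<phi>)" for \<phi>
        using comp_funpow_commute[OF HA[symmetric], of k, THEN fun_cong, of \<phi>] by simp
      moreover have "id_op N (?A \<psi>) = ?A (id_op N \<psi>)"
        using comp_id_op[OF A, THEN fun_cong, of \<psi>] by simp
      ultimately show ?thesis
        unfolding C_def comp_apply by (simp only: transfer_six_vertex_flip[OF g])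
    qed
    have "trace_op N (C \<circ> (?A \<circ> ?B) \<circ> shift N) = trace_op N (\<lambda>\<psi>. (- 1) *\<^sub>V (?A \<circ> (C \<circ> ?B \<circ> shift N)) \<psi>)"
      by (intro arg_cong[of _ _ "trace_op N"] ext)
        (simp only: comp_apply CA cscale_def uminus_apply mult_minus1)
    also have "\<dots> = - trace_op N (?A \<circ> (C \<circ> ?B \<circ> shift N))"
      by (simp only: trace_op_smult mult_minus1)
    finally have 1: "trace_op N (C \<circ> (?A \<circ> ?B) \<circ> shift N) = - trace_op N (?A \<circ> (C \<circ> ?B \<circ> shift N))" .
    have 2: "trace_op N (?A \<circ> (C \<circ> ?B \<circ> shift N)) = trace_op N (C \<circ> ?B \<circ> shift N \<circ> ?A)"
      by (rule trace_op_comm[OF A]) (intro is_op_comp B C is_op_shift)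
    \<comment> \<open>\<open>A\<close> returns behind \<open>B\<close>. Both orders have the same
      fused kernel, so the trace equals its own negative.\<close>
    have 3: "C \<circ> ?B \<circ> shift N \<circ> ?A = C \<circ> (?B \<circ> ?A) \<circ> shift N"
      unfolding comp_assoc shift_transfer[OF twist_covariant_six_vertex(1) N0] ..
    show ?thesis
      using 1 unfolding 2 3 six_vertex_fusion[OF assms(2)] by (rule zero_if_neg)
  qed
  \<comment> \<open>At \<open>s = 0\<close> the expression is \<open>x\<close>, so it stays away
    from zero nearby; a neighbourhood is what differentiation at 0 requires.\<close>
  have "\<forall>\<^sub>F s in nhds 0. x * (1 + x * s + s\<^sup>2) \<noteq> 0"
  proof -
    have "open {s. x * (1 + x * s + s\<^sup>2) \<noteq> 0}"
      by (intro open_Collect_neq continuous_intros)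
    then show ?thesis
      using eventually_nhds_in_open[of "{s. x * (1 + x * s + s\<^sup>2) \<noteq> 0}" 0] assms(2) by simp
  qed
  then have "\<forall>\<^sub>F s in nhds 0. trace_op N (C \<circ> kop N (fused_kernel N x s) \<circ> shift N) = 0"
    by (rule eventually_mono) (rule zero)
  then have "trace_op N (C \<circ> pair_op N (bond_weight x)) = 0"
    by (rule trace_bond_weight_zero[OF N0 C C_shift N2 assms(2)])
  then have "(\<Sum>l<N. trace_op N (C \<circ> translate N l (pair_op N (bond_weight x)))) = 0"
    by (simp only: trace_translate[OF N0 C C_shift is_op_pair_op] sum.neutral_const)
  then have "trace_op N (C \<circ> ?H) = 0"
    unfolding xxz_def bond_sum_def[abs_def] trace_comp_sum[OF N0 C C_shift] .
  moreover have "C \<circ> ?H = ?F \<circ> (?H ^^ Suc k \<circ> id_op N)"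
    unfolding C_def comp_assoc comp_id_op(2)[OF H] funpow_Suc_right comp_id_op(1)[OF H] ..
  ultimately show ?thesis by simp
qed

text \<open>The fusion argument degenerates at \<open>x = 0\<close>; the case follows from continuity in \<open>x\<close>.\<close>

lemma trace_spin_reversal_xxz_power:
  assumes "N \<ge> 2"
  shows "trace_op N (spin_reversal N \<circ> (xxz N (of_real x) ^^ Suc k \<circ> id_op N)) = 0"
proof (cases "x = 0")
  case True
  let ?f = "\<lambda>x::complex. trace_op N (spin_reversal N \<circ> (xxz N x ^^ Suc k \<circ> id_op N))"
  have N0: "N > 0" using assms by simp
  have isCont_if: "isCont f 0 \<Longrightarrow> isCont g 0 \<Longrightarrow> isCont (\<lambda>x. if P then f x else g x) 0" for f g :: "complex \<Rightarrow> complex" and P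
    by (cases P) auto
  have weight: "isCont (\<lambda>x. bond_weight x a b c d) 0" for a b c d
    unfolding bond_weight_def by (intro isCont_if continuous_intros)
  \<comment> \<open>The vector may depend on \<open>x\<close> too, because in a power of the
    operator the inner factors vary along with the outer one.\<close>
  have translate: "isCont (\<lambda>x. translate N l (pair_op N (bond_weight x)) (\<psi> x) \<sigma>) 0"
    if "\<And>\<tau>. isCont (\<lambda>x. \<psi> x \<tau>) 0" for l \<sigma> and \<psi> :: "complex \<Rightarrow> state"
    using that
  proof (induction l arbitrary: \<psi> \<sigma>)
    case 0
    then show ?case
      unfolding translate.simps pair_op_def kop_def pair_kernel_def
      by (intro isCont_if continuous_intros weight)
  next
    case (Suc l)
    have "isCont (\<lambda>x. unshift N (\<psi> x) \<tau>) 0" for \<tau>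
      unfolding unshift_def by (intro isCont_if continuous_intros Suc.prems)
    then have "isCont (\<lambda>x. translate N l (pair_op N (bond_weight x)) (unshift N (\<psi> x)) \<tau>) 0" for \<tau>
      by (rule Suc.IH)
    then show ?case
      unfolding translate.simps comp_apply shift_def by (intro isCont_if continuous_intros)
  qed
  have power: "isCont (\<lambda>x. (xxz N x ^^ l) \<psi> \<sigma>) 0" for l \<psi> \<sigma>
  proof (induction l arbitrary: \<sigma>)
    case (Suc l)
    show ?case
      unfolding funpow.simps comp_apply xxz_def bond_sum_def[of N _ "_ \<psi>"] sum_fun_apply
      by (intro continuous_intros translate Suc[unfolded xxz_def])
  qed simp
  have "isCont ?f 0"
    unfolding trace_op_def spin_reversal_eq comp_apply
    by (intro continuous_intros isCont_if power)
  then have "?f \<midarrow>0\<rightarrow> ?f 0" by (simp add: isCont_def)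
  moreover have "?f \<midarrow>0\<rightarrow> 0"
    by (rule tendsto_eventually)
      (auto simp: eventually_at_filter trace_spin_reversal_xxz_power_nonzero[OF assms] simp del: funpow.simps)
  ultimately have "?f 0 = 0" by (rule LIM_unique)
  then show ?thesis using True by simp
qed (use assms in \<open>simp add: trace_spin_reversal_xxz_power_nonzero del: funpow.simps\<close>)

section \<open>Dimensions as traces\<close>

lemma chain_space_expand:
  assumes "\<psi> \<in> chain_space N"
  shows "(\<Sum>\<sigma>\<in>configs N. \<psi> \<sigma> *\<^sub>V ket \<sigma>) = \<psi>"
proof
  fix \<tau>
  have "(\<Sum>\<sigma>\<in>configs N. \<psi> \<sigma> *\<^sub>V ket \<sigma>) \<tau> = (\<Sum>\<sigma>\<in>configs N. (\<psi> \<sigma> *\<^sub>V ket \<sigma>) \<tau>)"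
    by (rule sum_fun_apply)
  also have "\<dots> = (\<Sum>\<sigma>\<in>configs N. if \<tau> = \<sigma> then \<psi> \<sigma> else 0)"
    by (intro sum.cong) (auto simp: cscale_def ket_def)
  finally show "(\<Sum>\<sigma>\<in>configs N. \<psi> \<sigma> *\<^sub>V ket \<sigma>) \<tau> = \<psi> \<tau>"
    using assms by (auto simp: chain_space_def)
qed

lemma chain_space_span: "chain_space N \<subseteq> state.span (ket ` configs N)"
proof
  fix \<psi> assume "\<psi> \<in> chain_space N"
  then have "\<psi> = (\<Sum>\<sigma>\<in>configs N. \<psi> \<sigma> *\<^sub>V ket \<sigma>)" by (simp add: chain_space_expand)
  also have "\<dots> \<in> state.span (ket ` configs N)"
    by (intro state.span_sum state.span_scale state.span_base) auto
  finally show "\<psi> \<in> state.span (ket ` configs N)" .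
qed

lemma independent_chain_space:
  assumes "state.independent B" "B \<subseteq> chain_space N"
  shows "finite B" "card B \<le> card (configs N)"
proof -
  have "finite B \<and> card B \<le> card (ket ` configs N)"
    using assms chain_space_span by (intro state.independent_span_bound) auto
  then show "finite B" "card B \<le> card (configs N)"
    using card_image_le[of "configs N" ket] by auto
qed

text \<open>\<open>Q\<close> is a projection onto \<open>U\<close>, possibly oblique. Expanding the
  images of the basis kets in a basis of \<open>U\<close> turns the trace into the sum over
  \<open>b\<close> of the \<open>b\<close>-coefficient of \<open>Q b = b\<close>, which is 1 each
  time.\<close>

lemma dim_eq_trace:
  assumes Q: "is_op N Q" and U: "state.subspace U" and in_U: "\<And>\<psi>. Q \<psi> \<in> U"
    and on_U: "\<And>u. u \<in> U \<Longrightarrow> Q u = u"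
  shows "of_nat (state.dim U) = trace_op N Q"
proof -
  have chain: "U \<subseteq> chain_space N"
  proof
    fix u assume "u \<in> U"
    then show "u \<in> chain_space N"
      using is_op_in_chain_space[OF Q, of u] by (simp only: on_U)
  qed
  obtain B where B: "B \<subseteq> U" "state.independent B" "U \<subseteq> state.span B" "card B = state.dim U"
    using state.basis_exists by blast
  have fin: "finite B"
    using independent_chain_space(1)[OF B(2)] B(1) chain by blast
  define r where "r = state.representation B"
  have span: "\<psi> \<in> state.span B" if "\<psi> \<in> U" for \<psi> using B(3) that by blast
  have expand: "(\<Sum>b\<in>B. r \<psi> b *\<^sub>V b) = \<psi>" if "\<psi> \<in> U" for \<psi>
    unfolding r_def by (rule state.sum_representation_eq) (use B fin span that in auto)
  have coeff: "(\<Sum>\<sigma>\<in>configs N. b \<sigma> * r (Q (ket \<sigma>)) b) = 1" if "b \<in> B" for b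
  proof -
    have bU: "b \<in> U" using that B(1) by blast
    have "r (\<Sum>\<sigma>\<in>configs N. b \<sigma> *\<^sub>V Q (ket \<sigma>)) b = (\<Sum>\<sigma>\<in>configs N. r (b \<sigma> *\<^sub>V Q (ket \<sigma>)) b)"
      unfolding r_def using B(2) by (subst state.representation_sum) (auto intro: span in_U state.span_scale)
    also have "\<dots> = (\<Sum>\<sigma>\<in>configs N. b \<sigma> * r (Q (ket \<sigma>)) b)"
      unfolding r_def using B(2) by (subst state.representation_scale) (auto intro: span in_U)
    also have "(\<Sum>\<sigma>\<in>configs N. b \<sigma> *\<^sub>V Q (ket \<sigma>)) = b"
    proof -
      have "(\<Sum>\<sigma>\<in>configs N. b \<sigma> *\<^sub>V Q (ket \<sigma>)) = Q (\<Sum>\<sigma>\<in>configs N. b \<sigma> *\<^sub>V ket \<sigma>)"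
        by (simp add: is_op_sum[OF Q] is_op_scale[OF Q])
      then show ?thesis
        using chain bU by (simp add: chain_space_expand subsetD on_U)
    qed
    also have "r b b = 1"
      unfolding r_def using B(2) that by (simp add: state.representation_basis)
    finally show ?thesis by simp
  qed
  have "trace_op N Q = (\<Sum>\<sigma>\<in>configs N. \<Sum>b\<in>B. r (Q (ket \<sigma>)) b * b \<sigma>)"
  proof -
    have "Q (ket \<sigma>) \<sigma> = (\<Sum>b\<in>B. r (Q (ket \<sigma>)) b * b \<sigma>)" for \<sigma>
    proof -
      have "Q (ket \<sigma>) \<sigma> = (\<Sum>b\<in>B. r (Q (ket \<sigma>)) b *\<^sub>V b) \<sigma>"
        by (simp only: expand[OF in_U])
      then show ?thesis by (simp add: sum_fun_apply cscale_def)
    qed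
    then show ?thesis by (simp add: trace_op_def)
  qed
  also have "\<dots> = (\<Sum>b\<in>B. \<Sum>\<sigma>\<in>configs N. b \<sigma> * r (Q (ket \<sigma>)) b)"
    by (subst sum.swap) (simp add: mult.commute)
  also have "\<dots> = of_nat (card B)"
    by (simp add: coeff)
  finally show ?thesis by (simp add: B(4))
qed

section \<open>Polynomials of a self-adjoint operator\<close>

definition op_poly :: "(state \<Rightarrow> state) \<Rightarrow> complex poly \<Rightarrow> state \<Rightarrow> state" where
  "op_poly H p \<psi> = (\<Sum>i\<le>degree p. coeff p i *\<^sub>V (H ^^ i) \<psi>)"

lemma cscale_zero [simp]: "0 *\<^sub>V \<psi> = 0" "c *\<^sub>V 0 = 0"
  by (auto simp: cscale_def fun_eq_iff)

lemma op_poly_eq: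
  assumes "degree p \<le> n"
  shows "op_poly H p \<psi> = (\<Sum>i\<le>n. coeff p i *\<^sub>V (H ^^ i) \<psi>)"
  unfolding op_poly_def
  by (rule sum.mono_neutral_left) (use assms in \<open>auto simp: coeff_eq_0\<close>)

lemma op_poly_0 [simp]: "op_poly H 0 \<psi> = 0"
  by (simp add: op_poly_def)

lemma op_poly_pCons:
  assumes "is_op N H"
  shows "op_poly H (pCons a p) \<psi> = a *\<^sub>V \<psi> + H (op_poly H p \<psi>)"
proof -
  have "op_poly H (pCons a p) \<psi> = (\<Sum>i\<le>Suc (degree p). coeff (pCons a p) i *\<^sub>V (H ^^ i) \<psi>)"
    by (rule op_poly_eq) (rule degree_pCons_le)
  also have "\<dots> = a *\<^sub>V \<psi> + H (op_poly H p \<psi>)"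
    unfolding sum.atMost_Suc_shift op_poly_def is_op_sum[OF assms] is_op_scale[OF assms] by simp
  finally show ?thesis .
qed

lemma op_poly_add: "op_poly H (p + q) \<psi> = op_poly H p \<psi> + op_poly H q \<psi>"
proof -
  let ?n = "max (degree p) (degree q)"
  have "degree (p + q) \<le> ?n" by (rule degree_add_le) auto
  then show ?thesis
    by (simp add: op_poly_eq[of _ ?n] state.scale_left_distrib sum.distrib)
qed

lemma op_poly_smult: "op_poly H (smult c p) \<psi> = c *\<^sub>V op_poly H p \<psi>"
  by (subst op_poly_eq[of _ "degree p"]) (simp_all add: op_poly_def state.scale_sum_right degree_smult_le)

lemma op_poly_mult:
  assumes "is_op N H"
  shows "op_poly H (p * q) \<psi> = op_poly H p (op_poly H q \<psi>)"
proof (induction p)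
  case (pCons a p)
  have "op_poly H (pCons a p * q) \<psi> = a *\<^sub>V op_poly H q \<psi> + H (op_poly H p (op_poly H q \<psi>))"
    by (simp add: mult_pCons_left op_poly_add op_poly_smult op_poly_pCons[OF assms] pCons.IH)
  then show ?case by (simp add: op_poly_pCons[OF assms])
qed simp

lemma funpow_in_chain_space:
  assumes "is_op N H" "\<psi> \<in> chain_space N"
  shows "(H ^^ i) \<psi> \<in> chain_space N"
  using assms by (induction i) (auto simp: is_op_in_chain_space)

lemma id_op_chain_space: "\<psi> \<in> chain_space N \<Longrightarrow> id_op N \<psi> = \<psi>"
  by (auto simp: id_op_def chain_space_def fun_eq_iff)

lemma is_op_op_poly:
  assumes "is_op N H"
  shows "is_op N (op_poly H p \<circ> id_op N)"
  unfolding op_poly_def[abs_def] comp_def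
  by (intro is_op_setsum is_op_smult is_op_funpow[OF assms, unfolded comp_def])

lemma op_poly_eigenvector:
  assumes "is_op N H" "H \<psi> = E *\<^sub>V \<psi>"
  shows "op_poly H p \<psi> = poly p E *\<^sub>V \<psi>"
proof (induction p)
  case (pCons a p)
  then show ?case
    using assms by (simp add: op_poly_pCons is_op_scale state.scale_left_distrib mult.commute)
qed simp

text \<open>One more iterate of \<open>H\<close> is taken than there are configurations. Dependence
  is a property of the set of iterates, so a repetition among them does not produce it; that case
  yields the difference of two monomials instead.\<close>

lemma annihilating_poly_vector:
  assumes H: "is_op N H" and \<psi>: "\<psi> \<in> chain_space N"
  obtains q where "q \<noteq> 0" "op_poly H q \<psi> = 0"
proof -
  define v where "v i = (H ^^ i) \<psi>" for i
  let ?n = "card (configs N)"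
  show thesis
  proof (cases "inj_on v {..?n}")
    case True
    have "v ` {..?n} \<subseteq> chain_space N" by (auto simp: v_def funpow_in_chain_space[OF H \<psi>])
    moreover have "card (v ` {..?n}) = Suc ?n" using True by (simp add: card_image)
    ultimately have "state.dependent (v ` {..?n})"
      using independent_chain_space(2) by (metis Suc_n_not_le_n)
    then obtain u w where u: "w \<in> v ` {..?n}" "u w \<noteq> 0" "(\<Sum>w\<in>v ` {..?n}. u w *\<^sub>V w) = 0"
      by (auto simp: state.dependent_finite)
    define q where "q = (\<Sum>i\<le>?n. monom (u (v i)) i)"
    have coeff: "coeff q i = (if i \<le> ?n then u (v i) else 0)" for i
      by (simp add: q_def coeff_sum)
    have "degree q \<le> ?n" by (intro degree_le) (simp add: coeff)
    then have "op_poly H q \<psi> = (\<Sum>i\<le>?n. u (v i) *\<^sub>V v i)"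
      by (simp add: op_poly_eq[of q ?n] coeff v_def)
    also have "\<dots> = 0"
      using u(3) True by (simp add: sum.reindex)
    finally have "op_poly H q \<psi> = 0" .
    moreover have "q \<noteq> 0"
    proof -
      obtain i where "i \<le> ?n" "w = v i" using u(1) by auto
      then have "coeff q i \<noteq> 0" using coeff u(2) by simp
      then show ?thesis by auto
    qed
    ultimately show ?thesis using that by blast
  next
    case False
    then obtain i j where ij: "i < j" "v i = v j"
      by (auto simp: inj_on_def) (metis linorder_neqE_nat)
    let ?q = "monom 1 j - monom 1 i :: complex poly"
    have "degree ?q \<le> j" using ij by (intro degree_diff_le) (auto simp: degree_monom_eq)
    then have "op_poly H ?q \<psi> = (\<Sum>k\<le>j. (if k = j then v k else 0) - (if k = i then v k else 0))"
      using ij(1) by (auto simp: op_poly_eq[of ?q j] v_def intro!: sum.cong)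
    also have "\<dots> = 0"
      using ij by (simp add: sum_subtractf)
    finally have "op_poly H ?q \<psi> = 0" .
    moreover have "coeff ?q j = 1" using ij by simp
    then have "?q \<noteq> 0" by force
    ultimately show ?thesis using that by blast
  qed
qed

text \<open>The product over all kets of their annihilating polynomials works: the factors commute,
  so the one belonging to a given ket can be applied first.\<close>

lemma annihilating_poly:
  assumes H: "is_op N H"
  obtains q where "q \<noteq> 0" "\<And>\<psi>. \<psi> \<in> chain_space N \<Longrightarrow> op_poly H q \<psi> = 0"
proof -
  have "\<exists>q. q \<noteq> 0 \<and> op_poly H q (ket \<sigma>) = 0" if "\<sigma> \<in> configs N" for \<sigma>
  proof -
    have "ket \<sigma> \<in> chain_space N" using that by (auto simp: ket_def chain_space_def)
    then show ?thesis using annihilating_poly_vector[OF H] by metis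
  qed
  then obtain q where q: "\<And>\<sigma>. \<sigma> \<in> configs N \<Longrightarrow> q \<sigma> \<noteq> 0 \<and> op_poly H (q \<sigma>) (ket \<sigma>) = 0"
    by metis
  let ?q = "\<Prod>\<sigma>\<in>configs N. q \<sigma>"
  have id0: "op_poly H p 0 = 0" for p
    using is_op_zero[OF is_op_op_poly[OF H, of p]] is_op_zero[OF is_op_id] by (simp del: id_op_def)
  have "op_poly H ?q \<psi> = 0" if "\<psi> \<in> chain_space N" for \<psi>
  proof -
    have ket0: "op_poly H ?q (id_op N (ket \<sigma>)) = 0" if "\<sigma> \<in> configs N" for \<sigma>
    proof -
      have "ket \<sigma> \<in> chain_space N" using that by (auto simp: ket_def chain_space_def)
      moreover have "?q = (\<Prod>\<tau>\<in>configs N - {\<sigma>}. q \<tau>) * q \<sigma>"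
        using that by (subst prod.remove[of _ \<sigma>]) (auto simp: mult.commute)
      ultimately show ?thesis
        using q[OF that] by (simp add: id_op_chain_space op_poly_mult[OF H] id0)
    qed
    have "op_poly H ?q \<psi> = (op_poly H ?q \<circ> id_op N) (\<Sum>\<sigma>\<in>configs N. \<psi> \<sigma> *\<^sub>V ket \<sigma>)"
      using that by (simp add: chain_space_expand id_op_chain_space)
    also have "\<dots> = 0"
      unfolding is_op_sum[OF is_op_op_poly[OF H]] is_op_scale[OF is_op_op_poly[OF H]]
      using ket0 by simp
    finally show ?thesis .
  qed
  moreover have "?q \<noteq> 0" using q by simp
  ultimately show thesis using that by blast
qed

section \<open>Self-adjointness and the spectral projection\<close>

definition braket :: "nat \<Rightarrow> state \<Rightarrow> state \<Rightarrow> complex" where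
  "braket N \<phi> \<psi> = (\<Sum>\<sigma>\<in>configs N. cnj (\<phi> \<sigma>) * \<psi> \<sigma>)"

definition self_adjoint :: "nat \<Rightarrow> (state \<Rightarrow> state) \<Rightarrow> bool" where
  "self_adjoint N A \<longleftrightarrow> (\<forall>\<phi> \<psi>. braket N (A \<phi>) \<psi> = braket N \<phi> (A \<psi>))"

lemma braket_zero_imp:
  assumes "braket N \<psi> \<psi> = 0" "\<psi> \<in> chain_space N"
  shows "\<psi> = 0"
proof
  fix \<sigma>
  have "of_real (\<Sum>\<tau>\<in>configs N. (cmod (\<psi> \<tau>))\<^sup>2) = braket N \<psi> \<psi>"
    unfolding braket_def of_real_sum by (intro sum.cong refl) (simp only: complex_norm_square mult.commute)
  then have "(\<Sum>\<tau>\<in>configs N. (cmod (\<psi> \<tau>))\<^sup>2) = 0"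
    using assms(1) by (metis of_real_eq_0_iff)
  then show "\<psi> \<sigma> = 0 \<sigma>"
    using assms(2) by (cases "\<sigma> \<in> configs N") (auto simp: sum_nonneg_eq_0_iff chain_space_def)
qed

text \<open>A self-adjoint operator has no Jordan blocks: \<open>w\<close> is the image of \<psi>
  under H - E, and it is annihilated by H - E again.\<close>

lemma self_adjoint_kernel:
  assumes H: "is_op N H" "self_adjoint N H" and \<psi>: "\<psi> \<in> chain_space N"
    and w: "w = H \<psi> - E *\<^sub>V \<psi>" "H w = E *\<^sub>V w"
  shows "w = 0"
proof (rule braket_zero_imp)
  have adj: "braket N (H \<phi>) \<xi> = braket N \<phi> (H \<xi>)" for \<phi> \<xi>
    using H(2) by (simp add: self_adjoint_def)
  have right: "braket N \<phi> (E *\<^sub>V \<xi>) = E * braket N \<phi> \<xi>" for \<phi> \<xi>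
    by (simp add: braket_def cscale_def sum_distrib_left mult_ac)
  have left: "braket N (E *\<^sub>V \<phi>) \<xi> = cnj E * braket N \<phi> \<xi>" for \<phi> \<xi>
    by (simp add: braket_def cscale_def sum_distrib_left mult_ac)
  have "cnj E * braket N w w = E * braket N w w"
    using adj[of w w] by (simp add: w(2) left right)
  moreover have "braket N w w = (cnj E - E) * braket N w \<psi>"
  proof -
    have "braket N w w = braket N w (H \<psi>) - braket N w (E *\<^sub>V \<psi>)"
      by (subst (2) w(1)) (simp add: braket_def algebra_simps sum_subtractf)
    then show ?thesis
      by (simp add: adj[symmetric] w(2) left right algebra_simps)
  qed
  \<comment> \<open>\<open>E\<close> may be any complex number: if it is not real the first equation
    forces this, and if it is real the second does.\<close>
  ultimately show "braket N w w = 0" by auto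
  show "w \<in> chain_space N"
    using is_op_in_chain_space[OF H(1)] \<psi> by (auto simp: w(1) chain_space_def cscale_def)
qed

text \<open>Split the largest power of X - E off an annihilating polynomial. The cofactor
  \<open>r\<close> maps everything into the generalised eigenspace for \<open>E\<close>, which by
  self-adjointness is the eigenspace, and r(E) is not zero. The multiplicity \<open>m\<close> may be
  0; then \<open>r\<close> itself annihilates.\<close>

lemma spectral_projection:
  assumes H: "is_op N H" "self_adjoint N H" and "E \<noteq> 0"
  obtains p where "coeff p 0 = 0"
    "\<And>\<psi>. \<psi> \<in> chain_space N \<Longrightarrow> H (op_poly H p \<psi>) = E *\<^sub>V op_poly H p \<psi>"
    "\<And>\<psi>. H \<psi> = E *\<^sub>V \<psi> \<Longrightarrow> op_poly H p \<psi> = \<psi>"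
proof -
  obtain q where q: "q \<noteq> 0" "\<And>\<psi>. \<psi> \<in> chain_space N \<Longrightarrow> op_poly H q \<psi> = 0"
    using annihilating_poly[OF H(1)] by blast
  obtain m r where r: "q = [:- E, 1:] ^ m * r" "\<not> [:- E, 1:] dvd r"
    using order_decomp[OF q(1)] by blast
  have lin: "op_poly H [:- E, 1:] \<psi> = H \<psi> - E *\<^sub>V \<psi>" for \<psi>
    by (simp add: op_poly_pCons[OF H(1)] is_op_zero[OF H(1)] fun_eq_iff cscale_def)
  have chain: "op_poly H s \<psi> \<in> chain_space N" if "\<psi> \<in> chain_space N" for s \<psi>
    using is_op_in_chain_space[OF is_op_op_poly[OF H(1)], of s \<psi>] that by (simp add: id_op_chain_space)
  have kernel: "H u = E *\<^sub>V u" if "op_poly H ([:- E, 1:] ^ m) u = 0" "u \<in> chain_space N" for m u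
    using that
  proof (induction m arbitrary: u)
    case 0
    then have "u = 0" by (simp add: op_poly_def fun_eq_iff)
    show ?case unfolding \<open>u = 0\<close> is_op_zero[OF H(1)] cscale_zero ..
  next
    case (Suc m)
    let ?w = "H u - E *\<^sub>V u"
    have "op_poly H ([:- E, 1:] ^ m) ?w = 0"
      using Suc.prems(1) by (simp only: power_Suc2 op_poly_mult[OF H(1)] lin)
    moreover have "?w \<in> chain_space N"
      using chain[OF Suc.prems(2)] lin by metis
    ultimately have "H ?w = E *\<^sub>V ?w" by (rule Suc.IH)
    then have "?w = 0" by (rule self_adjoint_kernel[OF H Suc.prems(2) refl])
    then show ?case by simp
  qed
  have eig: "H (op_poly H r \<psi>) = E *\<^sub>V op_poly H r \<psi>" if "\<psi> \<in> chain_space N" for \<psi>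
    using q(2)[OF that] chain[OF that] unfolding r(1) op_poly_mult[OF H(1)] by (intro kernel)
  have rE: "poly r E \<noteq> 0" using r(2) by (simp add: poly_eq_0_iff_dvd)
  \<comment> \<open>This is X r(X) / (E r(E)): the factor X removes the constant term, and the
    scalar normalises the value at \<open>E\<close> to 1, which is where \<open>E \<noteq> 0\<close>
    enters.\<close>
  let ?p = "smult (1 / (E * poly r E)) (pCons 0 r)"
  show thesis
  proof (rule that[of ?p])
    show "H (op_poly H ?p \<psi>) = E *\<^sub>V op_poly H ?p \<psi>" if "\<psi> \<in> chain_space N" for \<psi>
      by (simp add: op_poly_smult op_poly_pCons[OF H(1)] eig[OF that] is_op_scale[OF H(1)] mult_ac)
    show "op_poly H ?p \<psi> = \<psi>" if "H \<psi> = E *\<^sub>V \<psi>" for \<psi>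
      using rE \<open>E \<noteq> 0\<close> by (simp add: op_poly_eigenvector[OF H(1) that])
  qed simp
qed

lemma dim_eigenspaces_eq:
  assumes H: "is_op N H" "self_adjoint N H" and F: "is_op N F" "F \<circ> F = id_op N" and HF: "H \<circ> F = F \<circ> H"
    and trace: "\<And>k. trace_op N (F \<circ> (H ^^ Suc k \<circ> id_op N)) = 0" and "E \<noteq> 0"
  defines "W \<equiv> \<lambda>\<epsilon>. {\<psi> \<in> chain_space N. F \<psi> = \<epsilon> *\<^sub>V \<psi> \<and> H \<psi> = E *\<^sub>V \<psi>}"
  shows "state.dim (W 1) = state.dim (W (- 1))"
proof -
  obtain p where p: "coeff p 0 = 0"
    "\<And>\<psi>. \<psi> \<in> chain_space N \<Longrightarrow> H (op_poly H p \<psi>) = E *\<^sub>V op_poly H p \<psi>"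
    "\<And>\<psi>. H \<psi> = E *\<^sub>V \<psi> \<Longrightarrow> op_poly H p \<psi> = \<psi>"
    using spectral_projection[OF H \<open>E \<noteq> 0\<close>] by blast
  define P where "P = op_poly H p \<circ> id_op N"
  have P: "is_op N P" unfolding P_def by (rule is_op_op_poly[OF H(1)])
  have HP: "H (P \<psi>) = E *\<^sub>V P \<psi>" for \<psi>
    using p(2)[of "id_op N \<psi>"] is_op_in_chain_space[OF is_op_id] by (simp add: P_def)
  have FF: "F (F (P \<psi>)) = P \<psi>" for \<psi>
    using F(2)[THEN fun_cong, of "P \<psi>"] is_op_in_chain_space[OF P] by (simp add: id_op_chain_space)
  have HFP: "H (F \<psi>) = F (H \<psi>)" for \<psi>
    using HF[THEN fun_cong, of \<psi>] by simp
  have FP: "trace_op N (F \<circ> P) = 0"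
  proof -
    have "trace_op N (F \<circ> P) = (\<Sum>i\<le>degree p. coeff p i * trace_op N (F \<circ> (H ^^ i \<circ> id_op N)))"
    proof -
      have "F \<circ> P = (\<lambda>\<psi>. \<Sum>i\<le>degree p. coeff p i *\<^sub>V (F \<circ> (H ^^ i \<circ> id_op N)) \<psi>)"
        by (rule ext) (simp add: P_def op_poly_def is_op_sum[OF F(1)] is_op_scale[OF F(1)])
      then show ?thesis
        by (simp only: trace_op_setsum trace_op_smult)
    qed
    also have "\<dots> = 0"
    proof (intro sum.neutral ballI)
      fix i assume "i \<in> {..degree p}"
      show "coeff p i * trace_op N (F \<circ> (H ^^ i \<circ> id_op N)) = 0"
        using p(1) trace by (cases i) (simp_all del: funpow.simps)
    qed
    finally show ?thesis .
  qed
  have dim: "of_nat (state.dim (W \<epsilon>)) = 1 / 2 * trace_op N P" if \<epsilon>: "\<epsilon> * \<epsilon> = 1" for \<epsilon>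
  proof -
    \<comment> \<open>The projection (1 + \<epsilon> F) / 2 onto the sector, composed with
      \<open>P\<close>. As Tr (F P) = 0, its trace does not depend on the sign.\<close>
    let ?Q = "\<lambda>\<psi>. (1 / 2) *\<^sub>V (P \<psi> + \<epsilon> *\<^sub>V (F \<circ> P) \<psi>)"
    have Q: "is_op N ?Q" by (intro is_op_smult is_op_plus is_op_comp P F)
    have "of_nat (state.dim (W \<epsilon>)) = trace_op N ?Q"
    proof (rule dim_eq_trace[OF Q])
      show "state.subspace (W \<epsilon>)"
        unfolding W_def
        by (auto intro!: state.subspaceI simp: is_op_zero[OF H(1)] is_op_zero[OF F(1)] is_op_add[OF H(1)] is_op_add[OF F(1)]
            is_op_scale[OF H(1)] is_op_scale[OF F(1)] state.scale_right_distrib mult.commute)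
          (auto simp: chain_space_def cscale_def)
      show "?Q \<psi> \<in> W \<epsilon>" for \<psi>
      proof -
        have "F (?Q \<psi>) = (1 / 2) *\<^sub>V (F (P \<psi>) + \<epsilon> *\<^sub>V P \<psi>)"
          by (simp add: is_op_scale[OF F(1)] is_op_add[OF F(1)] FF)
        also have "\<dots> = \<epsilon> *\<^sub>V ?Q \<psi>"
          using \<epsilon> by (simp add: state.scale_right_distrib mult_ac add.commute)
        finally have "F (?Q \<psi>) = \<epsilon> *\<^sub>V ?Q \<psi>" .
        moreover have "H (?Q \<psi>) = E *\<^sub>V ?Q \<psi>"
          by (simp add: is_op_scale[OF H(1)] is_op_add[OF H(1)] HFP HP is_op_scale[OF F(1)] state.scale_right_distrib mult_ac)
        ultimately show ?thesis
          unfolding W_def using is_op_in_chain_space[OF Q] by blast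
      qed
      show "?Q u = u" if "u \<in> W \<epsilon>" for u
      proof -
        have u: "P u = u" "F u = \<epsilon> *\<^sub>V u"
          using that p(3) by (auto simp: W_def P_def id_op_chain_space)
        show ?thesis
          using \<epsilon> by (simp add: u fun_eq_iff cscale_def mult.assoc[symmetric])
      qed
    qed
    also have "\<dots> = 1 / 2 * trace_op N P"
      by (simp only: trace_op_smult trace_op_plus FP) simp
    finally show ?thesis .
  qed
  have "(of_nat (state.dim (W 1)) :: complex) = of_nat (state.dim (W (- 1)))"
  proof -
    have "of_nat (state.dim (W 1)) = 1 / 2 * trace_op N P" by (rule dim) simp
    moreover have "of_nat (state.dim (W (- 1))) = 1 / 2 * trace_op N P" by (rule dim) simp
    ultimately show ?thesis by (simp only:)
  qed
  then show ?thesis by (simp only: of_nat_eq_iff)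
qed

section \<open>The eigenspaces of the Hamiltonian\<close>

text \<open>The twisted translation is unitary: it permutes the kets up to signs, and
  \<open>twist\<close> is real.\<close>

lemma braket_shift:
  assumes "N > 0"
  shows "braket N (shift N \<phi>) \<psi> = braket N \<phi> (unshift N \<psi>)"
proof -
  have "braket N \<phi> (unshift N \<psi>) = (\<Sum>\<sigma>\<in>configs N. cnj (\<phi> (rotate1 \<sigma>)) * unshift N \<psi> (rotate1 \<sigma>))"
    unfolding braket_def by (rule sum_rotate1[symmetric])
  also have "\<dots> = braket N (shift N \<phi>) \<psi>"
    unfolding braket_def
    by (intro sum.cong refl) (use assms in \<open>auto simp: shift_def unshift_def last_rotate1
        last_butlast_rotate1 configs_nonempty twist_def\<close>)
  finally show ?thesis by simp
qed

lemma braket_cnj: "braket N \<psi> \<phi> = cnj (braket N \<phi> \<psi>)"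
  by (simp add: braket_def mult.commute)

lemma self_adjoint_translate:
  assumes "N > 0" "self_adjoint N A"
  shows "self_adjoint N (translate N k A)"
proof (induction k)
  case (Suc k)
  have "braket N \<phi> (shift N \<psi>) = braket N (unshift N \<phi>) \<psi>" for \<phi> \<psi>
    unfolding braket_cnj[of N \<phi> "shift N \<psi>"] braket_cnj[of N "unshift N \<phi>" \<psi>] braket_shift[OF assms(1)] ..
  then show ?case
    using Suc braket_shift[OF assms(1)] by (simp add: self_adjoint_def)
qed (simp add: assms)

lemma self_adjoint_kop:
  assumes "\<And>\<sigma> \<tau>. cnj (m \<tau> \<sigma>) = m \<sigma> \<tau>"
  shows "self_adjoint N (kop N m)"
  unfolding self_adjoint_def
proof (intro allI)
  fix \<phi> \<psi>
  have "braket N (kop N m \<phi>) \<psi> = (\<Sum>\<sigma>\<in>configs N. \<Sum>\<tau>\<in>configs N. m \<tau> \<sigma> * cnj (\<phi> \<tau>) * \<psi> \<sigma>)"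
    by (simp add: braket_def kop_def sum_distrib_right assms)
  also have "\<dots> = (\<Sum>\<tau>\<in>configs N. \<Sum>\<sigma>\<in>configs N. m \<tau> \<sigma> * cnj (\<phi> \<tau>) * \<psi> \<sigma>)"
    by (rule sum.swap)
  also have "\<dots> = braket N \<phi> (kop N m \<psi>)"
    by (simp add: braket_def kop_def sum_distrib_left mult_ac)
  finally show "braket N (kop N m \<phi>) \<psi> = braket N \<phi> (kop N m \<psi>)" .
qed

lemma self_adjoint_xxz:
  assumes "N > 0"
  shows "self_adjoint N (xxz N (of_real x))"
proof -
  have "cnj (bond_weight (of_real x) a b c d) = bond_weight (of_real x) c d a b" for a b c d
    using exhaust_3[of a] exhaust_3[of b] exhaust_3[of c] exhaust_3[of d]
    by (elim disjE; hypsubst; simp add: bond_weight_def)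
  then have "self_adjoint N (pair_op N (bond_weight (of_real x)))"
    unfolding pair_op_def by (intro self_adjoint_kop) (simp add: pair_kernel_def)
  then have "self_adjoint N (translate N k (pair_op N (bond_weight (of_real x))))" for k
    by (rule self_adjoint_translate[OF assms])
  then have "braket N (translate N k (pair_op N (bond_weight (of_real x))) \<phi>) \<psi>
    = braket N \<phi> (translate N k (pair_op N (bond_weight (of_real x))) \<psi>)" for k \<phi> \<psi>
    by (simp add: self_adjoint_def)
  moreover have "braket N (\<Sum>k\<in>I. f k) \<psi> = (\<Sum>k\<in>I. braket N (f k) \<psi>)"
    "braket N \<psi> (\<Sum>k\<in>I. f k) = (\<Sum>k\<in>I. braket N \<psi> (f k))" for f \<psi> and I :: "nat set"
    unfolding braket_def sum_fun_apply cnj_sum sum_distrib_left sum_distrib_right by (rule sum.swap)+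
  ultimately show ?thesis
    by (simp add: self_adjoint_def xxz_def bond_sum_def)
qed

text \<open>The density is invariant under flipping both sites, and the twist takes the same value
  on up and down, so all translates inherit the symmetry.\<close>

lemma xxz_spin_reversal:
  assumes "N \<ge> 2"
  shows "xxz N x \<circ> spin_reversal N = spin_reversal N \<circ> xxz N x"
proof -
  let ?F = "spin_reversal N" and ?h = "pair_op N (bond_weight x)"
  have N0: "N > 0" using assms by simp
  have weight: "bond_weight x (flip a) (flip b) (flip c) (flip d) = bond_weight x a b c d" for a b c d
    using exhaust_3[of a] exhaust_3[of b] exhaust_3[of c] exhaust_3[of d]
    by (elim disjE; hypsubst; simp add: bond_weight_def flip_def)
  have reidx: "(\<Sum>a\<in>UNIV. f (flip a)) = (\<Sum>a\<in>UNIV. f a)" for f :: "3 \<Rightarrow> complex"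
    by (rule sum.reindex_bij_witness[of _ flip flip]) auto
  have "?h \<circ> ?F = ?F \<circ> ?h"
  proof (intro ext)
    fix \<psi> \<sigma>
    obtain n where n: "N = Suc (Suc n)" using assms by (metis add_2_eq_Suc le_Suc_ex)
    show "(?h \<circ> ?F) \<psi> \<sigma> = (?F \<circ> ?h) \<psi> \<sigma>"
    proof (cases "\<sigma> \<in> configs N")
      case True
      then obtain a b \<rho> where \<sigma>: "\<sigma> = a # b # \<rho>" using configs_Suc_Suc n by metis
      have mem: "flip a # flip b # map flip \<rho> \<in> configs N" "c # d # \<rho> \<in> configs N" for c d
        using True by (simp_all add: \<sigma> configs_def)
      have "(?F \<circ> ?h) \<psi> \<sigma> = (\<Sum>c\<in>UNIV. \<Sum>d\<in>UNIV. bond_weight x (flip a) (flip b) c d * \<psi> (c # d # map flip \<rho>))"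
        using True mem(1) by (simp add: spin_reversal_eq \<sigma> pair_op_apply)
      also have "\<dots> = (\<Sum>c\<in>UNIV. \<Sum>d\<in>UNIV. bond_weight x (flip a) (flip b) c (flip d) * \<psi> (c # flip d # map flip \<rho>))"
        by (intro sum.cong refl reidx[symmetric])
      also have "\<dots> = (\<Sum>c\<in>UNIV. \<Sum>d\<in>UNIV. bond_weight x (flip a) (flip b) (flip c) (flip d) * \<psi> (flip c # flip d # map flip \<rho>))"
        by (rule reidx[symmetric])
      also have "\<dots> = (?h \<circ> ?F) \<psi> \<sigma>"
        using True mem(2) by (simp add: weight \<sigma> pair_op_apply spin_reversal_eq)
      finally show ?thesis by simp
    qed (simp add: spin_reversal_eq is_op_outside[OF is_op_pair_op])
  qed
  moreover have "unshift N \<circ> ?F = ?F \<circ> unshift N"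
  proof (intro ext)
    fix \<psi> \<sigma>
    show "(unshift N \<circ> ?F) \<psi> \<sigma> = (?F \<circ> unshift N) \<psi> \<sigma>"
    proof (cases "\<sigma> \<in> configs N")
      case True
      then have "\<sigma> \<noteq> []" by (rule configs_nonempty[OF N0])
      then have "last (map flip \<sigma>) # butlast (map flip \<sigma>) = map flip (last \<sigma> # butlast \<sigma>)"
        "twist (last (map flip \<sigma>)) = twist (last \<sigma>)"
        by (simp_all add: last_map map_butlast)
      then show ?thesis
        using True last_butlast_configs[OF N0 True] by (simp add: unshift_def spin_reversal_eq del: list.map)
    qed (simp add: unshift_def spin_reversal_eq)
  qed
  ultimately have comm: "translate N k ?h \<circ> ?F = ?F \<circ> translate N k ?h" for k
  proof (induction k)
    case (Suc k)
    have "translate N (Suc k) ?h \<circ> ?F = shift N \<circ> (translate N k ?h \<circ> (unshift N \<circ> ?F))"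
      by (simp only: translate.simps comp_assoc)
    also have "\<dots> = shift N \<circ> ((translate N k ?h \<circ> ?F) \<circ> unshift N)"
      by (simp only: Suc.prems comp_assoc)
    also have "\<dots> = (shift N \<circ> ?F) \<circ> translate N k ?h \<circ> unshift N"
      by (simp only: Suc.IH[OF Suc.prems] comp_assoc)
    also have "\<dots> = ?F \<circ> translate N (Suc k) ?h"
      by (simp only: shift_spin_reversal translate.simps comp_assoc)
    finally show ?case .
  qed simp
  have "translate N k ?h (?F \<psi>) = ?F (translate N k ?h \<psi>)" for k \<psi>
    using comm[of k, THEN fun_cong, of \<psi>] by simp
  then show ?thesis
    by (intro ext) (simp add: xxz_def bond_sum_def is_op_sum[OF is_op_spin_reversal])
qed

theorem proposition2p1:
  fixes N :: nat and x :: real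
  assumes "N \<ge> 2"
  shows "\<forall>E::complex. E \<noteq> 0 \<longrightarrow>
    state.dim (sector_eigenspace N x 1 E) = state.dim (sector_eigenspace N x (- 1) E)"
proof (intro allI impI)
  fix E :: complex
  assume "E \<noteq> 0"
  have N0: "N > 0" using assms by simp
  have "sector_eigenspace N x \<epsilon> E
    = {\<psi> \<in> chain_space N. spin_reversal N \<psi> = \<epsilon> *\<^sub>V \<psi> \<and> xxz N (of_real x) \<psi> = E *\<^sub>V \<psi>}" for \<epsilon>
    by (auto simp: sector_eigenspace_def sector_def hamiltonian_eq_bond_sum[OF assms] xxz_def)
  then show "state.dim (sector_eigenspace N x 1 E) = state.dim (sector_eigenspace N x (- 1) E)"
    using dim_eigenspaces_eq[OF is_op_xxz[OF N0] self_adjoint_xxz[OF N0] is_op_spin_reversal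
        spin_reversal_involution xxz_spin_reversal[OF assms] trace_spin_reversal_xxz_power[OF assms] \<open>E \<noteq> 0\<close>]
    by (simp only:)
qed

end
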